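(* Let $\omega_1,\omega_2\in\mathscr P_Q(\mathbf R^{2d})$, let $v\in\mathscr P_E(\mathbf R^{2d})$ be submultiplicative, and let $\mathscr B$ be either an invariant BF-space on $\mathbf R^{2d}$ with respect to $v$, or a mixed quasi-normed space of Lebesgue type on $\mathbf R^{2d}$. Let $i$ be the injection $$i: M(\omega_1,\mathscr B)\to M(\omega_2,\mathscr B),\qquad i(f)=f. \qquad ( * )$$ Then the following is true: (1) if $\omega_2/\omega_1\in L^\infty_0(\mathbf R^{2d})$, then the map $( * )$ is compact; (2) if in addition $\omega_1,\omega_2\in\mathscr P_E(\mathbf R^{2d})$ and $v$ is bounded, then the map $( * )$ is compact if and only if $\omega_2/\omega_1\in L^\infty_0(\mathbf R^{2d})$.
   Context: Notation: $f(\theta)\lesssim g(\theta)$ means $f(\theta)\le c\,g(\theta)$ for a constant $c>0$ independent of $\theta$. "The map $( * )$ is compact" includes that it is well defined, i.e. $M(\omega_1,\mathscr B)\subseteq M(\omega_2,\mathscr B)$. Weights. A weight on $\mathbf R^n$ is a positive function $\omega$ with $\omega,1/\omega\in L^\infty_{loc}(\mathbf R^n)$. $\mathscr P_E(\mathbf R^n)$ is the set of moderate weights: weights $\omega$ for which there is a weight $v$ with $\omega(x_1+x_2)\lesssim\omega(x_1)v(x_2)$ for all $x_1,x_2\in\mathbf R^n$ (then $v$ can be chosen as $e^{r|\cdot|}$ for some $r>0$). A weight $v$ is submultiplicative if it is even and $v(x_1+x_2)\lesssim v(x_1)v(x_2)$. $\mathscr P_Q(\mathbf R^n)$ is the set of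 all weights $\omega$ such that for some constants $c,r>0$: $\omega(x)^2\lesssim\omega(x+y)\omega(x-y)\lesssim\omega(x)^2$ when $Rc\le|x|\le c/|y|$, $R\ge2$ (i.e. for all $x,y$ with $2c\le|x|\le c/|y|$), and $e^{-r|x|^2}\lesssim\omega(x)\lesssim e^{r|x|^2}$ for all $x$. $L^\infty_0(\mathbf R^n)$ is the set of $f\in L^\infty(\mathbf R^n)$ with $\lim_{R\to\infty}\operatorname{ess\,sup}_{|x|\ge R}|f(x)|=0$. Gelfand–Shilov space. $\Sigma_1(\mathbf R^n)$ is the Fréchet space of all $f\in C^\infty(\mathbf R^n)$ such that $\sup_{\alpha,\beta\in\mathbf N^n,\,x\in\mathbf R^n}\frac{|x^\beta\partial^\alpha f(x)|}{h^{|\alpha+\beta|}\alpha!\,\beta!}<\infty$ for every $h>0$ (these are its seminorms); $\Sigma_1'(\mathbf R^n)$ is its dual. Invariant BF-spaces. A Banach space $\mathscr B\subseteq L^1_{loc}(\mathbf R^n)$ which contains $\Sigma_1(\mathbf R^n)$ with continuous embedding is an invariant BF-space on $\mathbf R^n$ with respect to $v$ if there is a constant $C$ such that: (i) if $x\in\mathbf R^n$ and $f\in\mathscr B$, then $f(\cdot-x)\in\mathscr B$ and $\|f(\cdot-x)\|_{\mathscr B}\le Cv(x)\|f\|_{\mathscr B}$; (ii) if $f,g\in L^1_{loc}(\mathbf R^n)$, $g\in\mathscr B$ and $|f|\le|g|$, then $f\in\mathscr B$ and $\|f\|_{\mathscr B}\le C\|g\|_{\mathscr B}$. As in the paper, invariant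 BF-spaces are understood to satisfy Minkowski's inequality $\|f*\varphi\|_{\mathscr B}\le C\|f\|_{\mathscr B}\|\varphi v\|_{L^1}$ for $f\in\mathscr B$, $\varphi\in\Sigma_1(\mathbf R^n)$. Mixed quasi-normed spaces of Lebesgue type. These are the spaces $L^{\boldsymbol p}_E(\mathbf R^n)$, where $E=\{e_1,\dots,e_n\}$ is an ordered basis of $\mathbf R^n$ and $\boldsymbol p=(p_1,\dots,p_n)\in(0,\infty]^n$. With $r=\min(1,p_1,\dots,p_n)$, the space consists of all $f\in L^r_{loc}(\mathbf R^n)$ with $\|f\|_{L^{\boldsymbol p}_E}=\|g_{n-1}\|_{L^{p_n}(\mathbf R)}<\infty$, where $g_0(x_1,\dots,x_n)=|f(x_1e_1+\cdots+x_ne_n)|$ and $g_k(x_{k+1},\dots,x_n)=\|g_{k-1}(\cdot,x_{k+1},\dots,x_n)\|_{L^{p_k}(\mathbf R)}$ for $k=1,\dots,n-1$. They are translation invariant with respect to the weight $1$. Modulation spaces. Let $h_\alpha$, $\alpha\in\mathbf N^d$, be the ($L^2$-orthonormal) Hermite functions $h_\alpha(x)=\pi^{-d/4}(-1)^{|\alpha|}(2^{|\alpha|}\alpha!)^{-1/2}e^{|x|^2/2}\partial^\alpha e^{-|x|^2}$. $\mathcal H_\flat'(\mathbf R^d)$ is the set of formal expansions $f=\sum_{\alpha\in\mathbf N^d}c_\alpha(f)h_\alpha$ with $|c_\alpha(f)|\lesssim r^{|\alpha|}\alpha!^{1/2}$ for every $r>0$; it contains $\Sigma_1'(\mathbf R^d)$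 via $c_\alpha(f)=(f,h_\alpha)$. The Bargmann transform of $f\in\mathcal H_\flat'(\mathbf R^d)$ is the entire function $(\mathfrak V_df)(z)=\sum_\alpha c_\alpha(f)z^\alpha/\sqrt{\alpha!}$ on $\mathbf C^d$ (for $f\in L^2$ it equals $\pi^{-d/4}\int f(y)\exp(-\frac12(\langle z,z\rangle+|y|^2)+\sqrt2\langle z,y\rangle)\,dy$, with $\langle\cdot,\cdot\rangle$ bilinear). Let $\phi(x)=\pi^{-d/4}e^{-|x|^2/2}$. The short-time Fourier transform $V_\phi f$ of $f\in\mathcal H_\flat'(\mathbf R^d)$ is the function on $\mathbf R^{2d}$ determined by $$(\mathfrak V_df)(x+i\xi)=(2\pi)^{d/2}e^{\frac12(|x|^2+|\xi|^2)}e^{-i\langle x,\xi\rangle}(V_\phi f)(\sqrt2x,-\sqrt2\xi);$$ for $f\in L^2$ this is $V_\phi f(x,\xi)=(2\pi)^{-d/2}\int f(y)\overline{\phi(y-x)}e^{-i\langle y,\xi\rangle}\,dy$. For a weight $\omega$ on $\mathbf R^{2d}$, $M(\omega,\mathscr B)$ consists of all $f\in\mathcal H_\flat'(\mathbf R^d)$ such that $\|f\|_{M(\omega,\mathscr B)}=\|V_\phi f\cdot\omega\|_{\mathscr B}$ is finite. When $\omega\in\mathscr P_E(\mathbf R^{2d})$, the paper equivalently takes $f\in\Sigma_1'(\mathbf R^d)$ and any window in $\Sigma_1(\mathbf R^d)\setminus0$. *)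

theory Defs
  imports "HOL-Analysis.Analysis" "HOL-Probability.Essential_Supremum"
begin

section \<open>Weights\<close>

definition weight :: "('a::euclidean_space \<Rightarrow> real) \<Rightarrow> bool" where
  "weight \<omega> \<longleftrightarrow> (\<forall>x. 0 < \<omega> x) \<and> \<omega> \<in> borel_measurable lebesgue \<and>
     (\<forall>K. compact K \<longrightarrow> (\<exists>C. AE x in lebesgue. x \<in> K \<longrightarrow> \<omega> x \<le> C \<and> 1 / \<omega> x \<le> C))"

definition moderate_weights :: "('a::euclidean_space \<Rightarrow> real) set" where
  "moderate_weights = {\<omega>. weight \<omega> \<and>
     (\<exists>v. weight v \<and> (\<exists>C>0. \<forall>x y. \<omega> (x + y) \<le> C * \<omega> x * v y))}"

definition submultiplicative :: "('a::euclidean_space \<Rightarrow> real) \<Rightarrow> bool" where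
  "submultiplicative v \<longleftrightarrow> weight v \<and> (\<forall>x. v (- x) = v x) \<and>
     (\<exists>C>0. \<forall>x y. v (x + y) \<le> C * v x * v y)"

text \<open>The condition \<open>|x| \<le> c / |y|\<close> is written as \<open>|x| |y| \<le> c\<close>, so that it is void
  (and not \<open>|x| \<le> 0\<close>) for \<open>y = 0\<close>.\<close>

definition PQ_weights :: "('a::euclidean_space \<Rightarrow> real) set" where
  "PQ_weights = {\<omega>. weight \<omega> \<and> (\<exists>c>0. \<exists>r>0.
     (\<exists>C>0. \<forall>x y. 2 * c \<le> norm x \<and> norm x * norm y \<le> c \<longrightarrow>
        (\<omega> x)\<^sup>2 \<le> C * (\<omega> (x + y) * \<omega> (x - y)) \<and> \<omega> (x + y) * \<omega> (x - y) \<le> C * (\<omega> x)\<^sup>2) \<and>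
     (\<exists>C>0. \<forall>x. exp (- r * (norm x)\<^sup>2) \<le> C * \<omega> x \<and> \<omega> x \<le> C * exp (r * (norm x)\<^sup>2)))}"

definition Linfty0 :: "('a::euclidean_space \<Rightarrow> real) set" where
  "Linfty0 = {f. f \<in> borel_measurable lebesgue \<and>
     esssup lebesgue (\<lambda>x. ennreal \<bar>f x\<bar>) < \<infinity> \<and>
     ((\<lambda>R. esssup lebesgue (\<lambda>x. indicator {x. R \<le> norm x} x * ennreal \<bar>f x\<bar>)) \<longlongrightarrow> 0) at_top}"


section \<open>The Gelfand--Shilov space\<close>

definition partial_deriv :: "'a::euclidean_space \<Rightarrow> ('a \<Rightarrow> complex) \<Rightarrow> 'a \<Rightarrow> complex" where
  "partial_deriv b f x = vector_derivative (\<lambda>t. f (x + t *\<^sub>R b)) (at 0)"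

definition smooth :: "('a::euclidean_space \<Rightarrow> complex) \<Rightarrow> bool" where
  "smooth f \<longleftrightarrow> (\<forall>bs\<in>lists Basis. continuous_on UNIV (foldr partial_deriv bs f) \<and>
     (\<forall>b\<in>Basis. \<forall>x. (\<lambda>t. foldr partial_deriv bs f (x + t *\<^sub>R b)) differentiable at 0))"

text \<open>Multi-indices on \<^typ>\<open>'a\<close> are functions \<^typ>\<open>'a \<Rightarrow> nat\<close> of which only the values on
  \<^const>\<open>Basis\<close> are ever used. The order in which the partial derivatives are taken
  is irrelevant for smooth functions.\<close>

definition multi_deriv :: "('a::euclidean_space \<Rightarrow> nat) \<Rightarrow> ('a \<Rightarrow> complex) \<Rightarrow> 'a \<Rightarrow> complex" where
  "multi_deriv \<alpha> f =
     foldr partial_deriv (SOME bs. set bs \<subseteq> Basis \<and> (\<forall>b\<in>Basis. count_list bs b = \<alpha> b)) f"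

definition Sigma1_seminorm :: "real \<Rightarrow> ('a::euclidean_space \<Rightarrow> complex) \<Rightarrow> ennreal" where
  "Sigma1_seminorm h f = (SUP (\<alpha>, \<beta>, x)\<in>UNIV.
     ennreal (norm (of_real (\<Prod>b\<in>Basis. (x \<bullet> b) ^ \<beta> b) * multi_deriv \<alpha> f x) /
       (h ^ (\<Sum>b\<in>Basis. \<alpha> b + \<beta> b) * (\<Prod>b\<in>Basis. fact (\<alpha> b)) * (\<Prod>b\<in>Basis. fact (\<beta> b)))))"

definition Sigma1 :: "('a::euclidean_space \<Rightarrow> complex) set" where
  "Sigma1 = {f. smooth f \<and> (\<forall>h>0. Sigma1_seminorm h f < \<infinity>)}"


section \<open>Function spaces\<close>

text \<open>A (quasi-)normed space of classes of functions modulo equality almost everywhere is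
  given by the set \<open>B\<close> of all representatives of its elements, which is closed under
  modification on null sets, together with the (quasi-)norm \<open>N\<close>; only the
  values of \<open>N\<close> on \<open>B\<close> matter.\<close>

definition Lloc :: "real \<Rightarrow> ('a::euclidean_space \<Rightarrow> complex) set" where
  "Lloc r = {f \<in> borel_measurable lebesgue. \<forall>K. compact K \<longrightarrow>
     (\<integral>\<^sup>+x\<in>K. ennreal (norm (f x) powr r) \<partial>lebesgue) < \<infinity>}"

locale Banach_function_space =
  fixes B :: "('a::euclidean_space \<Rightarrow> complex) set" and N :: "('a \<Rightarrow> complex) \<Rightarrow> real"
  assumes subset_L1loc: "B \<subseteq> Lloc 1"
    and AE_closed: "f \<in> B \<Longrightarrow> g \<in> borel_measurable lebesgue \<Longrightarrow> (AE x in lebesgue. f x = g x) \<Longrightarrow>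
      g \<in> B \<and> N g = N f"
    and zero_mem: "(\<lambda>_. 0) \<in> B"
    and add_mem: "f \<in> B \<Longrightarrow> g \<in> B \<Longrightarrow> (\<lambda>x. f x + g x) \<in> B"
    and scale_mem: "f \<in> B \<Longrightarrow> (\<lambda>x. a * f x) \<in> B"
    and norm_nonneg: "f \<in> B \<Longrightarrow> 0 \<le> N f"
    and norm_eq_0_iff: "f \<in> B \<Longrightarrow> N f = 0 \<longleftrightarrow> (AE x in lebesgue. f x = 0)"
    and norm_triangle: "f \<in> B \<Longrightarrow> g \<in> B \<Longrightarrow> N (\<lambda>x. f x + g x) \<le> N f + N g"
    and norm_scale: "f \<in> B \<Longrightarrow> N (\<lambda>x. a * f x) = norm a * N f"
    and complete: "(\<And>n. F n \<in> B) \<Longrightarrow>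
      (\<And>e. 0 < e \<Longrightarrow> \<exists>M. \<forall>m\<ge>M. \<forall>n\<ge>M. N (\<lambda>x. F m x - F n x) < e) \<Longrightarrow>
      \<exists>g\<in>B. (\<lambda>n. N (\<lambda>x. F n x - g x)) \<longlonglongrightarrow> 0"

definition convolution ::
    "('a::euclidean_space \<Rightarrow> complex) \<Rightarrow> ('a \<Rightarrow> complex) \<Rightarrow> 'a \<Rightarrow> complex" where
  "convolution f g x = (LINT y|lebesgue. f (x - y) * g y)"

text \<open>The seminorms of \<^const>\<open>Sigma1\<close> increase as \<open>h\<close> decreases. Hence continuity of the
  inclusion into \<open>B\<close> means that the norm of \<open>B\<close> is dominated by a multiple of a
  single one of them.\<close>

locale invariant_BF_space = Banach_function_space B N
  for v :: "'a::euclidean_space \<Rightarrow> real"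
    and B :: "('a \<Rightarrow> complex) set" and N :: "('a \<Rightarrow> complex) \<Rightarrow> real" +
  assumes Sigma1_subset: "Sigma1 \<subseteq> B"
    and Sigma1_continuous:
      "\<exists>h>0. \<exists>C\<ge>0. \<forall>f\<in>Sigma1. ennreal (N f) \<le> ennreal C * Sigma1_seminorm h f"
    and invariance: "\<exists>C.
      (\<forall>x. \<forall>f\<in>B. (\<lambda>y. f (y - x)) \<in> B \<and> N (\<lambda>y. f (y - x)) \<le> C * v x * N f) \<and>
      (\<forall>f\<in>Lloc 1. \<forall>g\<in>Lloc 1. g \<in> B \<and> (AE x in lebesgue. norm (f x) \<le> norm (g x)) \<longrightarrow>
         f \<in> B \<and> N f \<le> C * N g) \<and>
      (\<forall>f\<in>B. \<forall>\<phi>\<in>Sigma1. convolution f \<phi> \<in> B \<and>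
         N (convolution f \<phi>) \<le> C * N f * (LINT x|lebesgue. norm (\<phi> x) * v x))"

definition ennreal_powr :: "ennreal \<Rightarrow> real \<Rightarrow> ennreal" where
  "ennreal_powr x p = (if x = \<infinity> then \<infinity> else ennreal (enn2real x powr p))"

definition Lp_norm :: "ennreal \<Rightarrow> (real \<Rightarrow> ennreal) \<Rightarrow> ennreal" where
  "Lp_norm p g = (if p = \<infinity> then esssup lebesgue g
     else ennreal_powr (\<integral>\<^sup>+t. ennreal_powr (g t) (enn2real p) \<partial>lebesgue) (1 / enn2real p))"

text \<open>A function of \<open>n\<close> real variables is encoded as a function of lists of length \<open>n\<close>;
  the first variable is integrated out first.\<close>

fun iterated_Lp_norm :: "ennreal list \<Rightarrow> (real list \<Rightarrow> ennreal) \<Rightarrow> ennreal" where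
  "iterated_Lp_norm [] g = g []"
| "iterated_Lp_norm (p # ps) g = iterated_Lp_norm ps (\<lambda>xs. Lp_norm p (\<lambda>t. g (t # xs)))"

definition mixed_norm ::
    "'a::euclidean_space list \<Rightarrow> ennreal list \<Rightarrow> ('a \<Rightarrow> complex) \<Rightarrow> ennreal" where
  "mixed_norm es ps f =
     iterated_Lp_norm ps (\<lambda>xs. ennreal (norm (f (\<Sum>(t, e)\<leftarrow>zip xs es. t *\<^sub>R e))))"

definition mixed_Lebesgue ::
    "'a::euclidean_space list \<Rightarrow> ennreal list \<Rightarrow> ('a \<Rightarrow> complex) set" where
  "mixed_Lebesgue es ps =
     {f \<in> Lloc (enn2real (Min (insert 1 (set ps)))). mixed_norm es ps f < \<infinity>}"

definition mixed_Lebesgue_space ::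
    "('a::euclidean_space \<Rightarrow> complex) set \<Rightarrow> (('a \<Rightarrow> complex) \<Rightarrow> real) \<Rightarrow> bool" where
  "mixed_Lebesgue_space B N \<longleftrightarrow> (\<exists>es ps.
     distinct es \<and> independent (set es) \<and> span (set es) = UNIV \<and>
     length ps = length es \<and> (\<forall>p\<in>set ps. 0 < p) \<and>
     B = mixed_Lebesgue es ps \<and> N = (\<lambda>f. enn2real (mixed_norm es ps f)))"


section \<open>Modulation spaces\<close>

text \<open>A formal Hermite expansion \<open>\<Sum>\<^sub>\<alpha> c\<^sub>\<alpha> h\<^sub>\<alpha>\<close> is identified with its family of
  coefficients \<open>c\<close>.\<close>

definition H_flat' :: "(('d::finite \<Rightarrow> nat) \<Rightarrow> complex) set" where
  "H_flat' = {c. \<forall>r>0. \<exists>C>0. \<forall>\<alpha>.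
     norm (c \<alpha>) \<le> C * r ^ (\<Sum>i\<in>UNIV. \<alpha> i) * sqrt (\<Prod>i\<in>UNIV. fact (\<alpha> i))}"

definition Bargmann :: "(('d::finite \<Rightarrow> nat) \<Rightarrow> complex) \<Rightarrow> complex ^ 'd \<Rightarrow> complex" where
  "Bargmann c z =
     (\<Sum>\<^sub>\<infinity>\<alpha>. c \<alpha> * (\<Prod>i\<in>UNIV. (z $ i) ^ \<alpha> i) / of_real (sqrt (\<Prod>i\<in>UNIV. fact (\<alpha> i))))"

text \<open>The short-time Fourier transform with Gaussian window is determined by its relation to
  the Bargmann transform, stated in the lemma below; the definition is
  this relation solved for \<open>V\<^sub>\<phi> f (x, \<xi>)\<close>.\<close>

definition STFT ::
    "(('d::finite \<Rightarrow> nat) \<Rightarrow> complex) \<Rightarrow> (real ^ 'd) \<times> (real ^ 'd) \<Rightarrow> complex" where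
  "STFT c = (\<lambda>(x, \<xi>).
     of_real ((2 * pi) powr (- real CARD('d) / 2) * exp (- ((norm x)\<^sup>2 + (norm \<xi>)\<^sup>2) / 4)) *
     exp (- \<i> * of_real (x \<bullet> \<xi>) / 2) *
     Bargmann c (\<chi> i. Complex (x $ i / sqrt 2) (- \<xi> $ i / sqrt 2)))"

lemma Bargmann_eq_STFT:
  fixes c :: "('d::finite \<Rightarrow> nat) \<Rightarrow> complex"
  shows "Bargmann c (\<chi> i. Complex (x $ i) (\<xi> $ i)) =
    of_real ((2 * pi) powr (real CARD('d) / 2) * exp (((norm x)\<^sup>2 + (norm \<xi>)\<^sup>2) / 2)) *
    exp (- \<i> * of_real (x \<bullet> \<xi>)) * STFT c (sqrt 2 *\<^sub>R x, - sqrt 2 *\<^sub>R \<xi>)"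
proof -
  have 1: "(2 * pi) powr (real CARD('d) / 2) * (2 * pi) powr (- real CARD('d) / 2) = 1"
    by (simp flip: powr_add)
  have 2: "exp (((norm x)\<^sup>2 + (norm \<xi>)\<^sup>2) / 2) *
      exp (- ((norm (sqrt 2 *\<^sub>R x))\<^sup>2 + (norm (- sqrt 2 *\<^sub>R \<xi>))\<^sup>2) / 4) = 1"
    by (simp flip: exp_add add: power_mult_distrib field_simps)
  have 3: "exp (- \<i> * of_real (x \<bullet> \<xi>)) *
      exp (- \<i> * of_real ((sqrt 2 *\<^sub>R x) \<bullet> (- sqrt 2 *\<^sub>R \<xi>)) / 2) = 1"
  proof -
    have "(sqrt 2 *\<^sub>R x) \<bullet> (- sqrt 2 *\<^sub>R \<xi>) = - 2 * (x \<bullet> \<xi>)"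
      by (simp flip: mult.assoc)
    then show ?thesis
      unfolding exp_add[symmetric] by (simp only:) simp
  qed
  have "of_real ((2 * pi) powr (real CARD('d) / 2) * exp (((norm x)\<^sup>2 + (norm \<xi>)\<^sup>2) / 2)) *
      exp (- \<i> * of_real (x \<bullet> \<xi>)) * STFT c (sqrt 2 *\<^sub>R x, - sqrt 2 *\<^sub>R \<xi>) =
    of_real (((2 * pi) powr (real CARD('d) / 2) * (2 * pi) powr (- real CARD('d) / 2)) *
      (exp (((norm x)\<^sup>2 + (norm \<xi>)\<^sup>2) / 2) *
        exp (- ((norm (sqrt 2 *\<^sub>R x))\<^sup>2 + (norm (- sqrt 2 *\<^sub>R \<xi>))\<^sup>2) / 4))) *
      (exp (- \<i> * of_real (x \<bullet> \<xi>)) *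
        exp (- \<i> * of_real ((sqrt 2 *\<^sub>R x) \<bullet> (- sqrt 2 *\<^sub>R \<xi>)) / 2)) *
      Bargmann c (\<chi> i. Complex ((sqrt 2 *\<^sub>R x) $ i / sqrt 2) (- (- sqrt 2 *\<^sub>R \<xi>) $ i / sqrt 2))"
    unfolding STFT_def by (simp only: prod.case of_real_mult mult_ac)
  then show ?thesis
    unfolding 1 2 3 by simp
qed

definition modulation_space ::
    "((real ^ 'd::finite) \<times> (real ^ 'd) \<Rightarrow> real) \<Rightarrow>
     ((real ^ 'd) \<times> (real ^ 'd) \<Rightarrow> complex) set \<Rightarrow> (('d \<Rightarrow> nat) \<Rightarrow> complex) set" where
  "modulation_space \<omega> B = {c \<in> H_flat'. (\<lambda>X. STFT c X * of_real (\<omega> X)) \<in> B}"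

definition modulation_norm ::
    "((real ^ 'd::finite) \<times> (real ^ 'd) \<Rightarrow> real) \<Rightarrow>
     (((real ^ 'd) \<times> (real ^ 'd) \<Rightarrow> complex) \<Rightarrow> real) \<Rightarrow> (('d \<Rightarrow> nat) \<Rightarrow> complex) \<Rightarrow> real" where
  "modulation_norm \<omega> N c = N (\<lambda>X. STFT c X * of_real (\<omega> X))"

text \<open>Compactness of a linear map \<open>T\<close> between the (quasi-)normed spaces \<open>(M\<^sub>1, N\<^sub>1)\<close> and
  \<open>(M\<^sub>2, N\<^sub>2)\<close>, including that \<open>T\<close> maps \<open>M\<^sub>1\<close> into \<open>M\<^sub>2\<close>.\<close>

definition compact_map ::
    "'a set \<Rightarrow> ('a \<Rightarrow> real) \<Rightarrow> 'b::minus set \<Rightarrow> ('b \<Rightarrow> real) \<Rightarrow> ('a \<Rightarrow> 'b) \<Rightarrow> bool" where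
  "compact_map M\<^sub>1 N\<^sub>1 M\<^sub>2 N\<^sub>2 T \<longleftrightarrow> T ` M\<^sub>1 \<subseteq> M\<^sub>2 \<and>
     (\<forall>f :: nat \<Rightarrow> 'a. range f \<subseteq> M\<^sub>1 \<and> (\<exists>C. \<forall>n. N\<^sub>1 (f n) \<le> C) \<longrightarrow>
        (\<exists>g\<in>M\<^sub>2. \<exists>r :: nat \<Rightarrow> nat. strict_mono r \<and> (\<lambda>n. N\<^sub>2 (T (f (r n)) - g)) \<longlonglongrightarrow> 0))"

end

theory Submission
  imports Defs
    "HOL-Complex_Analysis.Cauchy_Integral_Formula"
    "HOL-Library.Diagonal_Subsequence"
    "HOL-Real_Asymp.Real_Asymp"
    "HOL-Probability.Distributions"
begin

text \<open>The embedding is studied on the phase space side, where the short-time Fourier transform of \<open>f\<close> is,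
up to a Gaussian factor and a change of variables, the entire function given by the Bargmann
transform. Both kinds of function spaces enter only through a few properties, collected in the
locale \<open>quasi_Banach_function_space\<close>: the space is solid and quasi-normed, its quasi-norm
controls local \<open>L\<^sup>r\<close> norms for some \<open>0 < r \<le> 1\<close>, it contains the Gaussians, and the limit of a Cauchy
sequence is found by taking pointwise limits.

Sufficiency. If \<open>f\<^sub>j\<close> is bounded in \<open>M(\<omega>\<^sub>1, B)\<close>, then the functions \<open>V f\<^sub>j\<close> are bounded in \<open>L\<^sup>r\<close> on every
ball, because weights are locally bounded below. Entire functions satisfy the mean value
inequality, so local \<open>L\<^sup>r\<close> bounds give local uniform bounds (\<open>sub_mean_value_powr\<close>), and a sequence of
entire functions with local uniform bounds has a subsequence which converges locally uniformly
to another entire function with Hermite coefficients of the admitted size (\<open>STFT_Montel\<close>). On a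
large ball the differences \<open>V f\<^sub>j - V f\<^sub>k\<close> are then uniformly small, and outside of it the factor
\<open>\<omega>\<^sub>2 / \<omega>\<^sub>1\<close> is small while \<open>(V f\<^sub>j - V f\<^sub>k) \<omega>\<^sub>1\<close> stays bounded in \<open>B\<close>. So the subsequence is Cauchy in
\<open>M(\<omega>\<^sub>2, B)\<close>, and its limit there is the locally uniform limit.

Necessity. If \<open>\<omega>\<^sub>2 / \<omega>\<^sub>1 > e\<close> at points \<open>Y\<^sub>j\<close> going to infinity, then the coherent states centred at \<open>Y\<^sub>j\<close>
and divided by \<open>\<omega>\<^sub>1(Y\<^sub>j)\<close> have short-time Fourier transforms of modulus proportional to
\<open>exp (- |X - Y\<^sub>j|\<^sup>2 / 4) / \<omega>\<^sub>1(Y\<^sub>j)\<close>. As moderate weights grow at most exponentially, these are bounded in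
\<open>M(\<omega>\<^sub>1, B)\<close> by translation invariance and tend to zero pointwise, so a limit of a subsequence in
\<open>M(\<omega>\<^sub>2, B)\<close> can only be zero. But on the unit ball around \<open>Y\<^sub>j\<close> they are at least a fixed multiple of \<open>e\<close>
after multiplication by \<open>\<omega>\<^sub>2\<close>, which keeps their norms away from zero.

It remains to verify the properties of the locale. For invariant BF-spaces the local bound is
automatic: the gliding hump argument shows that every solid Banach function space inside
the locally integrable functions is continuously embedded there (\<open>L1_local_embedding\<close>). For mixed quasi-norms the properties
pass from one variable to several by induction over the iterated norms, completeness being replaced
by Fatou's lemma; that a function on the space may be studied in coordinates with respect to any
basis rests on the uniqueness of translation invariant measures.\<close>

section \<open>Translation invariant measures\<close>

text \<open>Uniqueness of Haar measure on a Euclidean space. For Borel functions \<open>f, g \<ge> 0\<close>, two applications of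
Tonelli's theorem and the substitution \<open>x \<mapsto> x - y\<close> show that the product of \<open>\<integral>f d\<mu>\<close> with the Lebesgue
integral of \<open>g\<close> is symmetric in \<open>f\<close> and \<open>g\<close>; the unit ball as \<open>f\<close> then gives the constant. This replaces
determinants in all linear changes of variables below.\<close>

lemma translation_invariant_nn_integral:
  fixes \<mu> :: "'a::euclidean_space measure"
  assumes sets [measurable_cong]: "sets \<mu> = sets borel"
    and fin: "\<And>R. emeasure \<mu> (ball 0 R) < \<infinity>"
    and inv: "\<And>a. distr \<mu> borel (\<lambda>x. a + x) = \<mu>"
  obtains c where "c < \<infinity>"
    "\<And>g. g \<in> borel_measurable borel \<Longrightarrow> (\<integral>\<^sup>+x. g x \<partial>\<mu>) = c * (\<integral>\<^sup>+x. g x \<partial>lborel)"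
proof -
  have "sigma_finite_measure \<mu>"
  proof (rule sigma_finite_measure.intro, intro exI conjI)
    show "\<Union> (range (\<lambda>n::nat. ball (0::'a) n)) = space \<mu>"
      using sets_eq_imp_space_eq[OF sets] by (auto intro: reals_Archimedean2)
  qed (use fin sets in \<open>auto simp: less_top[symmetric]\<close>)
  then interpret \<mu>: sigma_finite_measure \<mu> .
  interpret L: sigma_finite_measure "lborel :: 'a measure" by (rule sigma_finite_lborel)
  interpret P: pair_sigma_finite \<mu> "lborel :: 'a measure" ..
  have L_shift: "(\<integral>\<^sup>+x. f (a + x) \<partial>lborel) = (\<integral>\<^sup>+x. f x \<partial>lborel)"
    if [measurable]: "f \<in> borel_measurable borel" for f :: "'a \<Rightarrow> ennreal" and a
    by (subst (2) lborel_distr_plus[symmetric, of a]) (simp add: nn_integral_distr)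
  have L_neg: "(\<integral>\<^sup>+x. f (- x) \<partial>lborel) = (\<integral>\<^sup>+x. f x \<partial>lborel)"
    if [measurable]: "f \<in> borel_measurable borel" for f :: "'a \<Rightarrow> ennreal"
  proof -
    have "(lborel :: 'a measure) = distr lborel borel (\<lambda>x. - x)"
      by (subst lborel_affine[of "-1" 0]) (simp_all add: density_1 scaleR_minus_left)
    then have "(\<integral>\<^sup>+x. f x \<partial>lborel) = (\<integral>\<^sup>+x. f x \<partial>distr lborel borel (\<lambda>x. - x))"
      by simp
    also have "\<dots> = (\<integral>\<^sup>+x. f (- x) \<partial>lborel)"
      by (simp add: nn_integral_distr)
    finally show ?thesis by simp
  qed
  have m_shift: "(\<integral>\<^sup>+x. f (a + x) \<partial>\<mu>) = (\<integral>\<^sup>+x. f x \<partial>\<mu>)"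
    if [measurable]: "f \<in> borel_measurable borel" for f :: "'a \<Rightarrow> ennreal" and a
    by (subst (2) inv[symmetric, of a]) (simp add: nn_integral_distr)
  have key: "(\<integral>\<^sup>+x. f x \<partial>\<mu>) * (\<integral>\<^sup>+x. g x \<partial>lborel) = (\<integral>\<^sup>+x. g x \<partial>\<mu>) * (\<integral>\<^sup>+x. f x \<partial>lborel)"
    if [measurable]: "f \<in> borel_measurable borel" "g \<in> borel_measurable borel"
    for f g :: "'a \<Rightarrow> ennreal"
  proof -
    (* Shift y by x, exchange the integrals, shift x by - y, exchange again, and reflect y. *)
    have "(\<integral>\<^sup>+x. f x \<partial>\<mu>) * (\<integral>\<^sup>+y. g y \<partial>lborel) = (\<integral>\<^sup>+x. \<integral>\<^sup>+y. f x * g (x + y) \<partial>lborel \<partial>\<mu>)"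
      by (simp add: nn_integral_cmult nn_integral_multc L_shift)
    also have "\<dots> = (\<integral>\<^sup>+y. \<integral>\<^sup>+x. f x * g (x + y) \<partial>\<mu> \<partial>lborel)"
      by (subst P.Fubini') simp_all
    also have "\<dots> = (\<integral>\<^sup>+y. \<integral>\<^sup>+x. f (- y + x) * g x \<partial>\<mu> \<partial>lborel)"
      using m_shift[of "\<lambda>x. f x * g (x + y)" "- y" for y] by simp
    also have "\<dots> = (\<integral>\<^sup>+x. \<integral>\<^sup>+y. f (x + - y) * g x \<partial>lborel \<partial>\<mu>)"
      by (subst P.Fubini') (simp_all add: add.commute)
    also have "\<dots> = (\<integral>\<^sup>+x. g x \<partial>\<mu>) * (\<integral>\<^sup>+x. f x \<partial>lborel)"
      using L_neg[of "\<lambda>y. f (x + y)" for x]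
      by (simp add: nn_integral_cmult nn_integral_multc L_shift mult.commute)
    finally show ?thesis .
  qed
  define a where "a = emeasure \<mu> (ball 0 1)"
  define b where "b = emeasure lborel (ball (0::'a) 1)"
  have b: "b \<noteq> 0" "b \<noteq> \<infinity>"
    using emeasure_lborel_ball_finite[of "0::'a" 1] content_ball_pos[of 1 "0::'a"]
    unfolding b_def measure_def by auto
  show ?thesis
  proof
    show "a / b < \<infinity>"
      using fin[of 1] b by (simp add: a_def ennreal_divide_eq_top_iff less_top[symmetric])
    fix g :: "'a \<Rightarrow> ennreal" assume [measurable]: "g \<in> borel_measurable borel"
    have "a * (\<integral>\<^sup>+x. g x \<partial>lborel) = (\<integral>\<^sup>+x. g x \<partial>\<mu>) * b"
      using key[of "indicator (ball 0 1)" g, OF borel_measurable_indicator]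
      by (simp add: a_def b_def sets)
    then show "(\<integral>\<^sup>+x. g x \<partial>\<mu>) = a / b * (\<integral>\<^sup>+x. g x \<partial>lborel)"
      using b ennreal_mult_divide_eq[of b "\<integral>\<^sup>+x. g x \<partial>\<mu>"]
      by (metis ennreal_times_divide infinity_ennreal_def mult.commute)
  qed
qed

text \<open>The image measure is translation invariant, hence a multiple of Lebesgue measure, and the unit ball,
which is its own image, shows that the factor is \<open>1\<close>.\<close>

lemma lborel_distr_orthogonal:
  fixes T :: "'a::euclidean_space \<Rightarrow> 'a"
  assumes "orthogonal_transformation T"
  shows "distr lborel borel T = lborel"
proof -
  have lin: "linear T" and nT: "norm (T x) = norm x" for x
    using assms by (auto simp: orthogonal_transformation_linear orthogonal_transformation_norm)
  obtain S where TS: "T (S x) = x" for x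
    using orthogonal_transformation_surj[OF assms] by (metis surj_f_inv_f)
  have [measurable]: "T \<in> borel_measurable borel"
    using lin by (intro borel_measurable_continuous_onI linear_continuous_on linear_conv_bounded_linear[THEN iffD1])
  have pre: "T -` ball 0 R = ball 0 R" for R
    by (auto simp: nT)
  obtain c where c: "\<And>g. g \<in> borel_measurable borel \<Longrightarrow>
      (\<integral>\<^sup>+x. g x \<partial>distr lborel borel T) = c * (\<integral>\<^sup>+x. g x \<partial>lborel)"
  proof (rule translation_invariant_nn_integral[of "distr lborel borel T"])
    fix a
    have "distr (distr lborel borel T) borel (\<lambda>x. a + x) = distr lborel borel (\<lambda>x. T (S a + x))"
      by (subst distr_distr) (simp_all add: comp_def linear_add[OF lin] TS)
    also have "\<dots> = distr (distr lborel borel ((+) (S a))) borel T"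
      by (subst distr_distr) (simp_all add: comp_def)
    finally show "distr (distr lborel borel T) borel (\<lambda>x. a + x) = distr lborel borel T"
      by (simp add: lborel_distr_plus)
  qed (auto simp: emeasure_distr pre emeasure_lborel_ball_finite[unfolded infinity_ennreal_def])
  define b where "b = emeasure lborel (ball (0::'a) 1)"
  have b: "b \<noteq> 0" "b \<noteq> \<infinity>"
    using emeasure_lborel_ball_finite[of "0::'a" 1] content_ball_pos[of 1 "0::'a"]
    unfolding b_def measure_def by auto
  have "b = c * b"
    using c[of "indicator (ball 0 1)", OF borel_measurable_indicator] by (simp add: emeasure_distr pre b_def)
  then have "c = b / b"
    using b ennreal_mult_divide_eq[of b c] by simp
  then have "c = 1"
    using b by (simp add: ennreal_divide_self less_top)
  show ?thesis
  proof (rule measure_eqI)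
    fix A assume "A \<in> sets (distr lborel borel T)"
    then show "emeasure (distr lborel borel T) A = emeasure lborel A"
      using c[of "indicator A"] \<open>c = 1\<close> by simp
  qed simp
qed

section \<open>Bargmann transforms as entire functions\<close>

definition multi_size :: "('d::finite \<Rightarrow> nat) \<Rightarrow> nat" where
  "multi_size \<alpha> = (\<Sum>i\<in>UNIV. \<alpha> i)"

definition multi_fact :: "('d::finite \<Rightarrow> nat) \<Rightarrow> real" where
  "multi_fact \<alpha> = (\<Prod>i\<in>UNIV. fact (\<alpha> i))"

definition Bargmann_term :: "(('d::finite \<Rightarrow> nat) \<Rightarrow> complex) \<Rightarrow> complex ^ 'd \<Rightarrow> ('d \<Rightarrow> nat) \<Rightarrow> complex" where
  "Bargmann_term c z \<alpha> = c \<alpha> * (\<Prod>i\<in>UNIV. (z $ i) ^ \<alpha> i) / of_real (sqrt (multi_fact \<alpha>))"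

definition polydisc :: "real \<Rightarrow> (complex ^ 'd::finite) set" where
  "polydisc \<rho> = {z. \<forall>i. norm (z $ i) \<le> \<rho>}"

lemma multi_fact_pos [simp]: "0 < multi_fact \<alpha>"
  by (simp add: multi_fact_def prod_pos)

lemma multi_fact_nonzero [simp]: "multi_fact \<alpha> \<noteq> 0"
  using multi_fact_pos[of \<alpha>] by linarith

lemma prod_power_multi_size: "(\<Prod>i\<in>UNIV. x ^ \<alpha> i) = (x::'a::comm_monoid_mult) ^ multi_size \<alpha>"
  by (simp add: multi_size_def power_sum)

lemma H_flat'_iff: "c \<in> H_flat' \<longleftrightarrow>
    (\<forall>r>0. \<exists>C>0. \<forall>\<alpha>. norm (c \<alpha>) \<le> C * r ^ multi_size \<alpha> * sqrt (multi_fact \<alpha>))"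
  by (simp add: H_flat'_def multi_size_def multi_fact_def)

lemma Bargmann_eq: "Bargmann c z = (\<Sum>\<^sub>\<infinity>\<alpha>. Bargmann_term c z \<alpha>)"
  by (simp add: Bargmann_def Bargmann_term_def multi_fact_def)

lemma geometric_multi_summable:
  assumes "0 \<le> x" "x < 1"
  shows "(\<lambda>\<alpha>::'d::finite \<Rightarrow> nat. (x::real) ^ multi_size \<alpha>) summable_on UNIV"
proof -
  have "Infinite_Set_Sum.abs_summable_on (\<lambda>n::nat. x ^ n) UNIV"
    using assms by (simp add: abs_summable_on_nat_iff' summable_geometric_iff)
  then have "Infinite_Set_Sum.abs_summable_on (\<lambda>g. \<Prod>i\<in>(UNIV::'d set). x ^ g i) (PiE UNIV (\<lambda>_. UNIV))"
    by (intro abs_summable_on_prod_PiE) auto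
  then have "Infinite_Set_Sum.abs_summable_on (\<lambda>\<alpha>::'d \<Rightarrow> nat. x ^ multi_size \<alpha>) UNIV"
    by (simp add: prod_power_multi_size)
  then show ?thesis
    using abs_summable_equivalent abs_summable_summable by blast
qed

lemma norm_Bargmann_term_le:
  assumes "z \<in> polydisc \<rho>"
  shows "norm (Bargmann_term c z \<alpha>) \<le> norm (c \<alpha>) * \<rho> ^ multi_size \<alpha> / sqrt (multi_fact \<alpha>)"
proof -
  have "norm (\<Prod>i\<in>UNIV. (z $ i) ^ \<alpha> i) \<le> (\<Prod>i\<in>UNIV. \<rho> ^ \<alpha> i)"
    unfolding prod_norm[symmetric] norm_power using assms
    by (intro prod_mono conjI power_mono) (auto simp: polydisc_def)
  then show ?thesis
    by (simp add: Bargmann_term_def norm_mult norm_divide prod_power_multi_size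
        mult_left_mono divide_right_mono less_imp_le)
qed

text \<open>The coefficients of elements of \<open>H_flat'\<close> decay faster than any geometric sequence after division
by \<open>sqrt \<alpha>!\<close>; the factor \<open>(1/2) ^ |\<alpha>|\<close> is a convenient summable majorant on the polydisc of
radius \<open>\<rho>\<close>.\<close>

lemma H_flat'_coefficient_bound:
  assumes "c \<in> H_flat'" "0 < \<rho>"
  obtains C where "0 < C"
    "\<And>\<alpha>. norm (c \<alpha>) * \<rho> ^ multi_size \<alpha> / sqrt (multi_fact \<alpha>) \<le> C * (1/2) ^ multi_size \<alpha>"
proof -
  have "0 < 1 / (2 * \<rho>)" using assms by simp
  then obtain C where C: "C > 0"
    "\<And>\<alpha>. norm (c \<alpha>) \<le> C * (1 / (2 * \<rho>)) ^ multi_size \<alpha> * sqrt (multi_fact \<alpha>)"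
    using assms(1) unfolding H_flat'_iff by blast
  have "norm (c \<alpha>) * \<rho> ^ multi_size \<alpha> / sqrt (multi_fact \<alpha>) \<le> C * (1/2) ^ multi_size \<alpha>" for \<alpha>
  proof -
    have "norm (c \<alpha>) * \<rho> ^ multi_size \<alpha> \<le>
        (C * (1 / (2 * \<rho>)) ^ multi_size \<alpha> * sqrt (multi_fact \<alpha>)) * \<rho> ^ multi_size \<alpha>"
      using C(2) assms by (intro mult_right_mono) auto
    also have "\<dots> = C * ((1 / (2 * \<rho>)) * \<rho>) ^ multi_size \<alpha> * sqrt (multi_fact \<alpha>)"
      by (simp only: power_mult_distrib mult_ac)
    also have "(1 / (2 * \<rho>)) * \<rho> = 1/2"
      using assms by simp
    finally show ?thesis
      by (subst pos_divide_le_eq) simp_all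
  qed
  with C(1) that show ?thesis by blast
qed

lemma Bargmann_uniform_limit:
  assumes "c \<in> H_flat'"
  shows "uniform_limit (polydisc \<rho>) (\<lambda>F z. \<Sum>\<alpha>\<in>F. Bargmann_term c z \<alpha>) (Bargmann c)
    (finite_subsets_at_top UNIV)"
proof -
  obtain C where C: "\<And>\<alpha>. norm (c \<alpha>) * (\<bar>\<rho>\<bar> + 1) ^ multi_size \<alpha> / sqrt (multi_fact \<alpha>)
      \<le> C * (1/2) ^ multi_size \<alpha>"
    using H_flat'_coefficient_bound[OF assms, of "\<bar>\<rho>\<bar> + 1"] by (metis abs_add_one_gt_zero add.commute)
  have sub: "z \<in> polydisc \<rho> \<Longrightarrow> z \<in> polydisc (\<bar>\<rho>\<bar> + 1)" for z :: "complex ^ 'a"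
    by (auto simp: polydisc_def) (smt (verit))
  have "uniform_limit (polydisc \<rho>) (\<lambda>F z. \<Sum>\<alpha>\<in>F. Bargmann_term c z \<alpha>)
      (\<lambda>z. \<Sum>\<^sub>\<infinity>\<alpha>. Bargmann_term c z \<alpha>) (finite_subsets_at_top UNIV)"
  proof (rule Weierstrass_m_test_general)
    show "norm (Bargmann_term c z \<alpha>) \<le> C * (1/2) ^ multi_size \<alpha>" if "z \<in> polydisc \<rho>" for z \<alpha>
      using norm_Bargmann_term_le[OF sub[OF that]] C order_trans by blast
    show "(\<lambda>\<alpha>. C * (1/2) ^ multi_size \<alpha>) summable_on UNIV"
      by (intro summable_on_cmult_right geometric_multi_summable) auto
  qed
  then show ?thesis
    unfolding Bargmann_eq[abs_def] .
qed

lemma Bargmann_term_summable: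
  assumes "c \<in> H_flat'"
  shows "Bargmann_term c z summable_on UNIV"
proof -
  obtain C where C: "\<And>\<alpha>. norm (c \<alpha>) * (norm z + 1) ^ multi_size \<alpha> / sqrt (multi_fact \<alpha>)
      \<le> C * (1/2) ^ multi_size \<alpha>"
    using H_flat'_coefficient_bound[OF assms, of "norm z + 1"] by (auto simp: add_nonneg_pos)
  have z: "z \<in> polydisc (norm z + 1)"
    using Finite_Cartesian_Product.norm_nth_le[of z] by (simp add: polydisc_def add_increasing2)
  have "(\<lambda>\<alpha>. norm (Bargmann_term c z \<alpha>)) summable_on UNIV"
  proof (rule Infinite_Sum.abs_summable_on_comparison_test')
    show "(\<lambda>\<alpha>. C * (1/2) ^ multi_size \<alpha>) summable_on (UNIV :: ('a \<Rightarrow> nat) set)"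
      by (intro summable_on_cmult_right geometric_multi_summable) auto
    show "norm (Bargmann_term c z \<alpha>) \<le> C * (1/2) ^ multi_size \<alpha>" for \<alpha>
      using norm_Bargmann_term_le[OF z] C order_trans by blast
  qed
  then show ?thesis by (rule abs_summable_summable)
qed

lemma Bargmann_diff:
  assumes "c \<in> H_flat'" "c' \<in> H_flat'"
  shows "Bargmann (c - c') z = Bargmann c z - Bargmann c' z"
proof -
  have "Bargmann (c - c') z = (\<Sum>\<^sub>\<infinity>\<alpha>. Bargmann_term c z \<alpha> + - Bargmann_term c' z \<alpha>)"
    unfolding Bargmann_eq by (intro infsum_cong) (simp add: Bargmann_term_def field_simps)
  also have "\<dots> = Bargmann c z + (\<Sum>\<^sub>\<infinity>\<alpha>. - Bargmann_term c' z \<alpha>)"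
    unfolding Bargmann_eq using Bargmann_term_summable assms
    by (intro infsum_add) (auto simp: summable_on_uminus)
  finally show ?thesis
    by (simp add: infsum_uminus Bargmann_eq)
qed

lemma Bargmann_scale: "Bargmann (\<lambda>\<alpha>. a * c \<alpha>) z = a * Bargmann c z"
proof -
  have "Bargmann (\<lambda>\<alpha>. a * c \<alpha>) z = (\<Sum>\<^sub>\<infinity>\<alpha>. a * Bargmann_term c z \<alpha>)"
    unfolding Bargmann_eq by (intro infsum_cong) (simp add: Bargmann_term_def field_simps)
  then show ?thesis
    by (simp add: infsum_cmult_right' Bargmann_eq)
qed

lemma H_flat'_scale:
  assumes "c \<in> H_flat'"
  shows "(\<lambda>\<alpha>. a * c \<alpha>) \<in> H_flat'"
  unfolding H_flat'_iff
proof (intro allI impI)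
  fix r :: real assume "r > 0"
  then obtain C where C: "C > 0" "\<And>\<alpha>. norm (c \<alpha>) \<le> C * r ^ multi_size \<alpha> * sqrt (multi_fact \<alpha>)"
    using assms unfolding H_flat'_iff by blast
  have "norm (a * c \<alpha>) \<le> ((norm a + 1) * C) * r ^ multi_size \<alpha> * sqrt (multi_fact \<alpha>)" for \<alpha>
    using mult_mono[OF _ C(2)[of \<alpha>], of "norm a" "norm a + 1"] by (simp add: norm_mult mult_ac)
  moreover have "(norm a + 1) * C > 0"
    using C(1) by (simp add: add_nonneg_pos)
  ultimately show "\<exists>C>0. \<forall>\<alpha>. norm (a * c \<alpha>) \<le> C * r ^ multi_size \<alpha> * sqrt (multi_fact \<alpha>)"
    by blast
qed

lemma continuous_on_Bargmann_polydisc: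
  assumes "c \<in> H_flat'"
  shows "continuous_on (polydisc \<rho>) (Bargmann c)"
proof (rule uniform_limit_theorem[OF _ Bargmann_uniform_limit[OF assms]])
  show "\<forall>\<^sub>F F in finite_subsets_at_top UNIV.
      continuous_on (polydisc \<rho>) (\<lambda>z. \<Sum>\<alpha>\<in>F. Bargmann_term c z \<alpha>)"
    unfolding Bargmann_term_def by (intro always_eventually allI continuous_intros) auto
qed auto

lemma continuous_on_Bargmann:
  assumes "c \<in> H_flat'"
  shows "continuous_on S (Bargmann c)"
proof (rule continuous_on_subset[of UNIV])
  have "isCont (Bargmann c) z" for z
  proof -
    have "ball z 1 \<subseteq> polydisc (norm z + 1)"
    proof
      fix w assume "w \<in> ball z 1"
      then have "norm w \<le> norm z + 1"
        using norm_triangle_ineq2[of w z] by (simp add: dist_norm norm_minus_commute)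
      then show "w \<in> polydisc (norm z + 1)"
        using order_trans[OF Finite_Cartesian_Product.norm_nth_le] by (auto simp: polydisc_def)
    qed
    then have "continuous_on (ball z 1) (Bargmann c)"
      using continuous_on_Bargmann_polydisc[OF assms] continuous_on_subset by blast
    then show ?thesis
      by (simp add: continuous_on_eq_continuous_at)
  qed
  then show "continuous_on UNIV (Bargmann c)"
    by (simp add: continuous_at_imp_continuous_on)
qed auto

text \<open>Holomorphy in several variables is only used along complex lines, where the partial sums are
polynomials in one variable.\<close>

lemma Bargmann_holomorphic_on_lines:
  assumes "c \<in> H_flat'"
  shows "(\<lambda>w. Bargmann c (\<chi> i. a $ i + w * b $ i)) holomorphic_on S"
proof (rule holomorphic_on_subset[of _ UNIV])
  have "(\<lambda>w. Bargmann c (\<chi> i. a $ i + w * b $ i)) holomorphic_on ball 0 R" for R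
  proof -
    let ?l = "\<lambda>w. \<chi> i. a $ i + w * b $ i"
    have l: "?l w \<in> polydisc (norm a + R * norm b)" if "w \<in> cball 0 R" for w
    proof -
      have "norm (a $ i + w * b $ i) \<le> norm a + R * norm b" for i
      proof -
        have "norm (a $ i + w * b $ i) \<le> norm (a $ i) + norm w * norm (b $ i)"
          by (metis norm_mult norm_triangle_ineq)
        also have "\<dots> \<le> norm a + R * norm b"
          using that order_trans[OF norm_ge_zero]
          by (intro add_mono mult_mono Finite_Cartesian_Product.norm_nth_le) auto
        finally show ?thesis .
      qed
      then show ?thesis by (simp add: polydisc_def)
    qed
    have "uniform_limit (cball 0 R) (\<lambda>F w. \<Sum>\<alpha>\<in>F. Bargmann_term c (?l w) \<alpha>)
        (\<lambda>w. Bargmann c (?l w)) (finite_subsets_at_top UNIV)"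
      using Bargmann_uniform_limit[OF assms, of "norm a + R * norm b"] l
      unfolding uniform_limit_iff by (auto elim!: eventually_mono)
    moreover have "(\<lambda>w. \<Sum>\<alpha>\<in>F. Bargmann_term c (?l w) \<alpha>) holomorphic_on T" for F T
      unfolding Bargmann_term_def by (auto intro!: holomorphic_intros)
    ultimately show ?thesis
      by (elim holomorphic_uniform_limit[rotated])
        (auto intro!: always_eventually holomorphic_on_imp_continuous_on)
  qed
  then have "(\<lambda>w. Bargmann c (\<chi> i. a $ i + w * b $ i)) holomorphic_on (\<Union>R\<in>UNIV. ball 0 (R::real))"
    by (intro holomorphic_on_UN_open) auto
  moreover have "(\<Union>R\<in>UNIV. ball (0::complex) (R::real)) = UNIV"
    by (auto intro: gt_ex)
  ultimately show "(\<lambda>w. Bargmann c (\<chi> i. a $ i + w * b $ i)) holomorphic_on UNIV"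
    by simp
qed auto

section \<open>Cauchy estimates and normal families\<close>

lemma sum_roots_of_unity:
  assumes "a < m" "b < m"
  defines "\<zeta> \<equiv> exp (2 * of_real pi * \<i> / of_nat m)"
  shows "(\<Sum>k<m. \<zeta> ^ (k * a) * cnj \<zeta> ^ (k * b)) = (if a = b then of_nat m else 0)"
proof -
  have m: "m \<ge> 1" using assms by simp
  have pow: "\<zeta> ^ j = exp (2 * of_real pi * \<i> * of_nat j / of_nat m)" for j
    unfolding \<zeta>_def exp_of_nat_mult[symmetric] by (simp add: mult_ac)
  have unit: "\<zeta> * cnj \<zeta> = 1"
  proof -
    have "norm \<zeta> = 1"
      unfolding \<zeta>_def by (simp add: norm_exp_eq_Re)
    then show ?thesis by (simp add: complex_norm_square[symmetric])
  qed
  have \<zeta>m: "\<zeta> ^ m = 1"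
    using m by (simp add: pow exp_eq_1)
  define w where "w = \<zeta> ^ a * cnj \<zeta> ^ b"
  have "(\<Sum>k<m. \<zeta> ^ (k * a) * cnj \<zeta> ^ (k * b)) = (\<Sum>k<m. w ^ k)"
    by (simp add: w_def power_mult_distrib power_mult[symmetric] mult.commute)
  also have "\<dots> = (if a = b then of_nat m else 0)"
  proof (cases "a = b")
    case True
    then have "w = 1"
      by (simp add: w_def power_mult_distrib[symmetric] unit)
    then show ?thesis using True by simp
  next
    case False
    have "w \<noteq> 1"
    proof
      assume "w = 1"
      then have "\<zeta> ^ b = \<zeta> ^ a * (\<zeta> * cnj \<zeta>) ^ b"
        by (simp add: w_def power_mult_distrib mult_ac)
      then have "\<zeta> ^ a = \<zeta> ^ b" by (simp add: unit)
      then show False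
        using complex_root_unity_eq[OF m, of a b] assms(1,2) False unfolding pow by simp
    qed
    moreover have "w ^ m = 1"
    proof -
      have "w ^ m = (\<zeta> ^ m) ^ a * cnj (\<zeta> ^ m) ^ b"
        by (simp add: w_def power_mult_distrib power_mult[symmetric] mult.commute)
      then show ?thesis by (simp add: \<zeta>m)
    qed
    ultimately show ?thesis
      using False by (simp add: geometric_sum)
  qed
  finally show ?thesis .
qed

text \<open>Cauchy's estimate in several variables, without contour integrals: a partial sum that is uniformly
close to the transform and contains the index \<open>\<alpha>\<close> is averaged against the character \<open>\<alpha>\<close> over the
points with coordinates \<open>\<rho> \<zeta>\<^sup>k\<close>, where \<open>\<zeta>\<close> is a root of unity of an order exceeding all exponents that
occur. Orthogonality of characters isolates the coefficient exactly.\<close>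

lemma coefficient_bound_by_sup:
  fixes c :: "('d::finite \<Rightarrow> nat) \<Rightarrow> complex"
  assumes c: "c \<in> H_flat'" and \<rho>: "0 \<le> \<rho>"
    and M: "\<And>z. z \<in> polydisc \<rho> \<Longrightarrow> norm (Bargmann c z) \<le> M"
  shows "norm (c \<alpha>) * \<rho> ^ multi_size \<alpha> / sqrt (multi_fact \<alpha>) \<le> M"
proof (rule field_le_epsilon)
  fix e :: real assume "0 < e"
  have "\<forall>\<^sub>F F in finite_subsets_at_top UNIV. (finite F \<and> \<alpha> \<in> F) \<and>
      (\<forall>z\<in>polydisc \<rho>. dist (\<Sum>\<beta>\<in>F. Bargmann_term c z \<beta>) (Bargmann c z) < e)"
    by (intro eventually_conj uniform_limitD[OF Bargmann_uniform_limit[OF c] \<open>0 < e\<close>])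
      (auto simp: eventually_finite_subsets_at_top intro: exI[of _ "{\<alpha>}"])
  from eventually_happens'[OF finite_subsets_at_top_neq_bot this]
  obtain F where F: "finite F" "\<alpha> \<in> F"
    and close: "\<And>z. z \<in> polydisc \<rho> \<Longrightarrow> dist (\<Sum>\<beta>\<in>F. Bargmann_term c z \<beta>) (Bargmann c z) < e"
    by blast
  (* With this order, two exponents in F are congruent modulo m only if they are equal. *)
  define m where "m = Suc (Max ((\<lambda>(\<beta>, i). \<beta> i) ` (F \<times> UNIV)))"
  have m: "\<beta> i < m" if "\<beta> \<in> F" for \<beta> i
    unfolding m_def less_Suc_eq_le using that F by (intro Max_ge) (auto intro!: image_eqI[of _ _ "(\<beta>, i)"])
  have m0: "m > 0" by (simp add: m_def)
  define \<zeta> where "\<zeta> = exp (2 * complex_of_real pi * \<i> / of_nat m)"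
  have n\<zeta>: "norm \<zeta> = 1"
    unfolding \<zeta>_def by (simp add: norm_exp_eq_Re)
  define K where "K = (\<Pi>\<^sub>E i\<in>(UNIV::'d set). {..<m})"
  define Z where "Z k = (\<chi> i. of_real \<rho> * \<zeta> ^ k i)" for k :: "'d \<Rightarrow> nat"
  have Z: "Z k \<in> polydisc \<rho>" for k
    using \<rho> by (simp add: Z_def polydisc_def norm_mult norm_power n\<zeta>)
  define b where "b \<beta> = c \<beta> * of_real \<rho> ^ multi_size \<beta> / of_real (sqrt (multi_fact \<beta>))" for \<beta>
  have bterm: "Bargmann_term c (Z k) \<beta> = b \<beta> * (\<Prod>i\<in>UNIV. \<zeta> ^ (k i * \<beta> i))" for k \<beta>
    by (simp add: Bargmann_term_def b_def Z_def power_mult_distrib prod.distrib prod_power_multi_size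
        power_mult)
  define A where "A = (\<Sum>k\<in>K. (\<Sum>\<beta>\<in>F. Bargmann_term c (Z k) \<beta>) * (\<Prod>i\<in>UNIV. cnj \<zeta> ^ (k i * \<alpha> i)))"
  have "A = (\<Sum>\<beta>\<in>F. b \<beta> * (\<Sum>k\<in>K. \<Prod>i\<in>UNIV. \<zeta> ^ (k i * \<beta> i) * cnj \<zeta> ^ (k i * \<alpha> i)))"
    unfolding A_def bterm sum_distrib_left sum_distrib_right prod.distrib
    by (subst sum.swap) (simp add: mult_ac)
  also have "\<dots> = (\<Sum>\<beta>\<in>F. b \<beta> * (\<Prod>i\<in>UNIV. \<Sum>k<m. \<zeta> ^ (k * \<beta> i) * cnj \<zeta> ^ (k * \<alpha> i)))"
    unfolding K_def by (subst prod_sum_PiE) auto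
  also have "\<dots> = (\<Sum>\<beta>\<in>F. if \<beta> = \<alpha> then b \<alpha> * of_nat m ^ CARD('d) else 0)"
  proof (intro sum.cong refl)
    fix \<beta> assume \<beta>: "\<beta> \<in> F"
    have "(\<Prod>i\<in>UNIV. \<Sum>k<m. \<zeta> ^ (k * \<beta> i) * cnj \<zeta> ^ (k * \<alpha> i)) =
        (\<Prod>i\<in>UNIV. if \<beta> i = \<alpha> i then of_nat m else 0)"
      unfolding \<zeta>_def using m \<beta> F by (intro prod.cong refl sum_roots_of_unity) auto
    also have "\<dots> = (if \<beta> = \<alpha> then of_nat m ^ CARD('d) else 0)"
      by (auto simp: fun_eq_iff)
    finally show "b \<beta> * (\<Prod>i\<in>UNIV. \<Sum>k<m. \<zeta> ^ (k * \<beta> i) * cnj \<zeta> ^ (k * \<alpha> i)) =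
        (if \<beta> = \<alpha> then b \<alpha> * of_nat m ^ CARD('d) else 0)" by simp
  qed
  also have "\<dots> = b \<alpha> * of_nat m ^ CARD('d)"
    using F by (simp add: sum.delta)
  finally have A1: "norm A = norm (b \<alpha>) * real m ^ CARD('d)"
    by (simp add: norm_mult norm_power)
  have "norm A \<le> (\<Sum>k\<in>K. M + e)"
    unfolding A_def
  proof (rule sum_norm_le)
    fix k
    have "norm (\<Sum>\<beta>\<in>F. Bargmann_term c (Z k) \<beta>) \<le> M + e"
      using close[OF Z, of k] M[OF Z, of k] norm_triangle_ineq2[of "\<Sum>\<beta>\<in>F. Bargmann_term c (Z k) \<beta>" "Bargmann c (Z k)"]
      by (simp add: dist_norm)
    then show "norm ((\<Sum>\<beta>\<in>F. Bargmann_term c (Z k) \<beta>) * (\<Prod>i\<in>UNIV. cnj \<zeta> ^ (k i * \<alpha> i))) \<le> M + e"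
      by (simp add: norm_mult prod_norm[symmetric] norm_power n\<zeta>)
  qed
  also have "\<dots> = (M + e) * real m ^ CARD('d)"
    by (simp add: K_def card_PiE)
  finally have "norm (b \<alpha>) \<le> M + e"
    unfolding A1 using m0 by simp
  then show "norm (c \<alpha>) * \<rho> ^ multi_size \<alpha> / sqrt (multi_fact \<alpha>) \<le> M + e"
    using \<rho> by (simp add: b_def norm_mult norm_divide norm_power less_imp_le)
qed

text \<open>Dominated convergence for unordered sums.\<close>

lemma infsum_tendsto_zero:
  fixes f :: "nat \<Rightarrow> 'a \<Rightarrow> real"
  assumes bound: "\<And>n \<alpha>. \<bar>f n \<alpha>\<bar> \<le> g \<alpha>" and g: "g summable_on UNIV"
    and lim: "\<And>\<alpha>. (\<lambda>n. f n \<alpha>) \<longlonglongrightarrow> 0"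
  shows "(\<lambda>n. \<Sum>\<^sub>\<infinity>\<alpha>. f n \<alpha>) \<longlonglongrightarrow> 0"
proof (rule LIMSEQ_I, goal_cases)
  case (1 e)
  have ul: "uniform_limit UNIV (\<lambda>F n. \<Sum>\<alpha>\<in>F. f n \<alpha>) (\<lambda>n. \<Sum>\<^sub>\<infinity>\<alpha>. f n \<alpha>) (finite_subsets_at_top UNIV)"
    by (rule Weierstrass_m_test_general[where M = g]) (use bound g in auto)
  have "e / 2 > 0" using 1 by simp
  from eventually_happens'[OF finite_subsets_at_top_neq_bot uniform_limitD[OF ul this]]
  obtain F where F: "\<And>n. dist (\<Sum>\<alpha>\<in>F. f n \<alpha>) (\<Sum>\<^sub>\<infinity>\<alpha>. f n \<alpha>) < e / 2"
    by auto
  have "(\<lambda>n. \<Sum>\<alpha>\<in>F. f n \<alpha>) \<longlonglongrightarrow> (\<Sum>\<alpha>\<in>F. 0)"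
    by (intro tendsto_sum lim)
  then obtain n0 where n0: "\<And>n. n \<ge> n0 \<Longrightarrow> \<bar>\<Sum>\<alpha>\<in>F. f n \<alpha>\<bar> < e / 2"
    using LIMSEQ_D[OF _ \<open>e / 2 > 0\<close>] by fastforce
  have "\<bar>\<Sum>\<^sub>\<infinity>\<alpha>. f n \<alpha>\<bar> < e" if "n \<ge> n0" for n
    using F[of n] n0[OF that] unfolding dist_real_def by linarith
  then show ?case by auto
qed

lemma pointwise_convergent_subsequence:
  fixes f :: "nat \<Rightarrow> 'a::countable \<Rightarrow> complex"
  assumes "\<And>n a. norm (f n a) \<le> M a"
  obtains r g where "strict_mono (r :: nat \<Rightarrow> nat)" "\<And>a. (\<lambda>n. f (r n) a) \<longlonglongrightarrow> g a"
proof -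
  interpret subseqs "\<lambda>k r. convergent (\<lambda>n. f (r n) (from_nat k :: 'a))"
  proof
    fix k and s :: "nat \<Rightarrow> nat"
    have "bounded (range (\<lambda>n. f (s n) (from_nat k :: 'a)))"
      using assms by (auto intro: boundedI)
    then obtain l r where "strict_mono r" "((\<lambda>n. f (s n) (from_nat k :: 'a)) \<circ> r) \<longlonglongrightarrow> l"
      using bounded_imp_convergent_subsequence by blast
    then show "\<exists>r. strict_mono r \<and> convergent (\<lambda>n. f ((s \<circ> r) n) (from_nat k :: 'a))"
      by (auto simp: convergent_def comp_def)
  qed
  have "\<exists>l. (\<lambda>n. f (diagseq n) a) \<longlonglongrightarrow> l" for a
  proof -
    have "convergent (\<lambda>n. f ((diagseq \<circ> (+) (Suc (to_nat a))) n) (from_nat (to_nat a) :: 'a))"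
    proof (rule diagseq_holds)
      fix r s :: "nat \<Rightarrow> nat" and k assume "strict_mono r" "convergent (\<lambda>n. f (s n) (from_nat k :: 'a))"
      then show "convergent (\<lambda>n. f ((s \<circ> r) n) (from_nat k :: 'a))"
        using convergent_subseq_convergent[of "\<lambda>n. f (s n) (from_nat k :: 'a)" r] by (simp add: comp_def)
    qed
    then obtain l where "(\<lambda>n. f (diagseq (n + Suc (to_nat a))) a) \<longlonglongrightarrow> l"
      by (auto simp: convergent_def comp_def add.commute)
    then show ?thesis
      using LIMSEQ_offset[of "\<lambda>n. f (diagseq n) a"] by blast
  qed
  then obtain g where "\<And>a. (\<lambda>n. f (diagseq n) a) \<longlonglongrightarrow> g a"
    by metis
  with that subseq_diagseq show ?thesis by blast
qed

text \<open>Montel's theorem. Cauchy's estimates bound each coefficient, so a diagonal subsequence converges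
coefficientwise; the estimate for the radius \<open>2 \<sigma>\<close> then dominates the series on the polydisc of
radius \<open>\<sigma>\<close> by a geometric one. As the estimates hold for all radii, the limit coefficients satisfy
the growth condition of \<open>H_flat'\<close>.\<close>

lemma Bargmann_Montel:
  fixes c :: "nat \<Rightarrow> ('d::finite \<Rightarrow> nat) \<Rightarrow> complex"
  assumes c: "\<And>n. c n \<in> H_flat'"
    and bd: "\<And>\<rho>. \<exists>M. \<forall>n. \<forall>z\<in>polydisc \<rho>. norm (Bargmann (c n) z) \<le> M"
  obtains r a where "strict_mono (r :: nat \<Rightarrow> nat)" "a \<in> H_flat'"
    "\<And>\<rho>. uniform_limit (polydisc \<rho>) (\<lambda>n. Bargmann (c (r n))) (Bargmann a) sequentially"
proof -
  have "\<exists>M>0. \<forall>n \<alpha>. norm (c n \<alpha>) * \<rho> ^ multi_size \<alpha> / sqrt (multi_fact \<alpha>) \<le> M" if "\<rho> > 0" for \<rho>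
  proof -
    obtain M where M: "\<And>n z. z \<in> polydisc \<rho> \<Longrightarrow> norm (Bargmann (c n) z) \<le> M"
      using bd by blast
    then have "norm (c n \<alpha>) * \<rho> ^ multi_size \<alpha> / sqrt (multi_fact \<alpha>) \<le> M" for n \<alpha>
      using that by (intro coefficient_bound_by_sup c) auto
    then show ?thesis
      by (intro exI[of _ "max M 1"]) (simp add: le_max_iff_disj)
  qed
  then obtain M where M0: "\<And>\<rho>. \<rho> > 0 \<Longrightarrow> M \<rho> > 0"
    and M: "\<And>\<rho> n \<alpha>. \<rho> > 0 \<Longrightarrow> norm (c n \<alpha>) * \<rho> ^ multi_size \<alpha> / sqrt (multi_fact \<alpha>) \<le> M \<rho>"
    by metis
  have "norm (c n \<alpha>) \<le> M 1 * sqrt (multi_fact \<alpha>)" for n \<alpha>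
    using M[of 1 n \<alpha>] by (simp add: pos_divide_le_eq)
  then obtain r a where r: "strict_mono r" and a: "\<And>\<alpha>. (\<lambda>n. c (r n) \<alpha>) \<longlonglongrightarrow> a \<alpha>"
    using pointwise_convergent_subsequence[of c "\<lambda>\<alpha>. M 1 * sqrt (multi_fact \<alpha>)"] by blast
  have Ma: "norm (a \<alpha>) * \<rho> ^ multi_size \<alpha> / sqrt (multi_fact \<alpha>) \<le> M \<rho>" if "\<rho> > 0" for \<rho> \<alpha>
  proof (rule LIMSEQ_le_const2)
    show "(\<lambda>n. norm (c (r n) \<alpha>) * \<rho> ^ multi_size \<alpha> / sqrt (multi_fact \<alpha>))
        \<longlonglongrightarrow> norm (a \<alpha>) * \<rho> ^ multi_size \<alpha> / sqrt (multi_fact \<alpha>)"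
      by (intro tendsto_intros a) auto
  qed (use M that in auto)
  have aH: "a \<in> H_flat'"
    unfolding H_flat'_iff
  proof (intro allI impI)
    fix s :: real assume s: "s > 0"
    have "norm (a \<alpha>) \<le> M (1/s) * s ^ multi_size \<alpha> * sqrt (multi_fact \<alpha>)" for \<alpha>
      using Ma[of "1/s" \<alpha>] s by (simp add: field_simps power_divide)
    then show "\<exists>C>0. \<forall>\<alpha>. norm (a \<alpha>) \<le> C * s ^ multi_size \<alpha> * sqrt (multi_fact \<alpha>)"
      using M0[of "1/s"] s by auto
  qed
  have "uniform_limit (polydisc \<rho>) (\<lambda>n. Bargmann (c (r n))) (Bargmann a) sequentially" for \<rho>
  proof (rule uniform_limitI)
    fix e :: real assume "e > 0"
    define \<sigma> where "\<sigma> = \<bar>\<rho>\<bar> + 1"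
    have \<sigma>: "\<sigma> > 0" by (simp add: \<sigma>_def)
    define f where "f n \<alpha> = norm (c (r n) \<alpha> - a \<alpha>) * \<sigma> ^ multi_size \<alpha> / sqrt (multi_fact \<alpha>)" for n \<alpha>
    have f0: "f n \<alpha> \<ge> 0" for n \<alpha>
      using \<sigma> by (simp add: f_def less_imp_le)
    have f: "f n \<alpha> \<le> 2 * M (2 * \<sigma>) * (1/2) ^ multi_size \<alpha>" for n \<alpha>
    proof -
      have "norm (c (r n) \<alpha> - a \<alpha>) * (2 * \<sigma>) ^ multi_size \<alpha> / sqrt (multi_fact \<alpha>)
          \<le> (norm (c (r n) \<alpha>) + norm (a \<alpha>)) * (2 * \<sigma>) ^ multi_size \<alpha> / sqrt (multi_fact \<alpha>)"
        using \<sigma> by (intro divide_right_mono mult_right_mono norm_triangle_ineq4) (auto simp: less_imp_le)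
      also have "\<dots> \<le> 2 * M (2 * \<sigma>)"
        using M[of "2 * \<sigma>" "r n" \<alpha>] Ma[of "2 * \<sigma>" \<alpha>] \<sigma> by (simp add: add_divide_distrib distrib_right)
      finally show ?thesis
        by (simp add: f_def power_mult_distrib field_simps)
    qed
    have summ: "(\<lambda>\<alpha>::'d \<Rightarrow> nat. 2 * M (2 * \<sigma>) * (1/2) ^ multi_size \<alpha>) summable_on UNIV"
      by (intro summable_on_cmult_right geometric_multi_summable) auto
    have fs: "f n summable_on UNIV" for n
      by (rule summable_on_comparison_test[OF summ f f0])
    have "(\<lambda>n. \<Sum>\<^sub>\<infinity>\<alpha>. f n \<alpha>) \<longlonglongrightarrow> 0"
    proof (rule infsum_tendsto_zero[OF _ summ])
      show "(\<lambda>n. f n \<alpha>) \<longlonglongrightarrow> 0" for \<alpha>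
      proof -
        have "(\<lambda>n. f n \<alpha>) \<longlonglongrightarrow> norm (a \<alpha> - a \<alpha>) * \<sigma> ^ multi_size \<alpha> / sqrt (multi_fact \<alpha>)"
          unfolding f_def by (intro tendsto_intros a) auto
        then show ?thesis by simp
      qed
    qed (use f f0 in auto)
    then have "\<forall>\<^sub>F n in sequentially. (\<Sum>\<^sub>\<infinity>\<alpha>. f n \<alpha>) < e"
      using \<open>e > 0\<close> by (rule order_tendstoD)
    then show "\<forall>\<^sub>F n in sequentially. \<forall>z\<in>polydisc \<rho>. dist (Bargmann (c (r n)) z) (Bargmann a z) < e"
    proof eventually_elim
      case (elim n)
      show ?case
      proof
        fix z :: "complex ^ 'd" assume "z \<in> polydisc \<rho>"
        then have "norm (z $ i) \<le> \<rho>" for i by (simp add: polydisc_def)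
        then have "norm (z $ i) \<le> \<sigma>" for i unfolding \<sigma>_def by (smt (verit))
        then have z: "z \<in> polydisc \<sigma>"
          by (simp add: polydisc_def)
        have le: "norm (Bargmann_term (c (r n) - a) z \<alpha>) \<le> f n \<alpha>" for \<alpha>
          using norm_Bargmann_term_le[OF z, of "c (r n) - a" \<alpha>] by (simp add: f_def)
        then have abs: "(\<lambda>\<alpha>. norm (Bargmann_term (c (r n) - a) z \<alpha>)) summable_on UNIV"
          by (rule Infinite_Sum.abs_summable_on_comparison_test'[OF fs])
        have "dist (Bargmann (c (r n)) z) (Bargmann a z) = norm (Bargmann (c (r n) - a) z)"
          by (simp add: dist_norm Bargmann_diff c aH)
        also have "\<dots> \<le> (\<Sum>\<^sub>\<infinity>\<alpha>. norm (Bargmann_term (c (r n) - a) z \<alpha>))"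
          unfolding Bargmann_eq by (rule norm_infsum_bound[OF abs])
        also have "\<dots> \<le> (\<Sum>\<^sub>\<infinity>\<alpha>. f n \<alpha>)"
          by (rule infsum_mono[OF abs fs le])
        finally show "dist (Bargmann (c (r n)) z) (Bargmann a z) < e"
          using elim by simp
      qed
    qed
  qed
  with r aH that show ?thesis by blast
qed

section \<open>Mean values of entire functions\<close>

lemma mean_value_circle:
  assumes "g holomorphic_on UNIV"
  shows "ennreal (norm (g 0)) \<le> (\<integral>\<^sup>+t\<in>{0..1}. ennreal (norm (g (exp (2 * of_real pi * \<i> * of_real t)))) \<partial>lborel)"
proof -
  define h where "h = (\<lambda>t::real. g (exp (2 * of_real pi * \<i> * of_real t)))"
  have "((\<lambda>u. g u / (u - 0)) has_contour_integral (2 * of_real pi * \<i> * g 0)) (circlepath 0 1)"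
    using assms by (intro Cauchy_integral_circlepath_simple) (auto intro: holomorphic_on_subset)
  then have "((\<lambda>t. 2 * of_real pi * \<i> * h t) has_integral 2 * of_real pi * \<i> * g 0) {0..1}"
    unfolding has_contour_integral vector_derivative_circlepath h_def
    by (simp add: circlepath mult_ac)
  moreover define a where "a = 2 * of_real pi * \<i>"
  ultimately have "((\<lambda>t. a * h t) has_integral a * g 0) {0..1}"
    by simp
  from has_integral_mult_right[OF this, of "1 / a"]
  have "((\<lambda>t. 1 / a * (a * h t)) has_integral 1 / a * (a * g 0)) {0..1}" .
  moreover have "a \<noteq> 0"
    by (simp add: a_def)
  ultimately have h: "(h has_integral g 0) {0..1}"
    by simp
  have "continuous_on UNIV h"
    unfolding h_def
  proof (rule continuous_on_compose2[OF holomorphic_on_imp_continuous_on[OF assms]])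
    show "continuous_on UNIV (\<lambda>t::real. exp (2 * complex_of_real pi * \<i> * of_real t))"
      by (intro continuous_intros)
  qed simp
  then have int: "set_integrable lborel {0..1} h"
    by (intro borel_integrable_atLeastAtMost') (auto intro: continuous_on_subset)
  have "g 0 = (LINT t:{0..1}|lborel. h t)"
    using set_borel_integral_eq_integral(2)[OF int] h by (simp add: integral_unique)
  then have "ennreal (norm (g 0)) \<le> (\<integral>\<^sup>+t. ennreal (norm (indicator {0..1} t *\<^sub>R h t)) \<partial>lborel)"
    using integral_norm_bound_ennreal[OF int[unfolded set_integrable_def]]
    by (simp add: set_lebesgue_integral_def)
  also have "\<dots> = (\<integral>\<^sup>+t\<in>{0..1}. ennreal (norm (h t)) \<partial>lborel)"
    by (intro nn_integral_cong) (simp add: indicator_def)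
  finally show ?thesis unfolding h_def .
qed

text \<open>The point of \<open>\<complex>\<^sup>d\<close> at which the Bargmann transform is evaluated in the definition of the short-time
Fourier transform.\<close>

definition to_complex :: "(real ^ 'd) \<times> (real ^ 'd) \<Rightarrow> complex ^ 'd::finite" where
  "to_complex X = (\<chi> i. Complex (fst X $ i / sqrt 2) (- snd X $ i / sqrt 2))"

text \<open>Multiplication by \<open>exp (i t)\<close> on \<open>\<complex>\<^sup>d\<close>, transported to phase space by \<open>to_complex\<close>.\<close>

definition phase_rotation :: "real \<Rightarrow> (real ^ 'd) \<times> (real ^ 'd) \<Rightarrow> (real ^ 'd) \<times> (real ^ 'd::finite)" where
  "phase_rotation t X = (cos t *\<^sub>R fst X + sin t *\<^sub>R snd X, cos t *\<^sub>R snd X - sin t *\<^sub>R fst X)"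

lemma to_complex_add: "to_complex (X + Y) $ i = to_complex X $ i + to_complex Y $ i"
  by (simp add: to_complex_def complex_eq_iff add_divide_distrib diff_divide_distrib)

lemma to_complex_phase_rotation: "to_complex (phase_rotation t X) $ i = exp (\<i> * of_real t) * to_complex X $ i"
  by (simp add: to_complex_def phase_rotation_def exp_Euler complex_eq_iff cos_of_real sin_of_real
      add_divide_distrib diff_divide_distrib algebra_simps)

lemma orthogonal_transformation_phase_rotation: "orthogonal_transformation (phase_rotation t)"
  unfolding orthogonal_transformation_def
proof (intro conjI allI)
  show "linear (phase_rotation t)"
    by (intro linearI) (simp_all add: phase_rotation_def algebra_simps scaleR_add_right)
  fix X Y :: "(real ^ 'a) \<times> (real ^ 'a)"
  have "phase_rotation t X \<bullet> phase_rotation t Y =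
      ((cos t)\<^sup>2 + (sin t)\<^sup>2) * (fst X \<bullet> fst Y) + ((cos t)\<^sup>2 + (sin t)\<^sup>2) * (snd X \<bullet> snd Y)"
    unfolding phase_rotation_def power2_eq_square
    by (simp add: inner_add inner_diff inner_commute algebra_simps del: sin_cos_squared_add3)
  then show "phase_rotation t X \<bullet> phase_rotation t Y = X \<bullet> Y"
    by (simp add: inner_prod_def)
qed

lemma norm_to_complex_component_le: "norm (to_complex X $ i) \<le> norm X"
proof -
  have "(norm (to_complex X $ i))\<^sup>2 = ((fst X $ i)\<^sup>2 + (snd X $ i)\<^sup>2) / 2"
    by (simp add: to_complex_def cmod_power2 power_divide add_divide_distrib)
  also have "\<dots> \<le> (norm (fst X))\<^sup>2 + (norm (snd X))\<^sup>2"
  proof -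
    have "(a + b) / 2 \<le> A + B" if "0 \<le> a" "0 \<le> b" "a \<le> A" "b \<le> B" for a b A B :: real
      using that by simp
    then show ?thesis
      using power_mono[OF component_le_norm_cart[of "fst X" i] abs_ge_zero, of 2]
        power_mono[OF component_le_norm_cart[of "snd X" i] abs_ge_zero, of 2]
      unfolding power2_abs by (meson zero_le_power2)
  qed
  also have "\<dots> = (norm X)\<^sup>2"
    by (simp add: norm_prod_def)
  finally show ?thesis by (simp add: power2_le_iff_abs_le)
qed

lemma continuous_on_to_complex: "continuous_on S to_complex"
proof -
  have "continuous_on UNIV (to_complex :: (real ^ 'a) \<times> (real ^ 'a) \<Rightarrow> _)"
    unfolding to_complex_def Complex_eq by (intro continuous_intros) auto
  then show ?thesis by (rule continuous_on_subset) simp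
qed

lemma continuous_on_Bargmann_to_complex:
  "c \<in> H_flat' \<Longrightarrow> continuous_on S (\<lambda>X. Bargmann c (to_complex X))"
  by (intro continuous_on_compose2[OF continuous_on_Bargmann[of c UNIV] continuous_on_to_complex]) auto

text \<open>Averaging over the circle action \<open>Y \<mapsto> exp (i t) Y\<close>: along the complex line through \<open>X\<close> in the
direction \<open>Y\<close>, the one-variable mean value property bounds the value at \<open>X\<close>. Integrate this over \<open>Y\<close> in
the ball of radius \<open>\<delta>\<close>; the action preserves the ball and Lebesgue measure, so the average over \<open>t\<close>
disappears.\<close>

lemma Bargmann_sub_mean_value:
  fixes X :: "(real ^ 'd::finite) \<times> (real ^ 'd)"
  assumes c: "c \<in> H_flat'"
  shows "ennreal (norm (Bargmann c (to_complex X))) * emeasure lborel (ball (0 :: (real ^ 'd) \<times> (real ^ 'd)) \<delta>)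
    \<le> (\<integral>\<^sup>+Y\<in>ball X \<delta>. ennreal (norm (Bargmann c (to_complex Y))) \<partial>lborel)"
proof -
  define u where "u Y = norm (Bargmann c (to_complex Y))" for Y
  have cont: "continuous_on UNIV u"
    unfolding u_def by (intro continuous_intros continuous_on_Bargmann_to_complex c)
  have [measurable]: "u \<in> borel_measurable borel"
    using cont by (rule borel_measurable_continuous_onI)
  have [measurable]: "ball Z d \<in> sets borel" "cball Z d \<in> sets borel" for Z :: "(real ^ 'd) \<times> (real ^ 'd)" and d
    by simp_all
  have contR: "continuous_on UNIV (\<lambda>p::((real ^ 'd) \<times> (real ^ 'd)) \<times> real. X + phase_rotation (2 * pi * snd p) (fst p))"
    unfolding phase_rotation_def by (intro continuous_intros)
  have [measurable]: "(\<lambda>p. X + phase_rotation (2 * pi * snd p) (fst p)) \<in> borel_measurable (borel \<Otimes>\<^sub>M borel)"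
    using borel_measurable_continuous_onI[OF contR] by (simp add: borel_prod)
  have rot [measurable]: "phase_rotation t \<in> borel_measurable borel" for t :: real
    unfolding phase_rotation_def by (intro borel_measurable_continuous_onI continuous_intros)
  have line: "(\<chi> i. to_complex X $ i + exp (2 * of_real pi * \<i> * of_real t) * to_complex Y $ i) =
      to_complex (X + phase_rotation (2 * pi * t) Y)" for t and Y :: "(real ^ 'd) \<times> (real ^ 'd)"
    by (simp add: vec_eq_iff to_complex_add to_complex_phase_rotation mult_ac)
  have circle: "ennreal (u X) \<le> (\<integral>\<^sup>+t\<in>{0..1}. ennreal (u (X + phase_rotation (2 * pi * t) Y)) \<partial>lborel)" for Y
  proof -
    define g where "g w = Bargmann c (\<chi> i. to_complex X $ i + w * to_complex Y $ i)" for w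
    have "g holomorphic_on UNIV"
      unfolding g_def by (rule Bargmann_holomorphic_on_lines[OF c])
    from mean_value_circle[OF this] show ?thesis
      unfolding g_def line u_def[symmetric] by (simp add: u_def vec_lambda_eta)
  qed
  have "ennreal (u X) * emeasure lborel (ball (0 :: (real ^ 'd) \<times> (real ^ 'd)) \<delta>) =
      (\<integral>\<^sup>+Y. ennreal (u X) * indicator (ball 0 \<delta>) (Y :: (real ^ 'd) \<times> (real ^ 'd)) \<partial>lborel)"
    by (simp add: nn_integral_cmult_indicator)
  also have "\<dots> \<le> (\<integral>\<^sup>+Y. (\<integral>\<^sup>+t. ennreal (u (X + phase_rotation (2 * pi * t) Y)) * indicator (ball 0 \<delta>) Y
      * indicator {0..1} t \<partial>lborel) \<partial>lborel)"
  proof (intro nn_integral_mono)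
    fix Y
    show "ennreal (u X) * indicator (ball 0 \<delta>) Y \<le> (\<integral>\<^sup>+t. ennreal (u (X + phase_rotation (2 * pi * t) Y)) * indicator (ball 0 \<delta>) Y
        * indicator {0..1} t \<partial>lborel)"
      using circle[of Y] by (simp add: indicator_def)
  qed
  also have "\<dots> = (\<integral>\<^sup>+t. (\<integral>\<^sup>+Y. ennreal (u (X + phase_rotation (2 * pi * t) Y)) * indicator (ball 0 \<delta>) Y
      * indicator {0..1} t \<partial>lborel) \<partial>lborel)"
  proof (rule lborel_pair.Fubini'[symmetric])
    have [measurable]: "Measurable.pred (borel \<Otimes>\<^sub>M borel) (\<lambda>p. fst p \<in> ball (0 :: (real ^ 'd) \<times> (real ^ 'd)) \<delta>)"
      "Measurable.pred (borel \<Otimes>\<^sub>M borel) (\<lambda>p. snd p \<in> {0..1::real})"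
      by (auto intro!: measurable_compose[OF measurable_fst] measurable_compose[OF measurable_snd])
    have "(\<lambda>p. ennreal (u (X + phase_rotation (2 * pi * snd p) (fst p))) * indicator (ball 0 \<delta>) (fst p)
        * indicator {0..1} (snd p)) \<in> borel_measurable (borel \<Otimes>\<^sub>M borel)"
      by (intro borel_measurable_times_ennreal borel_measurable_indicator') measurable
    then show "(\<lambda>(Y, t). ennreal (u (X + phase_rotation (2 * pi * t) Y)) * indicator (ball 0 \<delta>) Y
        * indicator {0..1} t) \<in> borel_measurable (lborel \<Otimes>\<^sub>M lborel)"
      by (simp add: case_prod_beta' cong: measurable_cong_sets)
  qed
  also have "\<dots> = (\<integral>\<^sup>+t. (\<integral>\<^sup>+Y. ennreal (u (X + Y)) * indicator (ball 0 \<delta>) Y \<partial>lborel)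
      * indicator {0..1} (t::real) \<partial>lborel)"
  proof (intro nn_integral_cong)
    fix t :: real
    have ind: "indicator (ball 0 \<delta>) Y = (indicator (ball 0 \<delta>) (phase_rotation (2 * pi * t) Y) :: ennreal)"
      for Y :: "(real ^ 'd) \<times> (real ^ 'd)"
      using orthogonal_transformation_norm[OF orthogonal_transformation_phase_rotation, of "2 * pi * t" Y]
      by (simp add: indicator_def)
    have "(\<integral>\<^sup>+Y. ennreal (u (X + Y)) * indicator (ball 0 \<delta>) Y \<partial>lborel) =
        (\<integral>\<^sup>+Y. ennreal (u (X + Y)) * indicator (ball 0 \<delta>) Y \<partial>distr lborel borel (phase_rotation (2 * pi * t)))"
      by (simp add: lborel_distr_orthogonal[OF orthogonal_transformation_phase_rotation])
    also have "\<dots> = (\<integral>\<^sup>+Y. ennreal (u (X + phase_rotation (2 * pi * t) Y)) * indicator (ball 0 \<delta>) Y \<partial>lborel)"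
      by (subst nn_integral_distr) (simp_all add: ind[symmetric] borel_measurable_times_ennreal)
    finally show "(\<integral>\<^sup>+Y. ennreal (u (X + phase_rotation (2 * pi * t) Y)) * indicator (ball 0 \<delta>) Y
        * indicator {0..1} t \<partial>lborel) =
        (\<integral>\<^sup>+Y. ennreal (u (X + Y)) * indicator (ball 0 \<delta>) Y \<partial>lborel) * indicator {0..1} t"
      by (simp add: nn_integral_multc)
  qed
  also have "\<dots> = (\<integral>\<^sup>+Y. ennreal (u (X + Y)) * indicator (ball 0 \<delta>) Y \<partial>lborel)"
    by (subst nn_integral_cmult) auto
  also have "\<dots> = (\<integral>\<^sup>+Y. ennreal (u (X + Y)) * indicator (ball X \<delta>) (X + Y) \<partial>lborel)"
    by (intro nn_integral_cong) (simp add: indicator_def dist_norm)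
  also have "\<dots> = (\<integral>\<^sup>+Y. ennreal (u Y) * indicator (ball X \<delta>) Y \<partial>distr lborel borel ((+) X))"
    by (subst nn_integral_distr) simp_all
  finally show ?thesis
    by (simp add: u_def lborel_distr_plus)
qed

text \<open>The mean value inequality implies its own analogue with exponent \<open>r < 1\<close>, as observed by Hardy and
Littlewood and by Fefferman and Stein. This is what allows quasi-norms with exponents below \<open>1\<close>.

With \<open>n\<close> the dimension and \<open>\<rho> = R + 1\<close>, let \<open>S\<close> be the maximum of \<open>W = u \<sqdot> (\<rho> - |\<sqdot>|)\<^bsup>n/r\<^esup>\<close> on the
ball of radius \<open>\<rho>\<close>. Near a maximum point, at half its distance \<open>2 \<delta>\<close> from the boundary, \<open>u \<le> S \<delta>\<^bsup>-n/r\<^esup>\<close>,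
and so \<open>u \<le> (S \<delta>\<^bsup>-n/r\<^esup>)\<^bsup>1-r\<^esup> u\<^bsup>r\<^esup>\<close>. The mean value inequality on the ball of radius \<open>\<delta>\<close> turns this into
\<open>S \<lesssim> S\<^bsup>1-r\<^esup> I\<close>; the exponent \<open>n/r\<close> is the one for which all powers of \<open>\<delta>\<close> cancel.\<close>

lemma sub_mean_value_powr:
  fixes R r :: real
  assumes r: "0 < r" "r \<le> 1"
  obtains C where "0 \<le> C"
    "\<And>(u :: 'a::euclidean_space \<Rightarrow> real) X I. continuous_on UNIV u \<Longrightarrow> (\<And>X. 0 \<le> u X) \<Longrightarrow>
      (\<And>X \<delta>. ennreal (u X) * emeasure lborel (ball (0::'a) \<delta>) \<le> (\<integral>\<^sup>+Y\<in>ball X \<delta>. ennreal (u Y) \<partial>lborel)) \<Longrightarrow>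
      0 \<le> I \<Longrightarrow> (\<integral>\<^sup>+Y\<in>cball 0 (R + 1). ennreal (u Y powr r) \<partial>lborel) \<le> ennreal I \<Longrightarrow>
      norm X \<le> R \<Longrightarrow> u X powr r \<le> C * I"
proof
  define n where "n = real DIM('a)"
  have n: "n > 0" by (simp add: n_def)
  define b where "b = measure lborel (ball (0::'a) 1)"
  have b: "b > 0" by (simp add: b_def content_ball_pos)
  have vol: "emeasure lborel (ball (0::'a) \<delta>) = ennreal (b * \<delta> powr n)" if "\<delta> > 0" for \<delta>
    using that emeasure_ball[of \<delta> "0::'a"] emeasure_ball[of 1 "0::'a"]
    by (simp add: b_def n_def measure_def powr_realpow unit_ball_vol_nonneg)
  show "0 \<le> 2 powr (n / r) / b" using b by simp
  fix u :: "'a \<Rightarrow> real" and X :: 'a and I :: real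
  assume cont: "continuous_on UNIV u" and u0: "\<And>X. 0 \<le> u X"
    and sub: "\<And>X \<delta>. ennreal (u X) * emeasure lborel (ball (0::'a) \<delta>) \<le> (\<integral>\<^sup>+Y\<in>ball X \<delta>. ennreal (u Y) \<partial>lborel)"
    and I0: "0 \<le> I" and I: "(\<integral>\<^sup>+Y\<in>cball 0 (R + 1). ennreal (u Y powr r) \<partial>lborel) \<le> ennreal I"
    and X: "norm X \<le> R"
  have [measurable]: "u \<in> borel_measurable borel"
    using cont by (rule borel_measurable_continuous_onI)
  have [measurable]: "ball Z d \<in> sets borel" "cball Z d \<in> sets borel" for Z :: "'a" and d
    by simp_all
  define \<rho> where "\<rho> = R + 1"
  define W where "W Y = u Y * (\<rho> - norm Y) powr (n / r)" for Y
  have nr: "n / r > 0" using n r by simp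
  have "continuous_on (cball 0 \<rho>) W"
    unfolding W_def using nr
    by (intro continuous_intros continuous_on_subset[OF cont] continuous_on_powr') auto
  moreover have "cball (0::'a) \<rho> \<noteq> {}"
    using order_trans[OF norm_ge_zero X] by (simp add: \<rho>_def)
  ultimately obtain X0 where "X0 \<in> cball 0 \<rho>" "\<forall>Y\<in>cball 0 \<rho>. W Y \<le> W X0"
    using continuous_attains_sup[OF compact_cball, of "0::'a" \<rho> W] by blast
  then have X0: "norm X0 \<le> \<rho>" and max: "\<And>Y. norm Y \<le> \<rho> \<Longrightarrow> W Y \<le> W X0"
    by simp_all
  define S where "S = W X0"
  have S0: "S \<ge> 0" by (simp add: S_def W_def u0)
  have XS: "u X \<le> S"
  proof -
    have "u X * 1 \<le> W X"
      unfolding W_def using X u0 nr by (intro mult_left_mono ge_one_powr_ge_zero) (auto simp: \<rho>_def)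
    also have "\<dots> \<le> S"
      unfolding S_def using X by (intro max) (simp add: \<rho>_def)
    finally show ?thesis by simp
  qed
  have "S powr r \<le> 2 powr (n / r) / b * I"
  proof (cases "S = 0")
    case True
    then show ?thesis using b I0 by simp
  next
    case False
    then have S: "S > 0" using S0 by simp
    have "norm X0 \<noteq> \<rho>"
      using S nr by (auto simp: S_def W_def)
    then have "norm X0 < \<rho>" using X0 by simp
    define \<delta> where "\<delta> = (\<rho> - norm X0) / 2"
    have \<delta>: "\<delta> > 0" using \<open>norm X0 < \<rho>\<close> by (simp add: \<delta>_def)
    have uX0: "u X0 = S * (2 * \<delta>) powr (- n / r)"
    proof -
      have "(2 * \<delta>) powr (n / r) * (2 * \<delta>) powr (- n / r) = 1"
        using \<delta> by (simp flip: powr_add)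
      moreover have "S = u X0 * (2 * \<delta>) powr (n / r)"
        unfolding S_def W_def \<delta>_def by (simp only: times_divide_eq_right nonzero_mult_div_cancel_left numeral_neq_zero not_False_eq_True)
      ultimately show ?thesis by (simp add: mult.assoc)
    qed
    have near: "u Y \<le> (S * \<delta> powr (- n / r)) powr (1 - r) * u Y powr r" if "Y \<in> ball X0 \<delta>" for Y
    proof (cases "u Y = 0")
      case False
      then have "u Y > 0" using u0[of Y] by simp
      have "norm Y \<le> norm X0 + \<delta>"
        using that norm_triangle_ineq2[of Y X0] by (simp add: dist_norm norm_minus_commute)
      then have Y: "\<rho> - norm Y \<ge> \<delta>"
        by (simp add: \<delta>_def field_simps)
      have "u Y * \<delta> powr (n / r) \<le> W Y"
        unfolding W_def using Y \<delta> nr u0 by (intro mult_left_mono powr_mono2) auto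
      also have "\<dots> \<le> S"
        unfolding S_def using Y \<delta> by (intro max) simp
      finally have "u Y * \<delta> powr (n / r) * \<delta> powr (- n / r) \<le> S * \<delta> powr (- n / r)"
        by (intro mult_right_mono) auto
      moreover have "\<delta> powr (n / r) * \<delta> powr (- n / r) = 1"
        using \<delta> by (simp flip: powr_add)
      ultimately have le: "u Y \<le> S * \<delta> powr (- n / r)"
        by (simp add: mult.assoc)
      have "u Y = u Y powr (1 - r) * u Y powr r"
        using \<open>u Y > 0\<close> by (simp flip: powr_add)
      also have "\<dots> \<le> (S * \<delta> powr (- n / r)) powr (1 - r) * u Y powr r"
        using le r u0 by (intro mult_right_mono powr_mono2) auto
      finally show ?thesis .
    qed (use r in auto)
    have sub2: "ball X0 \<delta> \<subseteq> cball 0 \<rho>"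
    proof
      fix Y assume "Y \<in> ball X0 \<delta>"
      then have "norm Y \<le> norm X0 + \<delta>"
        using norm_triangle_ineq2[of Y X0] by (simp add: dist_norm norm_minus_commute)
      then show "Y \<in> cball 0 \<rho>"
        using \<delta> by (simp add: \<delta>_def field_simps)
    qed
    define A where "A = (S * \<delta> powr (- n / r)) powr (1 - r)"
    have "ennreal (u X0 * (b * \<delta> powr n)) = ennreal (u X0) * emeasure lborel (ball (0::'a) \<delta>)"
      using u0 b by (simp add: vol[OF \<delta>] ennreal_mult)
    also have "\<dots> \<le> (\<integral>\<^sup>+Y\<in>ball X0 \<delta>. ennreal (u Y) \<partial>lborel)" by (rule sub)
    also have "\<dots> \<le> (\<integral>\<^sup>+Y. ennreal A * (ennreal (u Y powr r) * indicator (cball 0 \<rho>) Y) \<partial>lborel)"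
    proof (intro nn_integral_mono)
      fix Y
      show "ennreal (u Y) * indicator (ball X0 \<delta>) Y \<le> ennreal A * (ennreal (u Y powr r) * indicator (cball 0 \<rho>) Y)"
        using near[of Y] sub2 by (auto simp: indicator_def A_def simp flip: ennreal_mult intro!: ennreal_leI)
    qed
    also have "\<dots> = ennreal A * (\<integral>\<^sup>+Y\<in>cball 0 \<rho>. ennreal (u Y powr r) \<partial>lborel)"
      by (rule nn_integral_cmult) measurable
    also have "\<dots> \<le> ennreal A * ennreal I"
      using I unfolding \<rho>_def by (intro mult_left_mono) auto
    also have "\<dots> = ennreal (A * I)"
      using I0 by (simp add: A_def ennreal_mult)
    finally have le: "u X0 * (b * \<delta> powr n) \<le> A * I"
      using I0 by (simp add: A_def)
    have eqA: "A = S powr (1 - r) * \<delta> powr (- n / r + n)"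
    proof -
      have "(- n / r) * (1 - r) = - n / r + n" using r by (simp add: field_simps)
      then show ?thesis
        using S \<delta> by (simp add: A_def powr_mult powr_powr)
    qed
    have "(2 * \<delta>) powr (- n / r) = 2 powr (- n / r) * \<delta> powr (- n / r)"
      using \<delta> by (simp add: powr_mult)
    then have eqU: "u X0 * (b * \<delta> powr n) = S * 2 powr (- n / r) * b * \<delta> powr (- n / r + n)"
      unfolding uX0 powr_add[of \<delta>] by (simp only: mult_ac)
    have "\<delta> powr (- n / r + n) * (S * 2 powr (- n / r) * b) \<le> \<delta> powr (- n / r + n) * (S powr (1 - r) * I)"
      using le unfolding eqA eqU by (simp only: mult_ac)
    then have "S * 2 powr (- n / r) * b \<le> S powr (1 - r) * I"
      using \<delta> by simp
    moreover have "S = S powr (1 - r) * S powr r"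
      using S by (simp flip: powr_add)
    ultimately have "S powr (1 - r) * (S powr r * 2 powr (- n / r) * b) \<le> S powr (1 - r) * I"
      by (metis mult.assoc)
    then have "S powr r * 2 powr (- n / r) * b \<le> I"
      using S by simp
    then show ?thesis
      using b by (simp add: powr_minus field_simps)
  qed
  moreover have "u X powr r \<le> S powr r"
    using XS u0 r by (intro powr_mono2) auto
  ultimately show "u X powr r \<le> 2 powr (n / r) / b * I" by simp
qed

section \<open>Short-time Fourier transforms\<close>

lemma STFT_eq:
  "STFT c X = of_real ((2 * pi) powr (- real CARD('d) / 2) * exp (- (norm X)\<^sup>2 / 4)) *
     exp (- \<i> * of_real (fst X \<bullet> snd X) / 2) * Bargmann c (to_complex (X :: (real ^ 'd::finite) \<times> (real ^ 'd)))"
proof -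
  have "(norm X)\<^sup>2 = (norm (fst X))\<^sup>2 + (norm (snd X))\<^sup>2"
    by (simp add: norm_prod_def)
  then show ?thesis
    by (simp add: STFT_def to_complex_def case_prod_beta)
qed

lemma norm_STFT:
  "norm (STFT c X) = (2 * pi) powr (- real CARD('d) / 2) * exp (- (norm X)\<^sup>2 / 4) *
     norm (Bargmann c (to_complex (X :: (real ^ 'd::finite) \<times> (real ^ 'd))))"
  unfolding STFT_eq by (simp add: norm_mult norm_exp_eq_Re)

lemma STFT_diff:
  "c \<in> H_flat' \<Longrightarrow> c' \<in> H_flat' \<Longrightarrow> STFT (c - c') X = STFT c X - STFT c' X"
  unfolding STFT_eq by (simp add: Bargmann_diff algebra_simps)

lemma STFT_scale: "STFT (\<lambda>\<alpha>. a * c \<alpha>) X = a * STFT c X"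
  unfolding STFT_eq by (simp add: Bargmann_scale)

lemma continuous_on_STFT:
  assumes "c \<in> H_flat'"
  shows "continuous_on S (STFT c)"
proof -
  have "continuous_on S (\<lambda>X. of_real ((2 * pi) powr (- real CARD('a) / 2) * exp (- (norm X)\<^sup>2 / 4)) *
     exp (- \<i> * of_real (fst X \<bullet> snd X) / 2) * Bargmann c (to_complex X))"
    by (intro continuous_intros continuous_on_Bargmann_to_complex assms) auto
  then show ?thesis
    unfolding STFT_eq[symmetric] .
qed

lemma STFT_measurable: "c \<in> H_flat' \<Longrightarrow> STFT c \<in> borel_measurable lebesgue"
  using borel_measurable_continuous_onI[OF continuous_on_STFT[of c UNIV]]
  by (simp add: measurable_completion)

lemma to_complex_onto_polydisc:
  fixes z :: "complex ^ 'd::finite"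
  assumes "z \<in> polydisc \<rho>"
  obtains X where "to_complex X = z" "norm X \<le> 2 * sqrt 2 * real CARD('d) * \<rho>"
proof
  define X where "X = ((\<chi> i. sqrt 2 * Re (z $ i)) :: real ^ 'd, (\<chi> i. - sqrt 2 * Im (z $ i)) :: real ^ 'd)"
  show "to_complex X = z"
    by (simp add: to_complex_def X_def vec_eq_iff complex_eq_iff)
  have "\<bar>Re (z $ i)\<bar> \<le> \<rho>" "\<bar>Im (z $ i)\<bar> \<le> \<rho>" for i
    using assms abs_Re_le_cmod[of "z $ i"] abs_Im_le_cmod[of "z $ i"]
    by (auto simp: polydisc_def intro: order_trans)
  then have "\<bar>fst X $ i\<bar> \<le> sqrt 2 * \<rho>" "\<bar>snd X $ i\<bar> \<le> sqrt 2 * \<rho>" for i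
    by (simp_all add: X_def abs_mult)
  then have "(\<Sum>i\<in>UNIV. \<bar>fst X $ i\<bar>) \<le> (\<Sum>i\<in>(UNIV::'d set). sqrt 2 * \<rho>)"
      "(\<Sum>i\<in>UNIV. \<bar>snd X $ i\<bar>) \<le> (\<Sum>i\<in>(UNIV::'d set). sqrt 2 * \<rho>)"
    by (blast intro: sum_mono)+
  then have "norm (fst X) \<le> sqrt 2 * real CARD('d) * \<rho>" "norm (snd X) \<le> sqrt 2 * real CARD('d) * \<rho>"
    using norm_le_l1_cart[of "fst X"] norm_le_l1_cart[of "snd X"] by (auto simp: mult_ac)
  moreover have "norm X \<le> norm (fst X) + norm (snd X)"
    by (metis norm_Pair_le prod.collapse)
  ultimately show "norm X \<le> 2 * sqrt 2 * real CARD('d) * \<rho>"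
    by simp
qed

text \<open>On a ball, \<open>V f\<close> and the Bargmann transform differ by a factor that is bounded above and below in
modulus, so the local \<open>L\<^sup>r\<close> bounds carry over to the latter, where the mean value inequality turns
them into uniform bounds.\<close>

lemma STFT_Montel:
  fixes c :: "nat \<Rightarrow> ('d::finite \<Rightarrow> nat) \<Rightarrow> complex"
  assumes r: "0 < r" "r \<le> 1" and c: "\<And>n. c n \<in> H_flat'"
    and bd: "\<And>R. \<exists>I. \<forall>n. (\<integral>\<^sup>+X\<in>cball 0 R. ennreal (norm (STFT (c n) X) powr r) \<partial>lborel) \<le> ennreal I"
  obtains s a where "strict_mono (s :: nat \<Rightarrow> nat)" "a \<in> H_flat'"
    "\<And>R. uniform_limit (cball 0 R) (\<lambda>n. STFT (c (s n))) (STFT a) sequentially"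
proof -
  define k where "k = (2 * pi) powr (- real CARD('d) / 2)"
  have k: "k > 0" by (simp add: k_def)
  have "\<exists>M. \<forall>n. \<forall>z\<in>polydisc \<rho>. norm (Bargmann (c n) z) \<le> M" for \<rho>
  proof -
    define R where "R = 2 * sqrt 2 * real CARD('d) * \<rho>"
    obtain I where I: "\<And>n. (\<integral>\<^sup>+X\<in>cball 0 (R + 1). ennreal (norm (STFT (c n) X) powr r) \<partial>lborel) \<le> ennreal I"
      using bd by blast
    define L where "L = (exp ((R + 1)\<^sup>2 / 4) / k) powr r"
    have L: "L \<ge> 0" by (simp add: L_def)
    have int: "(\<integral>\<^sup>+X\<in>cball 0 (R + 1). ennreal (norm (Bargmann (c n) (to_complex X)) powr r) \<partial>lborel) \<le> ennreal (L * max I 0)" for n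
    proof -
      have [measurable]: "STFT (c n) \<in> borel_measurable borel"
        by (intro borel_measurable_continuous_onI continuous_on_STFT c)
      have [measurable]: "cball Z d \<in> sets borel" for Z :: "(real ^ 'd) \<times> (real ^ 'd)" and d
        by simp
      have "(\<integral>\<^sup>+X\<in>cball 0 (R + 1). ennreal (norm (Bargmann (c n) (to_complex X)) powr r) \<partial>lborel)
          \<le> (\<integral>\<^sup>+X. ennreal L * (ennreal (norm (STFT (c n) X) powr r) * indicator (cball 0 (R + 1)) X) \<partial>lborel)"
      proof (intro nn_integral_mono)
        fix X :: "(real ^ 'd) \<times> (real ^ 'd)"
        have "norm (Bargmann (c n) (to_complex X)) powr r \<le> L * norm (STFT (c n) X) powr r" if "norm X \<le> R + 1"
        proof -
          have "norm (Bargmann (c n) (to_complex X)) = exp ((norm X)\<^sup>2 / 4) / k * norm (STFT (c n) X)"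
          proof -
            have "exp ((norm X)\<^sup>2 / 4) * exp (- (norm X)\<^sup>2 / 4) = 1"
              by (simp flip: exp_add)
            moreover have "norm (STFT (c n) X) = k * exp (- (norm X)\<^sup>2 / 4) * norm (Bargmann (c n) (to_complex X))"
              unfolding k_def by (rule norm_STFT)
            ultimately show ?thesis
              using k by (simp add: mult.assoc[symmetric])
          qed
          also have "\<dots> \<le> exp ((R + 1)\<^sup>2 / 4) / k * norm (STFT (c n) X)"
            using that k by (intro mult_right_mono divide_right_mono) (auto intro: power_mono)
          finally have "norm (Bargmann (c n) (to_complex X)) powr r
              \<le> (exp ((R + 1)\<^sup>2 / 4) / k * norm (STFT (c n) X)) powr r"
            using r by (intro powr_mono2) auto
          also have "\<dots> = L * norm (STFT (c n) X) powr r"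
            unfolding L_def by (rule powr_mult)
          finally show ?thesis .
        qed
        then show "ennreal (norm (Bargmann (c n) (to_complex X)) powr r) * indicator (cball 0 (R + 1)) X
            \<le> ennreal L * (ennreal (norm (STFT (c n) X) powr r) * indicator (cball 0 (R + 1)) X)"
          using L by (auto simp: indicator_def simp flip: ennreal_mult intro!: ennreal_leI)
      qed
      also have "\<dots> = ennreal L * (\<integral>\<^sup>+X\<in>cball 0 (R + 1). ennreal (norm (STFT (c n) X) powr r) \<partial>lborel)"
        by (rule nn_integral_cmult) measurable
      also have "\<dots> \<le> ennreal L * ennreal (max I 0)"
        using I[of n] by (intro mult_left_mono order_trans[OF I] ennreal_leI) auto
      finally show ?thesis
        using L by (simp add: ennreal_mult)
    qed
    obtain C where C: "0 \<le> C" "\<And>(u :: (real ^ 'd) \<times> (real ^ 'd) \<Rightarrow> real) X I. continuous_on UNIV u \<Longrightarrow> (\<And>X. 0 \<le> u X) \<Longrightarrow>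
      (\<And>X \<delta>. ennreal (u X) * emeasure lborel (ball (0::(real ^ 'd) \<times> (real ^ 'd)) \<delta>) \<le> (\<integral>\<^sup>+Y\<in>ball X \<delta>. ennreal (u Y) \<partial>lborel)) \<Longrightarrow>
      0 \<le> I \<Longrightarrow> (\<integral>\<^sup>+Y\<in>cball 0 (R + 1). ennreal (u Y powr r) \<partial>lborel) \<le> ennreal I \<Longrightarrow>
      norm X \<le> R \<Longrightarrow> u X powr r \<le> C * I"
      by (rule sub_mean_value_powr[OF r, where R = R]) blast
    have "norm (Bargmann (c n) z) \<le> (C * (L * max I 0)) powr (1 / r)" if z: "z \<in> polydisc \<rho>" for n z
    proof -
      obtain X where X: "to_complex X = z" "norm X \<le> R"
        using to_complex_onto_polydisc[OF z] unfolding R_def by blast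
      have "norm (Bargmann (c n) (to_complex X)) powr r \<le> C * (L * max I 0)"
        using L by (intro C(2) Bargmann_sub_mean_value int X c continuous_intros continuous_on_Bargmann_to_complex) auto
      then have "(norm (Bargmann (c n) z) powr r) powr (1 / r) \<le> (C * (L * max I 0)) powr (1 / r)"
        using X r by (intro powr_mono2) auto
      then show ?thesis
        using r by (simp add: powr_powr)
    qed
    then show ?thesis by blast
  qed
  then obtain s a where s: "strict_mono s" "a \<in> H_flat'"
    and ul: "\<And>\<rho>. uniform_limit (polydisc \<rho>) (\<lambda>n. Bargmann (c (s n))) (Bargmann a) sequentially"
    using Bargmann_Montel[of c] c by metis
  have "uniform_limit (cball 0 R) (\<lambda>n. STFT (c (s n))) (STFT a) sequentially" for R
  proof (rule uniform_limitI)
    fix e :: real assume "e > 0"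
    then have "e / k > 0" using k by simp
    from uniform_limitD[OF ul this]
    have "\<forall>\<^sub>F n in sequentially. \<forall>z\<in>polydisc R. dist (Bargmann (c (s n)) z) (Bargmann a z) < e / k" .
    then show "\<forall>\<^sub>F n in sequentially. \<forall>X\<in>cball 0 R. dist (STFT (c (s n)) X) (STFT a X) < e"
    proof eventually_elim
      case (elim n)
      show ?case
      proof
        fix X :: "(real ^ 'd) \<times> (real ^ 'd)" assume "X \<in> cball 0 R"
        then have "norm X \<le> R" by simp
        then have "to_complex X \<in> polydisc R"
          unfolding polydisc_def using norm_to_complex_component_le order_trans by blast
        then have d: "dist (Bargmann (c (s n)) (to_complex X)) (Bargmann a (to_complex X)) < e / k"
          using elim by blast
        have "dist (STFT (c (s n)) X) (STFT a X) = norm (STFT (c (s n) - a) X)"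
          by (simp add: dist_norm STFT_diff c s)
        also have "\<dots> = k * exp (- (norm X)\<^sup>2 / 4) * dist (Bargmann (c (s n)) (to_complex X)) (Bargmann a (to_complex X))"
          by (simp add: norm_STFT Bargmann_diff c s k_def dist_norm)
        also have "\<dots> \<le> k * 1 * dist (Bargmann (c (s n)) (to_complex X)) (Bargmann a (to_complex X))"
          using k by (intro mult_right_mono mult_left_mono) auto
        also have "\<dots> < e"
          using d k by (simp add: field_simps)
        finally show "dist (STFT (c (s n)) X) (STFT a X) < e" .
      qed
    qed
  qed
  with s that show ?thesis by blast
qed

section \<open>Coherent states\<close>

text \<open>The Hermite coefficients of the Gaussian window, shifted in phase space to the point \<open>Y\<close> (up to a
factor of modulus \<open>1\<close>).\<close>

definition coherent_state :: "(real ^ 'd) \<times> (real ^ 'd) \<Rightarrow> ('d::finite \<Rightarrow> nat) \<Rightarrow> complex" where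
  "coherent_state Y \<alpha> = of_real (exp (- (norm Y)\<^sup>2 / 4)) *
     (\<Prod>i\<in>UNIV. cnj (to_complex Y $ i) ^ \<alpha> i) / of_real (sqrt (multi_fact \<alpha>))"

lemma power_div_fact_le_exp:
  assumes "0 \<le> (x::real)"
  shows "x ^ n / fact n \<le> exp x"
  using sum_le_suminf[OF summable_exp_generic[of x], of "{n}"] assms
  by (simp add: exp_def divide_inverse mult.commute)

lemma coherent_state_H_flat': "coherent_state Y \<in> H_flat'"
  unfolding H_flat'_iff
proof (intro allI impI)
  fix r :: real assume r: "r > 0"
  define C where "C = (\<Prod>i\<in>UNIV. exp (norm (to_complex Y $ i) / r))"
  have "norm (coherent_state Y \<alpha>) \<le> C * r ^ multi_size \<alpha> * sqrt (multi_fact \<alpha>)" for \<alpha>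
  proof -
    have "(\<Prod>i\<in>UNIV. norm (to_complex Y $ i) ^ \<alpha> i) \<le>
        (\<Prod>i\<in>UNIV. exp (norm (to_complex Y $ i) / r) * (r ^ \<alpha> i * fact (\<alpha> i)))"
    proof (intro prod_mono conjI)
      fix i
      have "(norm (to_complex Y $ i) / r) ^ \<alpha> i / fact (\<alpha> i) \<le> exp (norm (to_complex Y $ i) / r)"
        using r by (intro power_div_fact_le_exp) auto
      then show "norm (to_complex Y $ i) ^ \<alpha> i \<le> exp (norm (to_complex Y $ i) / r) * (r ^ \<alpha> i * fact (\<alpha> i))"
        using r by (simp add: field_simps power_divide)
    qed auto
    also have "\<dots> = C * r ^ multi_size \<alpha> * multi_fact \<alpha>"
      by (simp add: prod.distrib C_def prod_power_multi_size multi_fact_def)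
    finally have 1: "(\<Prod>i\<in>UNIV. norm (to_complex Y $ i) ^ \<alpha> i) \<le> C * r ^ multi_size \<alpha> * multi_fact \<alpha>" .
    have "norm (coherent_state Y \<alpha>) \<le> 1 * (\<Prod>i\<in>UNIV. norm (to_complex Y $ i) ^ \<alpha> i) / sqrt (multi_fact \<alpha>)"
      unfolding coherent_state_def norm_mult norm_divide prod_norm[symmetric] norm_power
      by (simp add: less_imp_le mult_left_le_one_le prod_nonneg divide_right_mono)
    also have "\<dots> \<le> C * r ^ multi_size \<alpha> * multi_fact \<alpha> / sqrt (multi_fact \<alpha>)"
      using 1 by (intro divide_right_mono) (auto simp: less_imp_le)
    also have "\<dots> = C * r ^ multi_size \<alpha> * sqrt (multi_fact \<alpha>)"
      by (simp add: real_div_sqrt less_imp_le flip: times_divide_eq_right)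
    finally show ?thesis .
  qed
  moreover have "C > 0" unfolding C_def by (intro prod_pos) auto
  ultimately show "\<exists>C>0. \<forall>\<alpha>. norm (coherent_state Y \<alpha>) \<le> C * r ^ multi_size \<alpha> * sqrt (multi_fact \<alpha>)"
    by blast
qed

lemma Bargmann_coherent_state:
  fixes z :: "complex ^ 'd::finite"
  shows "Bargmann (coherent_state Y) z =
     of_real (exp (- (norm Y)\<^sup>2 / 4)) * (\<Prod>i\<in>UNIV. exp (z $ i * cnj (to_complex Y $ i)))"
proof -
  define f where "f i n = (z $ i * cnj (to_complex Y $ i)) ^ n / fact n" for i and n :: nat
  have "Bargmann (coherent_state Y) z =
      (\<Sum>\<^sub>\<infinity>\<alpha>. of_real (exp (- (norm Y)\<^sup>2 / 4)) * (\<Prod>i\<in>UNIV. f i (\<alpha> i)))"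
    unfolding Bargmann_eq
  proof (intro infsum_cong)
    fix \<alpha> :: "'d \<Rightarrow> nat"
    have "complex_of_real (sqrt (multi_fact \<alpha>)) * of_real (sqrt (multi_fact \<alpha>)) = (\<Prod>i\<in>UNIV. fact (\<alpha> i))"
      by (simp add: less_imp_le flip: of_real_mult) (simp add: multi_fact_def)
    then show "Bargmann_term (coherent_state Y) z \<alpha> = of_real (exp (- (norm Y)\<^sup>2 / 4)) * (\<Prod>i\<in>UNIV. f i (\<alpha> i))"
      by (simp add: Bargmann_term_def coherent_state_def f_def prod_dividef power_mult_distrib prod.distrib mult_ac)
  qed
  also have "\<dots> = of_real (exp (- (norm Y)\<^sup>2 / 4)) * (\<Sum>\<^sub>\<infinity>\<alpha>\<in>PiE UNIV (\<lambda>_. UNIV). \<Prod>i\<in>UNIV. f i (\<alpha> i))"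
    by (simp add: infsum_cmult_right')
  also have "(\<Sum>\<^sub>\<infinity>\<alpha>\<in>PiE UNIV (\<lambda>_. UNIV). \<Prod>i\<in>UNIV. f i (\<alpha> i)) = (\<Prod>i\<in>UNIV. infsum (f i) UNIV)"
  proof (rule infsum_prod_PiE_abs)
    fix i
    show "(\<lambda>n. norm (f i n)) summable_on UNIV"
      unfolding f_def by (intro norm_summable_imp_summable_on)
        (use summable_norm_exp[of "z $ i * cnj (to_complex Y $ i)"] in \<open>simp add: divide_inverse norm_mult scaleR_conv_of_real mult_ac norm_inverse\<close>)
  qed simp
  also have "(\<Prod>i\<in>UNIV. infsum (f i) UNIV) = (\<Prod>i\<in>UNIV. exp (z $ i * cnj (to_complex Y $ i)))"
  proof (intro prod.cong refl)
    fix i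
    have "summable (\<lambda>n. norm (f i n))"
      unfolding f_def using summable_norm_exp[of "z $ i * cnj (to_complex Y $ i)"]
      by (simp add: divide_inverse norm_mult scaleR_conv_of_real mult_ac norm_inverse)
    moreover have "f i sums exp (z $ i * cnj (to_complex Y $ i))"
      unfolding f_def using exp_converges[of "z $ i * cnj (to_complex Y $ i)"]
      by (simp add: divide_inverse scaleR_conv_of_real mult_ac)
    ultimately show "infsum (f i) UNIV = exp (z $ i * cnj (to_complex Y $ i))"
      by (intro infsumI norm_summable_imp_has_sum)
  qed
  finally show ?thesis by simp
qed

lemma norm_STFT_coherent_state:
  fixes X Y :: "(real ^ 'd::finite) \<times> (real ^ 'd)"
  shows "norm (STFT (coherent_state Y) X) = (2 * pi) powr (- real CARD('d) / 2) * exp (- (norm (X - Y))\<^sup>2 / 4)"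
proof -
  have "norm (\<Prod>i\<in>UNIV. exp (to_complex X $ i * cnj (to_complex Y $ i))) =
      (\<Prod>i\<in>UNIV. exp ((fst X $ i * fst Y $ i + snd X $ i * snd Y $ i) / 2))"
    unfolding prod_norm[symmetric]
    by (intro prod.cong refl) (simp add: norm_exp_eq_Re to_complex_def add_divide_distrib)
  also have "\<dots> = exp (X \<bullet> Y / 2)"
    by (simp add: exp_sum[symmetric] inner_prod_def inner_vec_def sum.distrib sum_divide_distrib[symmetric])
  finally have "norm (STFT (coherent_state Y) X) = (2 * pi) powr (- real CARD('d) / 2) *
      (exp (- (norm X)\<^sup>2 / 4) * (exp (- (norm Y)\<^sup>2 / 4) * exp (X \<bullet> Y / 2)))"
    by (simp add: norm_STFT Bargmann_coherent_state norm_mult)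
  also have "exp (- (norm X)\<^sup>2 / 4) * (exp (- (norm Y)\<^sup>2 / 4) * exp (X \<bullet> Y / 2)) = exp (- (norm (X - Y))\<^sup>2 / 4)"
    by (simp flip: exp_add add: power2_norm_eq_inner inner_diff inner_commute field_simps)
  finally show ?thesis .
qed

section \<open>Solid quasi-Banach function spaces\<close>

text \<open>The common features of the two kinds of spaces. In \<open>limit\<close>, completeness is combined with the
identification of the limit: a Cauchy sequence that converges almost everywhere converges
in quasi-norm to its pointwise limit. The Gaussians guarantee, by solidity, that bounded functions of
compact support belong to the space.\<close>

locale quasi_Banach_function_space =
  fixes B :: "('a::euclidean_space \<Rightarrow> complex) set" and N :: "('a \<Rightarrow> complex) \<Rightarrow> real"
    and r K :: real
  assumes r: "0 < r" "r \<le> 1" and K: "1 \<le> K"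
    and measurable: "f \<in> B \<Longrightarrow> f \<in> borel_measurable lebesgue"
    and nonneg: "f \<in> B \<Longrightarrow> 0 \<le> N f"
    and solid: "g \<in> B \<Longrightarrow> f \<in> borel_measurable lebesgue \<Longrightarrow>
      (AE x in lebesgue. norm (f x) \<le> norm (g x)) \<Longrightarrow> f \<in> B \<and> N f \<le> K * N g"
    and add: "f \<in> B \<Longrightarrow> g \<in> B \<Longrightarrow> (\<lambda>x. f x + g x) \<in> B \<and> N (\<lambda>x. f x + g x) \<le> K * (N f + N g)"
    and scale: "f \<in> B \<Longrightarrow> (\<lambda>x. a * f x) \<in> B \<and> N (\<lambda>x. a * f x) \<le> norm a * N f"
    and local: "\<exists>C\<ge>0. \<forall>f\<in>B. (\<integral>\<^sup>+x\<in>cball 0 R. ennreal (norm (f x) powr r) \<partial>lborel) \<le> ennreal (C * N f powr r)"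
    and gaussian: "0 < s \<Longrightarrow> (\<lambda>x. of_real (exp (- s * (norm x)\<^sup>2))) \<in> B"
    and limit: "(\<And>n::nat. F n \<in> B) \<Longrightarrow>
      (\<And>e. 0 < e \<Longrightarrow> \<exists>M. \<forall>m\<ge>M. \<forall>n\<ge>M. N (\<lambda>x. F m x - F n x) < e) \<Longrightarrow>
      g \<in> borel_measurable lebesgue \<Longrightarrow> (AE x in lebesgue. (\<lambda>n. F n x) \<longlonglongrightarrow> g x) \<Longrightarrow>
      g \<in> B \<and> (\<lambda>n. N (\<lambda>x. F n x - g x)) \<longlonglongrightarrow> 0"
begin

lemma diff:
  assumes "f \<in> B" "g \<in> B"
  shows "(\<lambda>x. f x - g x) \<in> B \<and> N (\<lambda>x. f x - g x) \<le> K * (N f + N g)"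
proof -
  have g: "(\<lambda>x. - 1 * g x) \<in> B" "N (\<lambda>x. - 1 * g x) \<le> N g"
    using scale[OF assms(2), of "- 1"] by auto
  have "(\<lambda>x. f x + - 1 * g x) \<in> B \<and> N (\<lambda>x. f x + - 1 * g x) \<le> K * (N f + N (\<lambda>x. - 1 * g x))"
    by (rule add[OF assms(1) g(1)])
  moreover have "K * (N f + N (\<lambda>x. - 1 * g x)) \<le> K * (N f + N g)"
    using g(2) K by simp
  ultimately show ?thesis by auto
qed

end

section \<open>Weights with vanishing quotient\<close>

lemma weight_pos: "weight \<omega> \<Longrightarrow> 0 < \<omega> x"
  by (simp add: weight_def)

lemma weight_measurable: "weight \<omega> \<Longrightarrow> \<omega> \<in> borel_measurable lebesgue"
  by (simp add: weight_def)

lemma weight_bound: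
  assumes "weight \<omega>"
  obtains C where "0 < C" "AE x in lebesgue. norm x \<le> R \<longrightarrow> \<omega> x \<le> C \<and> 1 / \<omega> x \<le> C"
proof -
  obtain C where C: "AE x in lebesgue. x \<in> cball 0 R \<longrightarrow> \<omega> x \<le> C \<and> 1 / \<omega> x \<le> C"
    using assms unfolding weight_def by (metis compact_cball)
  then have "AE x in lebesgue. norm x \<le> R \<longrightarrow> \<omega> x \<le> max C 1 \<and> 1 / \<omega> x \<le> max C 1"
    by (rule AE_mp) (auto intro!: AE_I2)
  then show ?thesis using that[of "max C 1"] by simp
qed

text \<open>The form in which \<open>\<omega>\<^sub>2 / \<omega>\<^sub>1 \<in> Linfty0\<close> is used: a global bound, and an arbitrarily small bound near
infinity.\<close>

lemma Linfty0_bounds: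
  assumes "(\<lambda>X. \<omega>\<^sub>2 X / \<omega>\<^sub>1 X) \<in> Linfty0" and pos: "\<And>X. 0 < \<omega>\<^sub>1 X" "\<And>X. 0 < \<omega>\<^sub>2 X"
  obtains M where "0 \<le> M" "AE X in lebesgue. \<omega>\<^sub>2 X \<le> M * \<omega>\<^sub>1 X"
    "\<And>e. 0 < e \<Longrightarrow> \<exists>R. AE X in lebesgue. R \<le> norm X \<longrightarrow> \<omega>\<^sub>2 X \<le> e * \<omega>\<^sub>1 X"
proof -
  define q where "q x = ennreal \<bar>\<omega>\<^sub>2 x / \<omega>\<^sub>1 x\<bar>" for x
  define S where "S R = esssup lebesgue (\<lambda>x. indicator {x. R \<le> norm x} x * q x)" for R
  have fin: "esssup lebesgue q < \<infinity>" and lim: "(S \<longlongrightarrow> 0) at_top"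
    using assms by (auto simp: Linfty0_def q_def[abs_def] S_def[abs_def])
  have le: "\<omega>\<^sub>2 x \<le> t * \<omega>\<^sub>1 x" if "q x \<le> ennreal t" "t \<ge> 0" for x t
    using that pos[of x] by (simp add: q_def pos_divide_le_eq less_imp_le)
  define M where "M = enn2real (esssup lebesgue q)"
  have M: "esssup lebesgue q = ennreal M"
    using fin by (simp add: M_def)
  have M0: "0 \<le> M" by (simp add: M_def)
  have "AE x in lebesgue. q x \<le> ennreal M"
    unfolding M[symmetric] by (rule esssup_AE)
  then have 1: "AE X in lebesgue. \<omega>\<^sub>2 X \<le> M * \<omega>\<^sub>1 X"
    by (rule eventually_mono) (rule le[OF _ M0])
  have 2: "\<exists>R. AE X in lebesgue. R \<le> norm X \<longrightarrow> \<omega>\<^sub>2 X \<le> e * \<omega>\<^sub>1 X" if e: "0 < e" for e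
  proof -
    from e have "\<forall>\<^sub>F R in at_top. S R < ennreal e"
      by (intro order_tendstoD(2)[OF lim]) simp
    then obtain R where R: "S R < ennreal e"
      unfolding eventually_at_top_linorder by (meson order_refl)
    have "AE X in lebesgue. indicator {x. R \<le> norm x} X * q X \<le> S R"
      unfolding S_def by (rule esssup_AE)
    then have "AE X in lebesgue. R \<le> norm X \<longrightarrow> \<omega>\<^sub>2 X \<le> e * \<omega>\<^sub>1 X"
    proof (rule eventually_mono, intro impI)
      fix x assume "indicator {x. R \<le> norm x} x * q x \<le> S R" "R \<le> norm x"
      then have "q x \<le> ennreal e"
        using R by (simp add: order.trans less_imp_le)
      then show "\<omega>\<^sub>2 x \<le> e * \<omega>\<^sub>1 x" using le e by simp
    qed
    then show ?thesis by blast
  qed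
  show ?thesis by (rule that[OF M0 1 2])
qed

section \<open>Compactness of the embedding\<close>

lemma modulation_space_measurable:
  assumes "c \<in> H_flat'" "weight \<omega>"
  shows "(\<lambda>X. STFT c X * of_real (\<omega> X)) \<in> borel_measurable lebesgue"
  using STFT_measurable[OF assms(1)] weight_measurable[OF assms(2)] by measurable

text \<open>The subsequence of \<open>STFT_Montel\<close> is Cauchy for the second quasi-norm. The difference of two members is
dominated almost everywhere by \<open>h = \<delta> \<gamma> + \<epsilon> |D|\<close>: inside a large ball by the Gaussian \<open>\<gamma>\<close>, with \<open>\<delta>\<close>
small by uniform convergence, and outside by the difference \<open>D\<close> for the first weight, which is
bounded in \<open>B\<close>, times a bound \<open>\<epsilon>\<close> for \<open>\<omega>\<^sub>2 / \<omega>\<^sub>1\<close>. Solidity concludes.\<close>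

theorem modulation_embedding_compact:
  fixes B :: "((real ^ 'd::finite) \<times> (real ^ 'd) \<Rightarrow> complex) set"
  assumes "quasi_Banach_function_space B N r K"
    and w: "weight \<omega>\<^sub>1" "weight \<omega>\<^sub>2" and ratio: "(\<lambda>X. \<omega>\<^sub>2 X / \<omega>\<^sub>1 X) \<in> Linfty0"
  shows "compact_map (modulation_space \<omega>\<^sub>1 B) (modulation_norm \<omega>\<^sub>1 N)
        (modulation_space \<omega>\<^sub>2 B) (modulation_norm \<omega>\<^sub>2 N) (\<lambda>f. f)"
proof -
  interpret quasi_Banach_function_space B N r K by fact
  note pos = weight_pos[OF w(1)] weight_pos[OF w(2)]
  obtain M where M: "0 \<le> M" "AE X in lebesgue. \<omega>\<^sub>2 X \<le> M * \<omega>\<^sub>1 X"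
    and small: "\<And>e. 0 < e \<Longrightarrow> \<exists>R. AE X in lebesgue. R \<le> norm X \<longrightarrow> \<omega>\<^sub>2 X \<le> e * \<omega>\<^sub>1 X"
    using Linfty0_bounds[OF ratio pos] by blast
  have sub: "modulation_space \<omega>\<^sub>1 B \<subseteq> modulation_space \<omega>\<^sub>2 B"
  proof
    fix c assume "c \<in> modulation_space \<omega>\<^sub>1 B"
    then have c: "c \<in> H_flat'" and cB: "(\<lambda>X. STFT c X * of_real (\<omega>\<^sub>1 X)) \<in> B"
      by (auto simp: modulation_space_def)
    have "(\<lambda>X. STFT c X * of_real (\<omega>\<^sub>2 X)) \<in> B"
    proof (rule solid[THEN conjunct1])
      show "(\<lambda>X. of_real M * (STFT c X * of_real (\<omega>\<^sub>1 X))) \<in> B"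
        using scale[OF cB] by blast
      show "AE X in lebesgue. norm (STFT c X * of_real (\<omega>\<^sub>2 X)) \<le> norm (of_real M * (STFT c X * of_real (\<omega>\<^sub>1 X)))"
        using M(2)
      proof (rule eventually_mono)
        fix X assume "\<omega>\<^sub>2 X \<le> M * \<omega>\<^sub>1 X"
        from mult_left_mono[OF this norm_ge_zero[of "STFT c X"]]
        show "norm (STFT c X * of_real (\<omega>\<^sub>2 X)) \<le> norm (of_real M * (STFT c X * of_real (\<omega>\<^sub>1 X)))"
          using M(1) pos[of X] by (simp add: norm_mult less_imp_le mult_ac)
      qed
    qed (use c w modulation_space_measurable in auto)
    then show "c \<in> modulation_space \<omega>\<^sub>2 B" using c by (simp add: modulation_space_def)
  qed
  show ?thesis
    unfolding compact_map_def
  proof (intro conjI allI impI)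
    show "(\<lambda>f. f) ` modulation_space \<omega>\<^sub>1 B \<subseteq> modulation_space \<omega>\<^sub>2 B" using sub by simp
    fix c :: "nat \<Rightarrow> ('d \<Rightarrow> nat) \<Rightarrow> complex"
    assume "range c \<subseteq> modulation_space \<omega>\<^sub>1 B \<and> (\<exists>C. \<forall>n. modulation_norm \<omega>\<^sub>1 N (c n) \<le> C)"
    then obtain C0' where cM: "\<And>n. c n \<in> modulation_space \<omega>\<^sub>1 B" and C0': "\<And>n. modulation_norm \<omega>\<^sub>1 N (c n) \<le> C0'"
      by auto
    define G where "G n X = STFT (c n) X * of_real (\<omega>\<^sub>1 X)" for n X
    have c: "c n \<in> H_flat'" and GB: "G n \<in> B" for n
      using cM[of n] by (auto simp: modulation_space_def G_def[abs_def])
    define C0 where "C0 = max C0' 1"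
    have C0: "N (G n) \<le> C0" "C0 > 0" for n
      using C0'[of n] by (auto simp: modulation_norm_def G_def[abs_def] C0_def)
    have "\<exists>I. \<forall>n. (\<integral>\<^sup>+X\<in>cball 0 R. ennreal (norm (STFT (c n) X) powr r) \<partial>lborel) \<le> ennreal I" for R
    proof -
      obtain A where A: "0 < A" "AE X in lebesgue. norm X \<le> R \<longrightarrow> \<omega>\<^sub>1 X \<le> A \<and> 1 / \<omega>\<^sub>1 X \<le> A"
        using weight_bound[OF w(1)] by blast
      obtain L where L: "L \<ge> 0"
        "\<And>f. f \<in> B \<Longrightarrow> (\<integral>\<^sup>+x\<in>cball 0 R. ennreal (norm (f x) powr r) \<partial>lborel) \<le> ennreal (L * N f powr r)"
        using local by blast
      have "(\<integral>\<^sup>+X\<in>cball 0 R. ennreal (norm (STFT (c n) X) powr r) \<partial>lborel) \<le> ennreal (A powr r * (L * C0 powr r))" for n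
      proof -
        have [measurable]: "G n \<in> borel_measurable lebesgue" using GB measurable by blast
        have [measurable]: "cball (0 :: (real ^ 'd) \<times> (real ^ 'd)) R \<in> sets lebesgue"
          by (simp add: lmeasurable_cball fmeasurableD)
        have "(\<integral>\<^sup>+X\<in>cball 0 R. ennreal (norm (STFT (c n) X) powr r) \<partial>lebesgue)
            \<le> (\<integral>\<^sup>+X. ennreal (A powr r) * (ennreal (norm (G n X) powr r) * indicator (cball 0 R) X) \<partial>lebesgue)"
        proof (rule nn_integral_mono_AE, use A(2) in \<open>rule eventually_mono\<close>)
          fix X assume X: "norm X \<le> R \<longrightarrow> \<omega>\<^sub>1 X \<le> A \<and> 1 / \<omega>\<^sub>1 X \<le> A"
          have "norm (STFT (c n) X) powr r \<le> A powr r * norm (G n X) powr r" if "norm X \<le> R"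
          proof -
            have "1 \<le> A * \<omega>\<^sub>1 X" using X that pos(1)[of X] by (simp add: field_simps)
            then have "norm (STFT (c n) X) \<le> A * norm (G n X)"
              using mult_left_mono[of 1 "A * \<omega>\<^sub>1 X" "norm (STFT (c n) X)"] pos(1)[of X]
              by (simp add: G_def norm_mult mult_ac)
            then have "norm (STFT (c n) X) powr r \<le> (A * norm (G n X)) powr r"
              using r by (intro powr_mono2) auto
            then show ?thesis by (simp only: powr_mult)
          qed
          then show "ennreal (norm (STFT (c n) X) powr r) * indicator (cball 0 R) X
              \<le> ennreal (A powr r) * (ennreal (norm (G n X) powr r) * indicator (cball 0 R) X)"
            by (auto simp: indicator_def simp flip: ennreal_mult intro!: ennreal_leI)
        qed
        also have "\<dots> = ennreal (A powr r) * (\<integral>\<^sup>+X\<in>cball 0 R. ennreal (norm (G n X) powr r) \<partial>lebesgue)"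
          by (rule nn_integral_cmult) measurable
        also have "\<dots> \<le> ennreal (A powr r) * ennreal (L * C0 powr r)"
          unfolding nn_integral_completion
          using L C0 GB nonneg r by (intro mult_left_mono order_trans[OF L(2)] ennreal_leI mult_left_mono powr_mono2) auto
        finally show ?thesis
          using L by (simp add: ennreal_mult nn_integral_completion)
      qed
      then show ?thesis by blast
    qed
    note bd = this
    obtain s a where s: "strict_mono (s :: nat \<Rightarrow> nat)" and a: "a \<in> H_flat'"
      and ul: "\<And>R. uniform_limit (cball 0 R) (\<lambda>n. STFT (c (s n))) (STFT a) sequentially"
      by (rule STFT_Montel[of r c, OF r c bd]) (rule that)
    define F where "F n X = STFT (c (s n)) X * of_real (\<omega>\<^sub>2 X)" for n X
    define g where "g X = STFT a X * of_real (\<omega>\<^sub>2 X)" for X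
    have FB: "F n \<in> B" for n
      using cM[of "s n"] sub by (auto simp: modulation_space_def F_def[abs_def])
    define \<gamma> where "\<gamma> X = complex_of_real (exp (- 1 * (norm X)\<^sup>2))" for X :: "(real ^ 'd) \<times> (real ^ 'd)"
    have \<gamma>B: "\<gamma> \<in> B" unfolding \<gamma>_def by (rule gaussian) simp
    have cauchy: "\<exists>M. \<forall>m\<ge>M. \<forall>n\<ge>M. N (\<lambda>X. F m X - F n X) < e" if e: "0 < e" for e
    proof -
      (* The powers of K account for one use of solidity for the norm of D, two quasi-triangle
         inequalities, and one use of solidity for h; both contributions end up as e / 4. *)
      define \<epsilon> where "\<epsilon> = e / (8 * K ^ 4 * C0)"
      have \<epsilon>: "\<epsilon> > 0" using e K C0 by (simp add: \<epsilon>_def)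
      obtain R where R: "AE X in lebesgue. R \<le> norm X \<longrightarrow> \<omega>\<^sub>2 X \<le> \<epsilon> * \<omega>\<^sub>1 X"
        using small[OF \<epsilon>] by blast
      obtain A where A: "0 < A" "AE X in lebesgue. norm X \<le> R \<longrightarrow> \<omega>\<^sub>2 X \<le> A \<and> 1 / \<omega>\<^sub>2 X \<le> A"
        using weight_bound[OF w(2)] by blast
      define \<delta> where "\<delta> = e / (4 * K ^ 2 * (N \<gamma> + 1))"
      have \<delta>: "\<delta> > 0" using e K nonneg[OF \<gamma>B] by (simp add: \<delta>_def add_nonneg_pos)
      define \<eta> where "\<eta> = \<delta> / (2 * A * exp (R\<^sup>2))"
      have \<eta>: "\<eta> > 0" using \<delta> A by (simp add: \<eta>_def)
      obtain n0 where "\<forall>n\<ge>n0. \<forall>X\<in>cball 0 R. dist (STFT (c (s n)) X) (STFT a X) < \<eta>"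
        using uniform_limitD[OF ul \<eta>, of R] unfolding eventually_sequentially by blast
      then have n0: "dist (STFT (c (s n)) X) (STFT a X) < \<eta>" if "n \<ge> n0" "norm X \<le> R" for n X
        using that by (meson mem_cball_0)
      have "N (\<lambda>X. F m X - F n X) < e" if mn: "m \<ge> n0" "n \<ge> n0" for m n
      proof -
        define D where "D X = G (s m) X - G (s n) X" for X
        have D: "D \<in> B" "N D \<le> K * (2 * C0)"
          using diff[OF GB GB, of "s m" "s n"] C0(1)[of "s m"] C0(1)[of "s n"] K
          by (auto simp: D_def[abs_def] intro: order_trans mult_left_mono)
        define D' where "D' X = complex_of_real (norm (D X))" for X
        have [measurable]: "D \<in> borel_measurable lebesgue" using D measurable by blast
        have D': "D' \<in> B" "N D' \<le> K * N D"
          using solid[OF D(1), of D'] unfolding D'_def by auto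
        define h where "h X = of_real \<delta> * \<gamma> X + of_real \<epsilon> * D' X" for X
        have sc: "(\<lambda>X. of_real \<delta> * \<gamma> X) \<in> B" "N (\<lambda>X. of_real \<delta> * \<gamma> X) \<le> \<delta> * N \<gamma>"
          "(\<lambda>X. of_real \<epsilon> * D' X) \<in> B" "N (\<lambda>X. of_real \<epsilon> * D' X) \<le> \<epsilon> * N D'"
          using scale[OF \<gamma>B, of "of_real \<delta>"] scale[OF D'(1), of "of_real \<epsilon>"] \<delta> \<epsilon> by auto
        have hB: "h \<in> B" "N h \<le> K * (\<delta> * N \<gamma> + \<epsilon> * N D')"
          using add[OF sc(1,3)] sc K unfolding h_def
          by (auto intro: order_trans mult_left_mono add_mono)
        have "AE X in lebesgue. norm (F m X - F n X) \<le> norm (h X)"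
          using R A(2)
        proof (eventually_elim)
          case (elim X)
          have FD: "norm (F m X - F n X) = norm (STFT (c (s m)) X - STFT (c (s n)) X) * \<omega>\<^sub>2 X"
            using pos(2)[of X] by (simp add: F_def norm_mult flip: left_diff_distrib)
          have DD: "norm (D X) = norm (STFT (c (s m)) X - STFT (c (s n)) X) * \<omega>\<^sub>1 X"
            using pos(1)[of X] by (simp add: D_def G_def norm_mult flip: left_diff_distrib)
          have hX: "norm (h X) = \<delta> * exp (- (norm X)\<^sup>2) + \<epsilon> * norm (D X)"
          proof -
            have "h X = of_real (\<delta> * exp (- (norm X)\<^sup>2) + \<epsilon> * norm (D X))"
              by (simp add: h_def \<gamma>_def D'_def)
            moreover have "\<delta> * exp (- (norm X)\<^sup>2) + \<epsilon> * norm (D X) \<ge> 0"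
              using \<delta> \<epsilon> by simp
            ultimately show ?thesis by (metis norm_of_real abs_of_nonneg)
          qed
          show ?case
          proof (cases "R \<le> norm X")
            case True
            then have "norm (F m X - F n X) \<le> norm (STFT (c (s m)) X - STFT (c (s n)) X) * (\<epsilon> * \<omega>\<^sub>1 X)"
              unfolding FD using elim by (intro mult_left_mono) auto
            also have "\<dots> = \<epsilon> * norm (D X)" by (simp add: DD)
            finally show ?thesis
              using hX \<delta> by (smt (verit) exp_gt_zero mult_pos_pos)
          next
            case False
            then have X: "norm X \<le> R" by simp
            have "dist (STFT (c (s m)) X) (STFT (c (s n)) X) \<le> 2 * \<eta>"
              using n0[OF mn(1) X] n0[OF mn(2) X]
                dist_triangle2[of "STFT (c (s m)) X" "STFT (c (s n)) X" "STFT a X"] by linarith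
            then have "norm (F m X - F n X) \<le> 2 * \<eta> * A"
              unfolding FD using elim X \<eta> pos(2)[of X] by (intro mult_mono) (auto simp: dist_norm less_imp_le)
            also have "\<dots> = \<delta> * exp (- R\<^sup>2)"
              using A by (simp add: \<eta>_def exp_minus field_simps)
            also have "\<dots> \<le> \<delta> * exp (- (norm X)\<^sup>2)"
              using X \<delta> by (intro mult_left_mono) (auto intro: power_mono)
            also have "\<dots> \<le> norm (h X)"
              using hX \<epsilon> by simp
            finally show ?thesis .
          qed
        qed
        then have "N (\<lambda>X. F m X - F n X) \<le> K * N h"
          using solid[OF hB(1), of "\<lambda>X. F m X - F n X"] diff[OF FB FB, of m n] measurable by blast
        also have "\<dots> \<le> K * (K * (\<delta> * N \<gamma> + \<epsilon> * (K * (K * (2 * C0)))))"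
        proof -
          have "N D' \<le> K * (K * (2 * C0))"
            using D' D K by (auto intro: order_trans mult_left_mono)
          then have "K * (\<delta> * N \<gamma> + \<epsilon> * N D') \<le> K * (\<delta> * N \<gamma> + \<epsilon> * (K * (K * (2 * C0))))"
            using \<epsilon> K by simp
          from order_trans[OF hB(2) this] show ?thesis
            using K by (intro mult_left_mono) auto
        qed
        also have "\<dots> = K ^ 2 * \<delta> * N \<gamma> + 2 * K ^ 4 * C0 * \<epsilon>"
          by (simp add: power2_eq_square power4_eq_xxxx algebra_simps)
        also have "\<dots> \<le> K ^ 2 * \<delta> * (N \<gamma> + 1) + 2 * K ^ 4 * C0 * \<epsilon>"
          using K \<delta> by (intro add_right_mono mult_left_mono) auto
        also have "K ^ 2 * \<delta> * (N \<gamma> + 1) = e / 4"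
        proof -
          have "K ^ 2 * (e / (4 * K ^ 2 * p)) * p = e / 4" if "p \<noteq> 0" for p
            using K that by simp
          moreover have "N \<gamma> + 1 \<noteq> 0"
            using nonneg[OF \<gamma>B] by linarith
          ultimately show ?thesis
            unfolding \<delta>_def by blast
        qed
        also have "2 * K ^ 4 * C0 * \<epsilon> = e / 4"
          using K C0(2) by (simp add: \<epsilon>_def field_simps)
        finally show ?thesis using e by simp
      qed
      then show ?thesis by blast
    qed
    have lim: "(\<lambda>n. F n X) \<longlonglongrightarrow> g X" for X
    proof -
      have "(\<lambda>n. STFT (c (s n)) X) \<longlonglongrightarrow> STFT a X"
        using tendsto_uniform_limitI[OF ul[of "norm X"], of X] by simp
      then show ?thesis unfolding F_def g_def by (intro tendsto_intros)
    qed
    have "g \<in> B \<and> (\<lambda>n. N (\<lambda>X. F n X - g X)) \<longlonglongrightarrow> 0"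
      using modulation_space_measurable[OF a w(2)] lim
      by (intro limit[OF FB cauchy]) (auto simp: g_def[abs_def])
    moreover have "(\<lambda>X. F n X - g X) = (\<lambda>X. STFT (c (s n) - a) X * of_real (\<omega>\<^sub>2 X))" for n
      by (simp add: F_def g_def STFT_diff c a left_diff_distrib)
    ultimately have "a \<in> modulation_space \<omega>\<^sub>2 B" "(\<lambda>n. modulation_norm \<omega>\<^sub>2 N (c (s n) - a)) \<longlonglongrightarrow> 0"
      using a by (auto simp: modulation_space_def modulation_norm_def g_def[abs_def])
    then show "\<exists>g\<in>modulation_space \<omega>\<^sub>2 B. \<exists>r::nat \<Rightarrow> nat. strict_mono r \<and>
        (\<lambda>n. modulation_norm \<omega>\<^sub>2 N (c (r n) - g)) \<longlonglongrightarrow> 0"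
      using s by blast
  qed
qed

section \<open>Growth of moderate weights\<close>

lemma AE_lborel_reflect:
  fixes a :: "'a::euclidean_space"
  assumes "AE y in lborel. P y"
  shows "AE y in lborel. P (a - y)"
proof -
  have "lborel = distr lborel borel (\<lambda>y. a - y)"
    by (subst lborel_affine[of "- 1" a]) (simp_all add: density_1)
  from subst[where P = "\<lambda>M. AE y in M. P y", OF this assms]
  have "AE y in distr lborel borel (\<lambda>y. a - y). P y" .
  then show ?thesis
    by (rule AE_distrD[rotated]) simp
qed

text \<open>The comparison weight is only essentially bounded on the unit ball. But every vector \<open>y\<close> of norm at most
\<open>1\<close> is a sum of two vectors at which the bound holds: almost every \<open>z\<close> near \<open>y / 2\<close> works, with \<open>y - z\<close>
as the other summand. So \<open>\<omega>(x + y) \<le> D \<omega>(x)\<close> for all such \<open>y\<close>, and steps of length at most \<open>1\<close> give an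
exponential bound at every point, not just almost everywhere.\<close>

lemma moderate_weight_growth:
  fixes \<omega> :: "'a::euclidean_space \<Rightarrow> real"
  assumes "\<omega> \<in> moderate_weights"
  obtains C q where "0 < C" "0 \<le> q" "\<And>x y. \<omega> (x + y) \<le> C * exp (q * norm y) * \<omega> x"
proof -
  obtain v C0 where w: "weight \<omega>" and v: "weight v" and C0: "C0 > 0"
    and mod: "\<And>x y. \<omega> (x + y) \<le> C0 * \<omega> x * v y"
    using assms unfolding moderate_weights_def by blast
  have pos: "0 < \<omega> x" "0 < v x" for x
    using w v weight_pos by blast+
  obtain A where A: "0 < A" "AE y in lebesgue. norm y \<le> 1 \<longrightarrow> v y \<le> A \<and> 1 / v y \<le> A"
    using weight_bound[OF v] by blast
  have good: "AE y in lborel. norm y \<le> 1 \<longrightarrow> v y \<le> A"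
    using A(2) unfolding AE_completion_iff by (rule eventually_mono) blast
  define D where "D = max 1 ((C0 * A)\<^sup>2)"
  have D: "1 \<le> D" by (simp add: D_def)
  have step: "\<omega> (x + y) \<le> D * \<omega> x" if "norm y \<le> 1" for x y
  proof -
    have "AE z in lborel. (norm z \<le> 1 \<longrightarrow> v z \<le> A) \<and> (norm (y - z) \<le> 1 \<longrightarrow> v (y - z) \<le> A)"
      using good AE_lborel_reflect[OF good, of y] by eventually_elim blast
    moreover have "\<not> (AE z in lborel. z \<notin> ball (y /\<^sub>R 2) (1/2))"
    proof
      assume "AE z in lborel. z \<notin> ball (y /\<^sub>R 2) (1/2)"
      then have "emeasure lborel (ball (y /\<^sub>R 2) (1/2)) = 0"
        using AE_iff_null_sets[of "ball (y /\<^sub>R 2) (1/2)" lborel] by auto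
      then show False
        using content_ball_pos[of "1/2" "y /\<^sub>R 2"] by (simp add: measure_def)
    qed
    ultimately obtain z where z: "z \<in> ball (y /\<^sub>R 2) (1/2)" "norm z \<le> 1 \<longrightarrow> v z \<le> A"
      "norm (y - z) \<le> 1 \<longrightarrow> v (y - z) \<le> A"
      by (smt (verit, best) eventually_mono)
    have "norm (y /\<^sub>R 2 - z) \<le> 1/2" "norm (y /\<^sub>R 2) \<le> 1/2"
      using z(1) that by (auto simp: dist_norm)
    then have n: "norm z \<le> 1" "norm (y - z) \<le> 1"
    proof -
      assume 1: "norm (y /\<^sub>R 2 - z) \<le> 1/2" and 2: "norm (y /\<^sub>R 2) \<le> 1/2"
      have "norm z \<le> norm (y /\<^sub>R 2) + norm (y /\<^sub>R 2 - z)"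
        using norm_triangle_ineq4[of "y /\<^sub>R 2" "y /\<^sub>R 2 - z"] by simp
      then show "norm z \<le> 1" using 1 2 by simp
      have "y /\<^sub>R 2 + y /\<^sub>R 2 = y"
        by (simp flip: scaleR_add_left)
      then have "y - z = y /\<^sub>R 2 + (y /\<^sub>R 2 - z)"
        by (metis add_diff_eq)
      then have "norm (y - z) \<le> norm (y /\<^sub>R 2) + norm (y /\<^sub>R 2 - z)"
        using norm_triangle_ineq by metis
      then show "norm (y - z) \<le> 1" using 1 2 by simp
    qed
    have "\<omega> (x + y) \<le> C0 * \<omega> (x + z) * v (y - z)"
      using mod[of "x + z" "y - z"] by simp
    also have "\<dots> \<le> C0 * (C0 * \<omega> x * v z) * v (y - z)"
      using mod[of x z] C0 pos by (intro mult_right_mono mult_left_mono) (auto simp: less_imp_le)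
    also have "\<dots> \<le> C0 * (C0 * \<omega> x * A) * A"
      using z n C0 pos A(1) by (intro mult_mono mult_left_mono) (auto simp: less_imp_le)
    also have "\<dots> = (C0 * A)\<^sup>2 * \<omega> x"
      by (simp add: power2_eq_square)
    also have "\<dots> \<le> D * \<omega> x"
      using pos(1)[of x] by (intro mult_right_mono) (auto simp: D_def)
    finally show ?thesis .
  qed
  have steps: "\<omega> (x + y) \<le> D ^ n * \<omega> x" if "norm y \<le> real n" for n x y
    using that
  proof (induction n arbitrary: x y)
    case (Suc n)
    define z where "z = (real n / real (Suc n)) *\<^sub>R y"
    have yz: "y - z = (1 / real (Suc n)) *\<^sub>R y"
    proof -
      have "y - z = (1 - real n / real (Suc n)) *\<^sub>R y"
        by (simp add: z_def scaleR_diff_left)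
      also have "1 - real n / real (Suc n) = 1 / real (Suc n)"
        by (simp add: field_simps)
      finally show ?thesis .
    qed
    have "norm z = real n / real (Suc n) * norm y"
      by (simp add: z_def)
    also have "\<dots> \<le> real n / real (Suc n) * real (Suc n)"
      using Suc.prems by (intro mult_left_mono) auto
    finally have "norm z \<le> real n" by simp
    from Suc.IH[OF this] have 1: "\<omega> (x + z) \<le> D ^ n * \<omega> x" .
    have "norm (y - z) \<le> 1"
      unfolding yz using Suc.prems by simp
    from step[OF this, of "x + z"] have "\<omega> (x + y) \<le> D * \<omega> (x + z)" by simp
    also have "\<dots> \<le> D * (D ^ n * \<omega> x)"
      using 1 D by (intro mult_left_mono) auto
    finally show ?case by simp
  qed simp
  have "\<omega> (x + y) \<le> D * exp (ln D * norm y) * \<omega> x" for x y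
  proof -
    define n where "n = nat \<lceil>norm y\<rceil>"
    have n: "norm y \<le> real n" "real n \<le> norm y + 1"
      unfolding n_def using norm_ge_zero[of y] by linarith+
    have "D ^ n = D powr real n"
      using D by (simp add: powr_realpow)
    also have "\<dots> \<le> D powr (norm y + 1)"
      using n D by (intro powr_mono) auto
    also have "\<dots> = D * exp (ln D * norm y)"
      using D by (simp add: powr_def exp_add distrib_right distrib_left mult_ac)
    finally have "D ^ n * \<omega> x \<le> D * exp (ln D * norm y) * \<omega> x"
      using pos(1)[of x] by (intro mult_right_mono) auto
    with steps[OF n(1), of x] show ?thesis by linarith
  qed
  then show ?thesis using that[of D "ln D"] D by simp
qed

lemma Linfty0_I:
  fixes \<omega>\<^sub>1 \<omega>\<^sub>2 :: "'a::euclidean_space \<Rightarrow> real"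
  assumes w: "weight \<omega>\<^sub>1" "weight \<omega>\<^sub>2" and M: "\<And>x. \<omega>\<^sub>2 x / \<omega>\<^sub>1 x \<le> M"
    and small: "\<And>e. 0 < e \<Longrightarrow> \<exists>R. \<forall>x. R \<le> norm x \<longrightarrow> \<omega>\<^sub>2 x / \<omega>\<^sub>1 x \<le> e"
  shows "(\<lambda>x. \<omega>\<^sub>2 x / \<omega>\<^sub>1 x) \<in> Linfty0"
proof -
  define q where "q x = \<omega>\<^sub>2 x / \<omega>\<^sub>1 x" for x
  have q0: "q x \<ge> 0" for x
    using weight_pos[OF w(1), of x] weight_pos[OF w(2), of x] by (simp add: q_def)
  have [measurable]: "q \<in> borel_measurable lebesgue"
    unfolding q_def using weight_measurable[OF w(1)] weight_measurable[OF w(2)] by measurable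
  have [measurable]: "{x::'a. R \<le> norm x} \<in> sets lebesgue" for R
  proof -
    have "closed {x::'a. R \<le> norm x}"
      by (intro closed_Collect_le continuous_intros)
    then show ?thesis
      by (intro sets_completionI_sets) (simp add: borel_closed)
  qed
  have "esssup lebesgue (\<lambda>x. ennreal \<bar>q x\<bar>) \<le> ennreal M"
    using M unfolding q_def[symmetric]
    by (intro esssup_I AE_I2 ennreal_leI) (measurable, simp add: q0)
  then have 1: "esssup lebesgue (\<lambda>x. ennreal \<bar>q x\<bar>) < \<infinity>"
    using le_less_trans ennreal_less_top by (metis infinity_ennreal_def)
  have 2: "((\<lambda>R. esssup lebesgue (\<lambda>x. indicator {x. R \<le> norm x} x * ennreal \<bar>q x\<bar>)) \<longlongrightarrow> 0) at_top"
  proof (rule order_tendstoI)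
    fix a :: ennreal assume "0 < a"
    then obtain b where "0 < b" "b < a" using dense by blast
    then obtain e where e: "b = ennreal e" "0 < e"
      by (cases b) (auto simp: top_unique)
    obtain R where R: "\<And>x. R \<le> norm x \<Longrightarrow> q x \<le> e"
      using small[OF e(2)] by (auto simp: q_def)
    have "esssup lebesgue (\<lambda>x. indicator {x. S \<le> norm x} x * ennreal \<bar>q x\<bar>) < a" if "S \<ge> R" for S
    proof -
      have "esssup lebesgue (\<lambda>x. indicator {x. S \<le> norm x} x * ennreal \<bar>q x\<bar>) \<le> b"
      proof (intro esssup_I AE_I2)
        show "(\<lambda>x. indicator {x. S \<le> norm x} x * ennreal \<bar>q x\<bar>) \<in> borel_measurable lebesgue"
          by measurable
        show "indicator {x. S \<le> norm x} x * ennreal \<bar>q x\<bar> \<le> b" for x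
          using R[of x] q0[of x] that e by (auto simp: indicator_def intro!: ennreal_leI)
      qed
      then show ?thesis using \<open>b < a\<close> by (rule le_less_trans)
    qed
    then show "\<forall>\<^sub>F S in at_top. esssup lebesgue (\<lambda>x. indicator {x. S \<le> norm x} x * ennreal \<bar>q x\<bar>) < a"
      by (auto simp: eventually_at_top_linorder)
  qed auto
  show ?thesis
    using 1 2 unfolding Linfty0_def q_def[symmetric] by simp
qed

section \<open>Necessity of a vanishing quotient\<close>

text \<open>Coherent states escaping to infinity along points where \<open>\<omega>\<^sub>2 / \<omega>\<^sub>1 > e\<close> form a sequence which is
bounded in the first space and converges to zero pointwise, but stays away from zero in the second.
Once the quotient is shown to be small at infinity, the growth bounds show that it is bounded
elsewhere.\<close>

theorem compact_modulation_embedding_ratio: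
  fixes B :: "((real ^ 'd::finite) \<times> (real ^ 'd) \<Rightarrow> complex) set"
  assumes "quasi_Banach_function_space B N r K"
    and trans: "\<exists>C. \<forall>x. \<forall>f\<in>B. (\<lambda>y. f (y - x)) \<in> B \<and> N (\<lambda>y. f (y - x)) \<le> C * N f"
    and w: "\<omega>\<^sub>1 \<in> moderate_weights" "\<omega>\<^sub>2 \<in> moderate_weights"
    and comp: "compact_map (modulation_space \<omega>\<^sub>1 B) (modulation_norm \<omega>\<^sub>1 N)
        (modulation_space \<omega>\<^sub>2 B) (modulation_norm \<omega>\<^sub>2 N) (\<lambda>f. f)"
  shows "(\<lambda>X. \<omega>\<^sub>2 X / \<omega>\<^sub>1 X) \<in> Linfty0"
proof -
  interpret quasi_Banach_function_space B N r K by fact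
  have ww: "weight \<omega>\<^sub>1" "weight \<omega>\<^sub>2" using w by (auto simp: moderate_weights_def)
  note pos = weight_pos[OF ww(1)] weight_pos[OF ww(2)]
  obtain Ct where Ct: "\<And>x f. f \<in> B \<Longrightarrow> (\<lambda>y. f (y - x)) \<in> B \<and> N (\<lambda>y. f (y - x)) \<le> Ct * N f"
    using trans by blast
  obtain C1 q1 where C1: "0 < C1" "0 \<le> q1" "\<And>x y. \<omega>\<^sub>1 (x + y) \<le> C1 * exp (q1 * norm y) * \<omega>\<^sub>1 x"
    using moderate_weight_growth[OF w(1)] by blast
  obtain C2 q2 where C2: "0 < C2" "0 \<le> q2" "\<And>x y. \<omega>\<^sub>2 (x + y) \<le> C2 * exp (q2 * norm y) * \<omega>\<^sub>2 x"
    using moderate_weight_growth[OF w(2)] by blast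
  define k where "k = (2 * pi) powr (- real CARD('d) / 2)"
  have k: "k > 0" by (simp add: k_def)
  (* The exponential growth of the weight is absorbed by half of the Gaussian decay. *)
  have lin_quad: "exp (q1 * t) * exp (- t\<^sup>2 / 4) \<le> exp (2 * q1\<^sup>2) * exp (- t\<^sup>2 / 8)" for t
  proof -
    have "0 \<le> (t - 4 * q1)\<^sup>2" by simp
    then have "q1 * t + - t\<^sup>2 / 4 \<le> 2 * q1\<^sup>2 + - t\<^sup>2 / 8"
      by (simp add: power2_eq_square algebra_simps)
    then show ?thesis by (simp flip: exp_add)
  qed
  have small: "\<exists>R. \<forall>X. R \<le> norm X \<longrightarrow> \<omega>\<^sub>2 X / \<omega>\<^sub>1 X \<le> e" if e: "0 < e" for e
  proof (rule ccontr)
    assume "\<not> ?thesis"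
    then have "\<forall>j::nat. \<exists>X. real j \<le> norm X \<and> e < \<omega>\<^sub>2 X / \<omega>\<^sub>1 X"
      by (meson not_le)
    then obtain Y where Y: "\<And>j. real j \<le> norm (Y j)" "\<And>j. e < \<omega>\<^sub>2 (Y j) / \<omega>\<^sub>1 (Y j)"
      by metis
    define c where "c j \<alpha> = of_real (1 / \<omega>\<^sub>1 (Y j)) * coherent_state (Y j) \<alpha>" for j \<alpha>
    have cH: "c j \<in> H_flat'" for j
      unfolding c_def by (intro H_flat'_scale coherent_state_H_flat')
    have nc: "norm (STFT (c j) X) = k * exp (- (norm (X - Y j))\<^sup>2 / 4) / \<omega>\<^sub>1 (Y j)" for j X
      using pos(1)[of "Y j"] unfolding c_def STFT_scale
      by (simp add: norm_mult norm_divide norm_STFT_coherent_state k_def)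
    define \<gamma> where "\<gamma> X = complex_of_real (exp (- (1/8) * (norm X)\<^sup>2))" for X :: "(real ^ 'd) \<times> (real ^ 'd)"
    have \<gamma>B: "\<gamma> \<in> B" unfolding \<gamma>_def by (rule gaussian) simp
    define A where "A = k * C1 * exp (2 * q1\<^sup>2)"
    have A: "A > 0" using k C1 by (simp add: A_def)
    have G: "(\<lambda>X. STFT (c j) X * of_real (\<omega>\<^sub>1 X)) \<in> B \<and>
        N (\<lambda>X. STFT (c j) X * of_real (\<omega>\<^sub>1 X)) \<le> K * (A * (Ct * N \<gamma>))" for j
    proof -
      note t = Ct[OF \<gamma>B, of "Y j"]
      have t1: "(\<lambda>X. \<gamma> (X - Y j)) \<in> B" using t by blast
      note sc = scale[OF t1, of "of_real A"]
      have "(\<lambda>X. STFT (c j) X * of_real (\<omega>\<^sub>1 X)) \<in> B \<and>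
          N (\<lambda>X. STFT (c j) X * of_real (\<omega>\<^sub>1 X)) \<le> K * N (\<lambda>X. of_real A * \<gamma> (X - Y j))"
      proof (intro solid AE_I2 modulation_space_measurable cH ww)
        fix X
        have "norm (STFT (c j) X * of_real (\<omega>\<^sub>1 X)) = k * exp (- (norm (X - Y j))\<^sup>2 / 4) * (\<omega>\<^sub>1 X / \<omega>\<^sub>1 (Y j))"
          using pos(1)[of X] by (simp add: norm_mult nc)
        also have "\<dots> \<le> k * exp (- (norm (X - Y j))\<^sup>2 / 4) * (C1 * exp (q1 * norm (X - Y j)))"
          using C1(3)[of "Y j" "X - Y j"] pos(1)[of "Y j"] k
          by (intro mult_left_mono) (auto simp: pos_divide_le_eq)
        also have "\<dots> = k * C1 * (exp (q1 * norm (X - Y j)) * exp (- (norm (X - Y j))\<^sup>2 / 4))"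
          by simp
        also have "\<dots> \<le> k * C1 * (exp (2 * q1\<^sup>2) * exp (- (norm (X - Y j))\<^sup>2 / 8))"
          using k C1 lin_quad by (intro mult_left_mono) auto
        also have "\<dots> = norm (of_real A * \<gamma> (X - Y j))"
          using k C1 by (simp add: norm_mult \<gamma>_def A_def abs_mult)
        finally show "norm (STFT (c j) X * of_real (\<omega>\<^sub>1 X)) \<le> norm (of_real A * \<gamma> (X - Y j))" .
      qed (use sc in auto)
      moreover have "N (\<lambda>X. of_real A * \<gamma> (X - Y j)) \<le> A * (Ct * N \<gamma>)"
        using sc t A by (auto intro: order_trans mult_left_mono)
      ultimately show ?thesis
        using K by (auto intro: order_trans mult_left_mono)
    qed
    have c1: "c n \<in> modulation_space \<omega>\<^sub>1 B" for n
      using G cH by (simp add: modulation_space_def)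
    have "range c \<subseteq> modulation_space \<omega>\<^sub>1 B \<and> (\<exists>C. \<forall>n. modulation_norm \<omega>\<^sub>1 N (c n) \<le> C)"
      using G cH by (auto simp: modulation_space_def modulation_norm_def)
    then obtain g s where g: "g \<in> modulation_space \<omega>\<^sub>2 B" and s: "strict_mono (s :: nat \<Rightarrow> nat)"
      and conv: "(\<lambda>n. modulation_norm \<omega>\<^sub>2 N (c (s n) - g)) \<longlonglongrightarrow> 0"
      using comp unfolding compact_map_def by blast
    have cM: "c n \<in> modulation_space \<omega>\<^sub>2 B" for n
      using comp c1 unfolding compact_map_def by (simp add: image_subset_iff subset_iff)
    have gH: "g \<in> H_flat'" and gB: "(\<lambda>X. STFT g X * of_real (\<omega>\<^sub>2 X)) \<in> B"
      using g by (auto simp: modulation_space_def)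
    define F where "F n X = STFT (c (s n)) X * of_real (\<omega>\<^sub>2 X)" for n X
    (* The sequence h tends to zero in quasi-norm and, pointwise, to minus the transform of g;
       identifying the two limits shows that F tends to zero in quasi-norm. *)
    define h where "h n X = F n X - STFT g X * of_real (\<omega>\<^sub>2 X)" for n X
    have FB: "F n \<in> B" for n
      using cM[of "s n"] by (simp add: modulation_space_def F_def[abs_def])
    have hB: "h n \<in> B" for n
      using diff[OF FB gB] by (simp add: h_def[abs_def])
    have "modulation_norm \<omega>\<^sub>2 N (c (s n) - g) = N (h n)" for n
      by (simp add: modulation_norm_def h_def[abs_def] F_def STFT_diff cH gH left_diff_distrib)
    then have h0: "(\<lambda>n. N (h n)) \<longlonglongrightarrow> 0" using conv by simp
    have hlim: "(\<lambda>n. h n X) \<longlonglongrightarrow> - (STFT g X * of_real (\<omega>\<^sub>2 X))" for X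
    proof -
      have "(\<lambda>j. STFT (c j) X) \<longlonglongrightarrow> 0"
      proof (rule Lim_null_comparison)
        define b where "b = k * C1 * exp (q1 * norm X) / \<omega>\<^sub>1 0 * exp (2 * q1\<^sup>2)"
        have b: "b \<ge> 0" using k C1 pos(1)[of 0] by (simp add: b_def)
        show "\<forall>\<^sub>F j in sequentially. norm (STFT (c j) X) \<le> b * exp (- (real j - norm X)\<^sup>2 / 8)"
          using eventually_ge_at_top[of "nat \<lceil>norm X\<rceil>"]
        proof eventually_elim
          case (elim j)
          define t where "t = norm (X - Y j)"
          have j: "real j \<ge> norm X" using elim by linarith
          have t: "t \<ge> real j - norm X" "norm (Y j) \<le> norm X + t"
            using Y(1)[of j] norm_triangle_ineq2[of "Y j" X] by (auto simp: t_def norm_minus_commute)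
          have "\<omega>\<^sub>1 0 \<le> C1 * exp (q1 * norm (Y j)) * \<omega>\<^sub>1 (Y j)"
            using C1(3)[of "Y j" "- Y j"] by simp
          then have "1 / \<omega>\<^sub>1 (Y j) \<le> C1 * exp (q1 * norm (Y j)) / \<omega>\<^sub>1 0"
            using pos(1)[of 0] pos(1)[of "Y j"] by (simp add: field_simps)
          also have "\<dots> \<le> C1 * (exp (q1 * norm X) * exp (q1 * t)) / \<omega>\<^sub>1 0"
            using C1 t(2) pos(1)[of 0] mult_left_mono[OF t(2) C1(2)]
            by (intro divide_right_mono mult_left_mono) (auto simp: distrib_left simp flip: exp_add)
          finally have 1: "1 / \<omega>\<^sub>1 (Y j) \<le> C1 * (exp (q1 * norm X) * exp (q1 * t)) / \<omega>\<^sub>1 0" .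
          have "norm (STFT (c j) X) = k * exp (- t\<^sup>2 / 4) * (1 / \<omega>\<^sub>1 (Y j))"
            by (simp add: nc t_def)
          also have "\<dots> \<le> k * exp (- t\<^sup>2 / 4) * (C1 * (exp (q1 * norm X) * exp (q1 * t)) / \<omega>\<^sub>1 0)"
            using 1 k by (intro mult_left_mono) auto
          also have "\<dots> = k * C1 * exp (q1 * norm X) / \<omega>\<^sub>1 0 * (exp (q1 * t) * exp (- t\<^sup>2 / 4))"
            by simp
          also have "\<dots> \<le> k * C1 * exp (q1 * norm X) / \<omega>\<^sub>1 0 * (exp (2 * q1\<^sup>2) * exp (- t\<^sup>2 / 8))"
            using k C1 pos(1)[of 0] lin_quad by (intro mult_left_mono) auto
          also have "\<dots> = b * exp (- t\<^sup>2 / 8)"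
            by (simp add: b_def)
          also have "\<dots> \<le> b * exp (- (real j - norm X)\<^sup>2 / 8)"
            using b t(1) j by (intro mult_left_mono) (auto intro: power_mono)
          finally show ?case .
        qed
        show "(\<lambda>j. b * exp (- (real j - norm X)\<^sup>2 / 8)) \<longlonglongrightarrow> 0"
          by real_asymp
      qed
      from LIMSEQ_subseq_LIMSEQ[OF this s] have "(\<lambda>n. STFT (c (s n)) X) \<longlonglongrightarrow> 0"
        by (simp add: comp_def)
      then have "(\<lambda>n. h n X) \<longlonglongrightarrow> 0 * of_real (\<omega>\<^sub>2 X) - STFT g X * of_real (\<omega>\<^sub>2 X)"
        unfolding h_def F_def by (intro tendsto_intros)
      then show ?thesis by simp
    qed
    have "\<exists>M. \<forall>m\<ge>M. \<forall>n\<ge>M. N (\<lambda>x. h m x - h n x) < e'" if "0 < e'" for e'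
    proof -
      have "e' / (2 * K) > 0" using that K by simp
      then obtain M where M: "\<And>n. n \<ge> M \<Longrightarrow> N (h n) < e' / (2 * K)"
        using order_tendstoD(2)[OF h0] unfolding eventually_sequentially by meson
      have "N (\<lambda>x. h m x - h n x) < e'" if "m \<ge> M" "n \<ge> M" for m n
      proof -
        have "N (\<lambda>x. h m x - h n x) \<le> K * (N (h m) + N (h n))"
          using diff[OF hB hB] by blast
        also have "\<dots> < K * (e' / (2 * K) + e' / (2 * K))"
          using M[OF that(1)] M[OF that(2)] K by (intro mult_strict_left_mono) auto
        finally show ?thesis using K by simp
      qed
      then show ?thesis by blast
    qed
    then have "(\<lambda>n. N (\<lambda>X. h n X - (- (STFT g X * of_real (\<omega>\<^sub>2 X))))) \<longlonglongrightarrow> 0"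
      using modulation_space_measurable[OF gH ww(2)] hlim
      by (intro limit[OF hB, THEN conjunct2]) auto
    then have F0: "(\<lambda>n. N (F n)) \<longlonglongrightarrow> 0"
      by (simp add: h_def)
    define \<eta> where "\<eta> = k * exp (- 1 / 4) * e / (C2 * exp q2)"
    have \<eta>: "\<eta> > 0" using k e C2 by (simp add: \<eta>_def)
    define \<psi> where "\<psi> X = complex_of_real (\<eta> * indicator (cball 0 1) X)" for X :: "(real ^ 'd) \<times> (real ^ 'd)"
    (* Translated back to the origin, every F n dominates a fixed multiple of the indicator
       function of the unit ball. *)
    have \<psi>: "\<psi> \<in> B \<and> N \<psi> \<le> K * (Ct * N (F n))" for n
    proof -
      note t = Ct[OF FB[of n], of "- Y (s n)"]
      have "\<psi> \<in> B \<and> N \<psi> \<le> K * N (\<lambda>X. F n (X - (- Y (s n))))"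
      proof (intro solid AE_I2)
        show "(\<lambda>X. F n (X - (- Y (s n)))) \<in> B" using t by blast
        show "\<psi> \<in> borel_measurable lebesgue"
        proof -
          have [measurable]: "cball (0 :: (real ^ 'd) \<times> (real ^ 'd)) 1 \<in> sets lebesgue"
            by (simp add: lmeasurable_cball fmeasurableD)
          show ?thesis unfolding \<psi>_def by measurable
        qed
        fix X :: "(real ^ 'd) \<times> (real ^ 'd)"
        show "norm (\<psi> X) \<le> norm (F n (X - (- Y (s n))))"
        proof (cases "norm X \<le> 1")
          case True
          define Z where "Z = Y (s n)"
          have "\<omega>\<^sub>2 Z \<le> C2 * exp (q2 * norm X) * \<omega>\<^sub>2 (X + Z)"
            using C2(3)[of "X + Z" "- X"] by simp
          also have "\<dots> \<le> C2 * exp q2 * \<omega>\<^sub>2 (X + Z)"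
            using True C2 pos(2)[of "X + Z"] mult_left_mono[OF True C2(2)]
            by (intro mult_right_mono mult_left_mono) auto
          finally have 1: "\<omega>\<^sub>2 Z / (C2 * exp q2) \<le> \<omega>\<^sub>2 (X + Z)"
            using C2 by (simp add: pos_divide_le_eq mult_ac)
          have "e \<le> \<omega>\<^sub>2 Z / \<omega>\<^sub>1 Z"
            using Y(2)[of "s n"] by (simp add: Z_def)
          then have "\<eta> \<le> k * exp (- 1 / 4) * (\<omega>\<^sub>2 Z / \<omega>\<^sub>1 Z) / (C2 * exp q2)"
            unfolding \<eta>_def using k C2 by (intro divide_right_mono mult_left_mono) auto
          also have "\<dots> = k * exp (- 1 / 4) / \<omega>\<^sub>1 Z * (\<omega>\<^sub>2 Z / (C2 * exp q2))"
            by simp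
          also have "\<dots> \<le> k * exp (- (norm X)\<^sup>2 / 4) / \<omega>\<^sub>1 Z * \<omega>\<^sub>2 (X + Z)"
          proof (intro mult_mono divide_right_mono mult_left_mono 1)
            show "exp (- 1 / 4) \<le> exp (- (norm X)\<^sup>2 / 4)"
              using True power_mono[of "norm X" 1 2] by simp
          qed (use k C2 pos[of Z] in \<open>auto simp: less_imp_le\<close>)
          also have "\<dots> = norm (F n (X + Z))"
            using pos(2)[of "X + Z"] by (simp add: F_def norm_mult nc Z_def)
          finally show ?thesis
            using True \<eta> by (simp add: \<psi>_def Z_def)
        qed (simp add: \<psi>_def)
      qed
      moreover have "K * N (\<lambda>X. F n (X - (- Y (s n)))) \<le> K * (Ct * N (F n))"
        using t K by (intro mult_left_mono) auto
      ultimately show ?thesis by linarith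
    qed
    have \<psi>B: "\<psi> \<in> B" using \<psi> by blast
    have "(\<lambda>n. K * (Ct * N (F n))) \<longlonglongrightarrow> K * (Ct * 0)"
      by (intro tendsto_intros F0)
    then have "N \<psi> \<le> K * (Ct * 0)"
      using \<psi> by (intro LIMSEQ_le_const) auto
    then have "N \<psi> = 0" using nonneg[OF \<psi>B] by simp
    moreover obtain L where "\<forall>f\<in>B. (\<integral>\<^sup>+x\<in>cball 0 1. ennreal (norm (f x) powr r) \<partial>lborel) \<le> ennreal (L * N f powr r)"
      using local by blast
    ultimately have "(\<integral>\<^sup>+x\<in>cball 0 1. ennreal (norm (\<psi> x) powr r) \<partial>lborel) \<le> 0"
      using \<psi>B by force
    moreover have "(\<integral>\<^sup>+x\<in>cball 0 1. ennreal (norm (\<psi> x) powr r) \<partial>lborel) =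
        (\<integral>\<^sup>+x. ennreal (\<eta> powr r) * indicator (cball (0 :: (real ^ 'd) \<times> (real ^ 'd)) 1) x \<partial>lborel)"
      using \<eta> by (intro nn_integral_cong) (auto simp: \<psi>_def indicator_def)
    ultimately have "ennreal (\<eta> powr r) * emeasure lborel (cball (0 :: (real ^ 'd) \<times> (real ^ 'd)) 1) = 0"
      by (simp add: nn_integral_cmult_indicator)
    then have "emeasure lborel (cball (0 :: (real ^ 'd) \<times> (real ^ 'd)) 1) = 0"
      using \<eta> by simp
    then show False
      using content_cball_pos[of 1 "0 :: (real ^ 'd) \<times> (real ^ 'd)"] by (simp add: measure_def)
  qed
  obtain R where R: "\<And>X. R \<le> norm X \<Longrightarrow> \<omega>\<^sub>2 X / \<omega>\<^sub>1 X \<le> 1"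
    using small[of 1] by auto
  define M where "M = C2 * exp (q2 * \<bar>R\<bar>) * \<omega>\<^sub>2 0 * (C1 * exp (q1 * \<bar>R\<bar>) / \<omega>\<^sub>1 0)"
  have "\<omega>\<^sub>2 X / \<omega>\<^sub>1 X \<le> max 1 M" for X
  proof (cases "R \<le> norm X")
    case False
    then have n: "norm X \<le> \<bar>R\<bar>" by simp
    have "\<omega>\<^sub>2 X \<le> C2 * exp (q2 * norm X) * \<omega>\<^sub>2 0"
      using C2(3)[of 0 X] by simp
    also have "\<dots> \<le> C2 * exp (q2 * \<bar>R\<bar>) * \<omega>\<^sub>2 0"
      using C2 pos(2)[of 0] mult_left_mono[OF n C2(2)] by (intro mult_right_mono mult_left_mono) auto
    finally have 2: "\<omega>\<^sub>2 X \<le> C2 * exp (q2 * \<bar>R\<bar>) * \<omega>\<^sub>2 0" .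
    have "\<omega>\<^sub>1 0 \<le> C1 * exp (q1 * norm X) * \<omega>\<^sub>1 X"
      using C1(3)[of X "- X"] by simp
    also have "\<dots> \<le> C1 * exp (q1 * \<bar>R\<bar>) * \<omega>\<^sub>1 X"
      using C1 pos(1)[of X] mult_left_mono[OF n C1(2)] by (intro mult_right_mono mult_left_mono) auto
    finally have "1 / \<omega>\<^sub>1 X \<le> C1 * exp (q1 * \<bar>R\<bar>) / \<omega>\<^sub>1 0"
      using pos(1)[of 0] pos(1)[of X] by (simp add: field_simps)
    then have "\<omega>\<^sub>2 X * (1 / \<omega>\<^sub>1 X) \<le> M"
      unfolding M_def using 2 C2 pos(2)[of 0] pos(1)[of X] by (intro mult_mono) (auto simp: less_imp_le)
    then show ?thesis by simp
  qed (use R in \<open>auto simp: le_max_iff_disj\<close>)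
  then show ?thesis
    using small by (intro Linfty0_I ww)
qed

section \<open>Gaussians in the Gelfand--Shilov space\<close>

definition gauss_deriv :: "real \<Rightarrow> nat \<Rightarrow> real \<Rightarrow> complex" where
  "gauss_deriv a m x = (deriv ^^ m) (\<lambda>w. exp (- of_real a * w\<^sup>2)) (of_real x)"

lemma gauss_holomorphic: "(\<lambda>w. exp (- of_real a * w\<^sup>2)) holomorphic_on S"
  by (intro holomorphic_intros)

lemma gauss_deriv_has_derivative:
  "((\<lambda>t. gauss_deriv a m (x + t)) has_vector_derivative gauss_deriv a (Suc m) (x + s)) (at s)"
proof -
  let ?G = "(deriv ^^ m) (\<lambda>w. exp (- complex_of_real a * w\<^sup>2))"
  have "?G holomorphic_on UNIV"
    by (intro holomorphic_higher_deriv gauss_holomorphic) auto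
  then have "(?G has_field_derivative deriv ?G (of_real (x + s))) (at (of_real (x + s)))"
    by (intro holomorphic_derivI[of _ UNIV]) auto
  then have "((\<lambda>w. ?G (w + of_real x)) has_field_derivative deriv ?G (of_real (x + s))) (at (of_real s))"
    by (subst DERIV_shift[symmetric]) (simp add: add.commute)
  from has_vector_derivative_real_field[OF this]
  show ?thesis
    by (simp add: gauss_deriv_def add.commute)
qed

lemma gauss_deriv_continuous: "continuous_on S (gauss_deriv a m)"
proof -
  have "isCont (gauss_deriv a m) x" for x
    using has_vector_derivative_continuous[OF gauss_deriv_has_derivative[of a m 0 x]] by simp
  then show ?thesis by (simp add: continuous_at_imp_continuous_on)
qed

text \<open>Cauchy's estimate on the circle of radius \<open>1/h\<close> around \<open>x\<close>. There \<open>|exp (- a w\<^sup>2)|\<close> is at most a constant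
times \<open>exp (- |x| / h)\<close>, since a quadratic exceeds any linear function up to a constant, and
\<open>(|x| / h)\<^sup>k / k!\<close> is at most \<open>exp (|x| / h)\<close>.\<close>

lemma gauss_deriv_bound:
  assumes a: "0 < a" and h: "0 < h"
  obtains C where "0 \<le> C"
    "\<And>m k x. \<bar>x\<bar> ^ k * norm (gauss_deriv a m x) \<le> C * (h ^ (m + k) * fact m * fact k)"
proof
  define C where "C = exp (a / h\<^sup>2) * exp (1 / (4 * a * h\<^sup>2)) * exp (1 / h\<^sup>2)"
  show "0 \<le> C" by (simp add: C_def)
  fix m k :: nat and x :: real
  have "norm (gauss_deriv a m x) \<le> fact m * (C * exp (- \<bar>x\<bar> / h)) / (1 / h) ^ m"
    unfolding gauss_deriv_def
  proof (rule Cauchy_inequality)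
    fix w :: complex assume w: "norm (of_real x - w) = 1 / h"
    define u v where "u = Re w" and "v = Im w"
    have "\<bar>v\<bar> \<le> 1 / h" "\<bar>x - u\<bar> \<le> 1 / h"
      using abs_Im_le_cmod[of "of_real x - w"] abs_Re_le_cmod[of "of_real x - w"] w
      by (auto simp: u_def v_def)
    then have v2: "v\<^sup>2 \<le> 1 / h\<^sup>2" and u: "\<bar>u\<bar> \<ge> \<bar>x\<bar> - 1 / h"
      using power_mono[of "\<bar>v\<bar>" "1 / h" 2] by (auto simp: power_divide)
    (* Completing the square. *)
    have "0 \<le> a * (\<bar>u\<bar> - 1 / (2 * a * h))\<^sup>2" using a by simp
    also have "\<dots> = a * u\<^sup>2 - \<bar>u\<bar> / h + 1 / (4 * a * h\<^sup>2)"
      using a h by (simp add: power2_diff power_divide power_mult_distrib algebra_simps)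
        (simp add: power2_eq_square field_simps)
    finally have "- a * u\<^sup>2 \<le> 1 / (4 * a * h\<^sup>2) - \<bar>u\<bar> / h" by simp
    also have "\<dots> \<le> 1 / (4 * a * h\<^sup>2) - (\<bar>x\<bar> - 1 / h) / h"
      using u h by (intro diff_left_mono divide_right_mono) auto
    finally have "- a * u\<^sup>2 \<le> 1 / (4 * a * h\<^sup>2) - \<bar>x\<bar> / h + 1 / h\<^sup>2"
      by (simp add: diff_divide_distrib power2_eq_square)
    moreover have "a * v\<^sup>2 \<le> a / h\<^sup>2"
      using v2 a mult_left_mono[OF v2, of a] by simp
    ultimately have "a * v\<^sup>2 - a * u\<^sup>2 \<le> a / h\<^sup>2 + 1 / (4 * a * h\<^sup>2) + 1 / h\<^sup>2 + (- \<bar>x\<bar> / h)"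
      by simp
    then have "exp (a * v\<^sup>2 - a * u\<^sup>2) \<le> C * exp (- \<bar>x\<bar> / h)"
      by (simp add: C_def flip: exp_add)
    moreover have "Re (- of_real a * w\<^sup>2) = a * v\<^sup>2 - a * u\<^sup>2"
      by (simp add: u_def v_def power2_eq_square algebra_simps)
    ultimately show "norm (exp (- of_real a * w\<^sup>2)) \<le> C * exp (- \<bar>x\<bar> / h)"
      by (simp only: norm_exp_eq_Re)
  qed (use h in \<open>auto intro!: holomorphic_on_imp_continuous_on holomorphic_intros\<close>)
  also have "\<dots> = C * (h ^ m * fact m) * exp (- \<bar>x\<bar> / h)"
    using h by (simp add: field_simps)
  finally have 1: "norm (gauss_deriv a m x) \<le> C * (h ^ m * fact m) * exp (- \<bar>x\<bar> / h)" .
  have "(\<bar>x\<bar> / h) ^ k / fact k \<le> exp (\<bar>x\<bar> / h)"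
    using h by (intro power_div_fact_le_exp) auto
  then have "\<bar>x\<bar> ^ k \<le> h ^ k * fact k * exp (\<bar>x\<bar> / h)"
    using h by (simp add: field_simps)
  with 1 have "\<bar>x\<bar> ^ k * norm (gauss_deriv a m x) \<le>
      (h ^ k * fact k * exp (\<bar>x\<bar> / h)) * (C * (h ^ m * fact m) * exp (- \<bar>x\<bar> / h))"
    using h by (intro mult_mono) auto
  also have "\<dots> = C * (h ^ (m + k) * fact m * fact k) * (exp (\<bar>x\<bar> / h) * exp (- \<bar>x\<bar> / h))"
    by (simp only: power_add mult_ac)
  also have "exp (\<bar>x\<bar> / h) * exp (- \<bar>x\<bar> / h) = 1"
    by (simp flip: exp_add)
  finally show "\<bar>x\<bar> ^ k * norm (gauss_deriv a m x) \<le> C * (h ^ (m + k) * fact m * fact k)"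
    by simp
qed

text \<open>The partial derivatives of \<open>exp (- a |x|\<^sup>2)\<close>: differentiating in the direction \<open>b\<close> raises \<open>\<alpha> b\<close> by one.\<close>

definition gauss_multi :: "real \<Rightarrow> ('a::euclidean_space \<Rightarrow> nat) \<Rightarrow> 'a \<Rightarrow> complex" where
  "gauss_multi a \<alpha> x = (\<Prod>b\<in>Basis. gauss_deriv a (\<alpha> b) (x \<bullet> b))"

lemma gauss_multi_has_derivative:
  assumes b: "b \<in> Basis"
  shows "((\<lambda>t. gauss_multi a \<alpha> (x + t *\<^sub>R b)) has_vector_derivative
    gauss_multi a (\<alpha>(b := Suc (\<alpha> b))) x) (at 0)"
proof -
  define c where "c = (\<Prod>b'\<in>Basis - {b}. gauss_deriv a (\<alpha> b') (x \<bullet> b'))"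
  have eq: "gauss_multi a \<beta> (x + t *\<^sub>R b) = c * gauss_deriv a (\<beta> b) (x \<bullet> b + t)"
    if "\<forall>b'\<in>Basis - {b}. \<beta> b' = \<alpha> b'" for t \<beta>
  proof -
    have "gauss_multi a \<beta> (x + t *\<^sub>R b) =
        gauss_deriv a (\<beta> b) ((x + t *\<^sub>R b) \<bullet> b) * (\<Prod>b'\<in>Basis - {b}. gauss_deriv a (\<beta> b') ((x + t *\<^sub>R b) \<bullet> b'))"
      unfolding gauss_multi_def by (rule prod.remove) (use b in auto)
    also have "(\<Prod>b'\<in>Basis - {b}. gauss_deriv a (\<beta> b') ((x + t *\<^sub>R b) \<bullet> b')) = c"
      unfolding c_def using that b
      by (intro prod.cong) (auto simp: inner_add_left inner_Basis)
    finally show ?thesis using b by (simp add: inner_add_left inner_Basis)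
  qed
  have "((\<lambda>t. c * gauss_deriv a (\<alpha> b) (x \<bullet> b + t)) has_vector_derivative c * gauss_deriv a (Suc (\<alpha> b)) (x \<bullet> b + 0)) (at 0)"
    by (intro has_vector_derivative_mult_right gauss_deriv_has_derivative)
  moreover have "gauss_multi a (\<alpha>(b := Suc (\<alpha> b))) x = c * gauss_deriv a (Suc (\<alpha> b)) (x \<bullet> b + 0)"
    using eq[of "\<alpha>(b := Suc (\<alpha> b))" 0] by simp
  ultimately show ?thesis
    using eq[of \<alpha>] by simp
qed

lemma foldr_partial_deriv_gauss:
  assumes "bs \<in> lists Basis"
  shows "foldr partial_deriv bs (gauss_multi a (\<lambda>_. 0)) = gauss_multi a (count_list bs)"
  using assms
proof (induction bs)
  case (Cons b bs)
  have "partial_deriv b (gauss_multi a (count_list bs)) x = gauss_multi a (count_list (b # bs)) x" for x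
  proof -
    have "gauss_multi a ((count_list bs)(b := Suc (count_list bs b))) = gauss_multi a (count_list (b # bs))"
      by (intro arg_cong[of _ _ "gauss_multi a"]) auto
    then show ?thesis
      unfolding partial_deriv_def
      using vector_derivative_at[OF gauss_multi_has_derivative[of b a "count_list bs" x]] Cons by auto
  qed
  then have "partial_deriv b (gauss_multi a (count_list bs)) = gauss_multi a (count_list (b # bs))"
    by (rule ext)
  with Cons show ?case by (simp del: count_list.simps)
qed (simp add: fun_eq_iff gauss_multi_def)

lemma gauss_multi_0: "gauss_multi a (\<lambda>_. 0) x = of_real (exp (- a * (norm x)\<^sup>2))"
proof -
  have "gauss_multi a (\<lambda>_. 0) x = of_real (exp (\<Sum>b\<in>Basis. - a * (x \<bullet> b)\<^sup>2))"
    unfolding gauss_multi_def gauss_deriv_def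
    by (simp add: exp_sum exp_of_real[symmetric] flip: of_real_mult of_real_power of_real_minus)
  also have "(\<Sum>b\<in>Basis. - a * (x \<bullet> b)\<^sup>2) = - a * (norm x)\<^sup>2"
    by (simp add: norm_eq_sqrt_inner euclidean_inner[of x x] power2_eq_square sum_distrib_left sum_nonneg flip: sum_negf)
  finally show ?thesis .
qed

lemma exists_list_with_counts:
  assumes "finite A"
  shows "\<exists>bs. set bs \<subseteq> A \<and> (\<forall>b\<in>A. count_list bs b = \<alpha> b)"
  using assms
proof induction
  case (insert x A)
  then obtain bs where bs: "set bs \<subseteq> A" "\<forall>b\<in>A. count_list bs b = \<alpha> b" by blast
  have "count_list bs x = 0"
    using bs insert by (auto simp: count_list_0_iff)
  moreover have "count_list (replicate n x) b = (if b = x then n else 0)" for n b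
    by (induction n) auto
  ultimately show ?case
    using bs insert.hyps by (intro exI[of _ "replicate (\<alpha> x) x @ bs"]) (auto simp: count_list_append)
qed auto

lemma gaussian_Sigma1:
  assumes a: "0 < a"
  shows "(\<lambda>x::'a::euclidean_space. complex_of_real (exp (- a * (norm x)\<^sup>2))) \<in> Sigma1"
proof -
  have eq: "(\<lambda>x::'a. complex_of_real (exp (- a * (norm x)\<^sup>2))) = gauss_multi a (\<lambda>_. 0)"
    by (simp add: fun_eq_iff gauss_multi_0)
  have "smooth (gauss_multi a (\<lambda>_::'a. 0))"
    unfolding smooth_def
  proof (intro ballI conjI allI)
    fix bs :: "'a list" and b x :: 'a assume bs: "bs \<in> lists Basis"
    show "continuous_on UNIV (foldr partial_deriv bs (gauss_multi a (\<lambda>_. 0)))"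
      unfolding foldr_partial_deriv_gauss[OF bs] gauss_multi_def
      by (intro continuous_on_prod continuous_on_compose2[OF gauss_deriv_continuous[of UNIV]] continuous_intros) auto
    assume "b \<in> Basis"
    then show "(\<lambda>t. foldr partial_deriv bs (gauss_multi a (\<lambda>_. 0)) (x + t *\<^sub>R b)) differentiable at 0"
      unfolding foldr_partial_deriv_gauss[OF bs]
      using gauss_multi_has_derivative differentiableI_vector by blast
  qed
  moreover have "Sigma1_seminorm h (gauss_multi a (\<lambda>_::'a. 0)) < \<infinity>" if h: "h > 0" for h
  proof -
    obtain C where C: "0 \<le> C"
      "\<And>m k x. \<bar>x\<bar> ^ k * norm (gauss_deriv a m x) \<le> C * (h ^ (m + k) * fact m * fact k)"
      using gauss_deriv_bound[OF a h] by blast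
    have "Sigma1_seminorm h (gauss_multi a (\<lambda>_::'a. 0)) \<le> ennreal (C ^ DIM('a))"
      unfolding Sigma1_seminorm_def
    proof (intro SUP_least, clarify)
      fix \<alpha> \<beta> :: "'a \<Rightarrow> nat" and x :: 'a
      define bs where "bs = (SOME bs. set bs \<subseteq> (Basis :: 'a set) \<and> (\<forall>b\<in>Basis. count_list bs b = \<alpha> b))"
      have bs: "set bs \<subseteq> Basis" "\<forall>b\<in>Basis. count_list bs b = \<alpha> b"
        using someI_ex[OF exists_list_with_counts[OF finite_Basis, of \<alpha>]] unfolding bs_def by blast+
      have "multi_deriv \<alpha> (gauss_multi a (\<lambda>_. 0)) = gauss_multi a (count_list bs)"
        unfolding multi_deriv_def bs_def[symmetric] using bs by (intro foldr_partial_deriv_gauss) auto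
      also have "\<dots> = gauss_multi a \<alpha>"
        using bs by (simp add: fun_eq_iff gauss_multi_def)
      finally have md: "multi_deriv \<alpha> (gauss_multi a (\<lambda>_. 0)) = gauss_multi a \<alpha>" .
      define Q where "Q b = h ^ (\<alpha> b + \<beta> b) * fact (\<alpha> b) * fact (\<beta> b)" for b :: 'a
      have Q: "Q b > 0" for b using h by (simp add: Q_def)
      have den: "h ^ (\<Sum>b\<in>Basis. \<alpha> b + \<beta> b) * (\<Prod>b\<in>Basis. fact (\<alpha> b)) * (\<Prod>b\<in>Basis. fact (\<beta> b)) = (\<Prod>b\<in>Basis. Q b)"
        by (simp add: Q_def power_sum prod.distrib)
      have "norm (of_real (\<Prod>b\<in>Basis. (x \<bullet> b) ^ \<beta> b) * gauss_multi a \<alpha> x) =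
          (\<Prod>b\<in>Basis. \<bar>x \<bullet> b\<bar> ^ \<beta> b * norm (gauss_deriv a (\<alpha> b) (x \<bullet> b)))"
        by (simp add: norm_mult gauss_multi_def prod.distrib power_abs norm_power flip: prod_norm abs_prod)
      also have "\<dots> \<le> (\<Prod>b\<in>Basis. C * Q b)"
        unfolding Q_def using C(2) by (intro prod_mono) auto
      also have "\<dots> = C ^ DIM('a) * (\<Prod>b\<in>Basis. Q b)"
        by (simp add: prod.distrib)
      finally have "norm (of_real (\<Prod>b\<in>Basis. (x \<bullet> b) ^ \<beta> b) * gauss_multi a \<alpha> x) / (\<Prod>b\<in>Basis. Q b) \<le> C ^ DIM('a)"
        using Q by (simp add: pos_divide_le_eq prod_pos)
      then show "ennreal (norm (of_real (\<Prod>b\<in>Basis. (x \<bullet> b) ^ \<beta> b) * multi_deriv \<alpha> (gauss_multi a (\<lambda>_. 0)) x) /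
          (h ^ (\<Sum>b\<in>Basis. \<alpha> b + \<beta> b) * (\<Prod>b\<in>Basis. fact (\<alpha> b)) * (\<Prod>b\<in>Basis. fact (\<beta> b)))) \<le> ennreal (C ^ DIM('a))"
        unfolding md den by (rule ennreal_leI)
    qed
    then show ?thesis by (simp add: le_less_trans)
  qed
  ultimately show ?thesis
    unfolding eq Sigma1_def by blast
qed

section \<open>Invariant BF-spaces\<close>

context invariant_BF_space
begin

lemma borel: "f \<in> B \<Longrightarrow> f \<in> borel_measurable lebesgue"
  using subset_L1loc by (auto simp: Lloc_def)

lemma solid_constant:
  obtains K where "1 \<le> K"
    "\<And>f g. g \<in> B \<Longrightarrow> f \<in> borel_measurable lebesgue \<Longrightarrow>
      (AE x in lebesgue. norm (f x) \<le> norm (g x)) \<Longrightarrow> f \<in> B \<and> N f \<le> K * N g"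
proof -
  obtain C where C: "\<And>f g. f \<in> Lloc 1 \<Longrightarrow> g \<in> Lloc 1 \<Longrightarrow> g \<in> B \<Longrightarrow> (AE x in lebesgue. norm (f x) \<le> norm (g x)) \<Longrightarrow>
         f \<in> B \<and> N f \<le> C * N g"
    using invariance by blast
  have "f \<in> B \<and> N f \<le> max 1 C * N g"
    if g: "g \<in> B" and f: "f \<in> borel_measurable lebesgue" and le: "AE x in lebesgue. norm (f x) \<le> norm (g x)" for f g
  proof -
    have gL: "g \<in> Lloc 1" using g subset_L1loc by blast
    have "(\<integral>\<^sup>+x\<in>A. ennreal (norm (f x) powr 1) \<partial>lebesgue) < \<infinity>" if "compact A" for A
    proof -
      have "(\<integral>\<^sup>+x\<in>A. ennreal (norm (f x) powr 1) \<partial>lebesgue) \<le> (\<integral>\<^sup>+x\<in>A. ennreal (norm (g x) powr 1) \<partial>lebesgue)"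
        using le by (intro nn_integral_mono_AE) (auto elim!: eventually_mono intro!: mult_right_mono ennreal_leI)
      also have "\<dots> < \<infinity>" using gL that by (simp add: Lloc_def)
      finally show ?thesis .
    qed
    then have fL: "f \<in> Lloc 1" using f by (simp add: Lloc_def)
    have "f \<in> B \<and> N f \<le> C * N g" using C[OF fL gL g le] .
    moreover have "C * N g \<le> max 1 C * N g"
      using norm_nonneg[OF g] by (intro mult_right_mono) auto
    ultimately show ?thesis by linarith
  qed
  then show ?thesis using that[of "max 1 C"] by simp
qed

text \<open>Gliding hump. If no constant works, there are \<open>f\<^sub>n\<close> whose integrals over the ball exceed \<open>4\<^sup>n\<close> times
their norms. Rescaled to \<open>h\<^sub>n\<close> with norms of order \<open>2\<^sup>-\<^sup>n\<close>, their moduli have a sum \<open>g\<close> in the space, by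
completeness. By solidity \<open>g\<close> dominates every partial sum almost everywhere, hence every \<open>h\<^sub>n\<close>,
whose integral is at least \<open>2\<^sup>n\<close>; so \<open>g\<close> is not locally integrable.\<close>

lemma L1_local_embedding:
  "\<exists>C\<ge>0. \<forall>f\<in>B. (\<integral>\<^sup>+x\<in>cball 0 R. ennreal (norm (f x)) \<partial>lebesgue) \<le> ennreal (C * N f)"
proof (rule ccontr)
  let ?I = "\<lambda>f. \<integral>\<^sup>+x\<in>cball 0 R. ennreal (norm (f x)) \<partial>lebesgue"
  assume "\<not> ?thesis"
  then have "\<exists>f\<in>B. ennreal (4 ^ n * N f) < ?I f" for n :: nat
    by (metis not_le zero_le_numeral zero_le_power)
  then obtain f where f: "\<And>n. f n \<in> B" and big: "\<And>n. ennreal (4 ^ n * N (f n)) < ?I (f n)"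
    by metis
  obtain K where K: "1 \<le> K"
    and solid: "\<And>f g. g \<in> B \<Longrightarrow> f \<in> borel_measurable lebesgue \<Longrightarrow>
      (AE x in lebesgue. norm (f x) \<le> norm (g x)) \<Longrightarrow> f \<in> B \<and> N f \<le> K * N g"
    using solid_constant by blast
  have [measurable]: "cball (0::'a) R \<in> sets lebesgue"
    by (simp add: lmeasurable_cball fmeasurableD)
  have Npos: "N (f n) > 0" for n
  proof (rule ccontr)
    assume "\<not> N (f n) > 0"
    then have "N (f n) = 0" using norm_nonneg[OF f, of n] by simp
    then have "AE x in lebesgue. f n x = 0" using norm_eq_0_iff[OF f] by blast
    then have "?I (f n) = (\<integral>\<^sup>+x. 0 \<partial>(lebesgue :: 'a measure))"
      by (intro nn_integral_cong_AE) (auto elim!: eventually_mono)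
    then show False using big[of n] by simp
  qed
  define t where "t n = 1 / (2 ^ n * N (f n))" for n
  have t: "t n > 0" for n using Npos[of n] by (simp add: t_def)
  define h where "h n x = t n * norm (f n x)" for n x
  have h0: "h n x \<ge> 0" for n x using t[of n] by (simp add: h_def)
  have hB: "(\<lambda>x. of_real (h n x)) \<in> B" and hN: "N (\<lambda>x. of_real (h n x)) \<le> K / 2 ^ n" for n
  proof -
    have [measurable]: "f n \<in> borel_measurable lebesgue" using borel f by blast
    have sc: "(\<lambda>x. of_real (t n) * f n x) \<in> B" "N (\<lambda>x. of_real (t n) * f n x) = t n * N (f n)"
      using scale_mem[OF f] norm_scale[OF f, of "of_real (t n)"] t[of n] by auto
    have "(\<lambda>x. of_real (h n x)) \<in> B \<and> N (\<lambda>x. of_real (h n x)) \<le> K * N (\<lambda>x. of_real (t n) * f n x)"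
      using t[of n] by (intro solid[OF sc(1)]) (auto simp: h_def norm_mult)
    moreover have "t n * N (f n) = 1 / 2 ^ n"
      using Npos[of n] by (simp add: t_def)
    ultimately show "(\<lambda>x. of_real (h n x)) \<in> B" "N (\<lambda>x. of_real (h n x)) \<le> K / 2 ^ n"
      using sc by auto
  qed
  define S where "S n x = complex_of_real (\<Sum>i<n. h i x)" for n x
  have SB: "S n \<in> B" for n
  proof (induction n)
    case (Suc n)
    have "S (Suc n) = (\<lambda>x. S n x + of_real (h n x))" by (simp add: S_def fun_eq_iff)
    then show ?case using add_mem[OF Suc hB] by simp
  qed (simp add: S_def zero_mem)
  have N0: "N (\<lambda>_. 0) = 0" using norm_eq_0_iff[OF zero_mem] by simp
  have tail: "(\<lambda>x. S (n + j) x - S n x) \<in> B \<and> N (\<lambda>x. S (n + j) x - S n x) \<le> 2 * K / 2 ^ n - 2 * K / 2 ^ (n + j)" for n j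
  proof (induction j)
    case (Suc j)
    have "(\<lambda>x. S (n + Suc j) x - S n x) = (\<lambda>x. (S (n + j) x - S n x) + of_real (h (n + j) x))"
      by (simp add: S_def fun_eq_iff)
    moreover have "2 * K / 2 ^ n - 2 * K / 2 ^ (n + j) + K / 2 ^ (n + j) = 2 * K / 2 ^ n - 2 * K / 2 ^ (n + Suc j)"
      by simp
    ultimately show ?case
      using add_mem[of "\<lambda>x. S (n + j) x - S n x", OF _ hB] norm_triangle[of "\<lambda>x. S (n + j) x - S n x", OF _ hB, of "n + j"] Suc hN[of "n + j"]
      by (auto intro: order_trans)
  qed (simp add: N0 zero_mem)
  have "\<exists>M. \<forall>m\<ge>M. \<forall>n\<ge>M. N (\<lambda>x. S m x - S n x) < e" if e: "0 < e" for e
  proof -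
    have "(\<lambda>n. 2 * K * (1 / 2) ^ n) \<longlonglongrightarrow> 2 * K * 0"
      by (intro tendsto_intros LIMSEQ_realpow_zero) auto
    then have "\<forall>\<^sub>F n in sequentially. 2 * K * (1 / 2) ^ n < e"
      using e by (intro order_tendstoD) auto
    then obtain M where M: "\<And>n. n \<ge> M \<Longrightarrow> 2 * K / 2 ^ n < e"
      unfolding eventually_sequentially by (auto simp: power_divide)
    have le: "N (\<lambda>x. S m x - S n x) < e" if "n \<ge> M" "m \<ge> n" for m n
    proof -
      have "N (\<lambda>x. S m x - S n x) \<le> 2 * K / 2 ^ n - 2 * K / 2 ^ m"
        using tail[of n "m - n"] that by simp
      moreover have "2 * K / 2 ^ m \<ge> 0" using K by simp
      ultimately show ?thesis using M[OF that(1)] by linarith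
    qed
    have sym: "N (\<lambda>x. S m x - S n x) = N (\<lambda>x. S n x - S m x)" if "m \<ge> n" for m n
    proof -
      have "(\<lambda>x. S m x - S n x) \<in> B" using tail[of n "m - n"] that by simp
      from norm_scale[OF this, of "- 1"] show ?thesis by simp
    qed
    show ?thesis
    proof (intro exI allI impI)
      fix m n assume "M \<le> m" "M \<le> n"
      then show "N (\<lambda>x. S m x - S n x) < e"
        using le[of n m] le[of m n] sym[of m n] by (cases "m \<ge> n") auto
    qed
  qed
  from complete[OF SB this] obtain g where g: "g \<in> B" and Sg: "(\<lambda>n. N (\<lambda>x. S n x - g x)) \<longlonglongrightarrow> 0"
    by blast
  have [measurable]: "g \<in> borel_measurable lebesgue" using borel g by blast
  have dom: "AE x in lebesgue. h n x \<le> norm (g x)" for n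
  proof -
    (* The part of h n above |g| is dominated by |S m - g| for all m > n, so its norm vanishes. *)
    define p where "p x = complex_of_real (max 0 (h n x - norm (g x)))" for x
    have [measurable]: "f n \<in> borel_measurable lebesgue" using borel f by blast
    have [measurable]: "p \<in> borel_measurable lebesgue" unfolding p_def h_def by measurable
    have p: "p \<in> B \<and> N p \<le> K * N (\<lambda>x. S m x - g x)" if "m > n" for m
    proof (intro solid AE_I2)
      have "(\<lambda>x. S m x + (- 1) * g x) \<in> B" by (intro add_mem scale_mem SB g)
      then show "(\<lambda>x. S m x - g x) \<in> B" by simp
      fix x
      have "h n x \<le> (\<Sum>i<m. h i x)"
        using that h0 by (intro member_le_sum) auto
      also have "\<dots> = norm (S m x)"
        unfolding S_def norm_of_real using h0 by (simp add: sum_nonneg)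
      also have "\<dots> \<le> norm (g x) + norm (S m x - g x)"
        by (metis add.commute norm_triangle_sub)
      finally show "norm (p x) \<le> norm (S m x - g x)"
        by (simp add: p_def)
    qed simp
    have "(\<lambda>m. K * N (\<lambda>x. S m x - g x)) \<longlonglongrightarrow> K * 0"
      by (intro tendsto_intros Sg)
    then have "N p \<le> K * 0"
      by (rule LIMSEQ_le_const) (use p in \<open>auto intro: exI[of _ "Suc n"]\<close>)
    then have "N p = 0"
      using norm_nonneg[of p] p[of "Suc n"] by simp
    then have "AE x in lebesgue. p x = 0"
      using norm_eq_0_iff[of p] p[of "Suc n"] by simp
    then show ?thesis
      by (rule eventually_mono) (simp add: p_def max_def split: if_splits)
  qed
  have "g \<in> Lloc 1" using g subset_L1loc by blast
  then have fin: "?I g < \<infinity>"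
    by (simp add: Lloc_def)
  have "ennreal (2 ^ n) \<le> ?I g" for n
  proof -
    have [measurable]: "f n \<in> borel_measurable lebesgue" using borel f by blast
    have "ennreal (2 ^ n) = ennreal (t n) * ennreal (4 ^ n * N (f n))"
    proof -
      have "t n * (4 ^ n * N (f n)) = 4 ^ n / 2 ^ n"
        using Npos[of n] by (simp add: t_def)
      also have "\<dots> = 2 ^ n"
        by (simp flip: power_divide)
      finally show ?thesis
        using t[of n] Npos[of n] by (simp flip: ennreal_mult)
    qed
    also have "\<dots> \<le> ennreal (t n) * ?I (f n)"
      using big[of n] by (intro mult_left_mono) auto
    also have "\<dots> = (\<integral>\<^sup>+x\<in>cball 0 R. ennreal (h n x) \<partial>lebesgue)"
      using t[of n] by (subst nn_integral_cmult[symmetric]) (auto simp: h_def ennreal_mult mult.assoc)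
    also have "\<dots> \<le> ?I g"
      using dom[of n] by (intro nn_integral_mono_AE) (auto elim!: eventually_mono intro!: mult_right_mono ennreal_leI)
    finally show ?thesis .
  qed
  moreover obtain q where q: "?I g = ennreal q" "q \<ge> 0"
    using fin by (cases "?I g") auto
  ultimately have "2 ^ n \<le> q" for n :: nat
    using q by simp
  moreover obtain n :: nat where "q < 2 ^ n"
    using real_arch_pow[of 2 q] by auto
  ultimately show False
    using not_le by blast
qed

text \<open>The norm limit given by completeness is also a limit in the mean on every ball, so by Fatou's lemma it
agrees with the pointwise limit.\<close>

lemma pointwise_limit:
  assumes F: "\<And>n::nat. F n \<in> B"
    and cauchy: "\<And>e. 0 < e \<Longrightarrow> \<exists>M. \<forall>m\<ge>M. \<forall>n\<ge>M. N (\<lambda>x. F m x - F n x) < e"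
    and g [measurable]: "g \<in> borel_measurable lebesgue" and lim: "AE x in lebesgue. (\<lambda>n. F n x) \<longlonglongrightarrow> g x"
  shows "g \<in> B \<and> (\<lambda>n. N (\<lambda>x. F n x - g x)) \<longlonglongrightarrow> 0"
proof -
  obtain g0 where g0: "g0 \<in> B" and conv: "(\<lambda>n. N (\<lambda>x. F n x - g0 x)) \<longlonglongrightarrow> 0"
    using complete[OF F cauchy] by blast
  have [measurable]: "g0 \<in> borel_measurable lebesgue" "F n \<in> borel_measurable lebesgue" for n
    using borel g0 F by blast+
  have dB: "(\<lambda>x. F n x - g0 x) \<in> B" for n
  proof -
    have "(\<lambda>x. F n x + (- 1) * g0 x) \<in> B" by (intro add_mem scale_mem F g0)
    then show ?thesis by simp
  qed
  have "AE x in lebesgue. x \<in> cball 0 R \<longrightarrow> g x = g0 x" for R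
  proof -
    have [measurable]: "cball (0::'a) R \<in> sets lebesgue"
      by (simp add: lmeasurable_cball fmeasurableD)
    obtain C where C: "C \<ge> 0" "\<And>f. f \<in> B \<Longrightarrow> (\<integral>\<^sup>+x\<in>cball 0 R. ennreal (norm (f x)) \<partial>lebesgue) \<le> ennreal (C * N f)"
      using L1_local_embedding by blast
    have "(\<integral>\<^sup>+x\<in>cball 0 R. ennreal (norm (g x - g0 x)) \<partial>lebesgue) =
        (\<integral>\<^sup>+x. liminf (\<lambda>n. ennreal (norm (F n x - g0 x)) * indicator (cball 0 R) x) \<partial>lebesgue)"
      using lim
    proof (intro nn_integral_cong_AE, eventually_elim)
      case (elim x)
      have "(\<lambda>n. ennreal (norm (F n x - g0 x)) * indicator (cball 0 R) x) \<longlonglongrightarrow>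
          ennreal (norm (g x - g0 x)) * indicator (cball 0 R) x"
        using elim by (intro tendsto_mult_ennreal tendsto_ennrealI tendsto_intros) (auto simp: indicator_def)
      then show ?case
        by (simp add: lim_imp_Liminf)
    qed
    also have "\<dots> \<le> liminf (\<lambda>n. \<integral>\<^sup>+x\<in>cball 0 R. ennreal (norm (F n x - g0 x)) \<partial>lebesgue)"
      by (rule nn_integral_liminf) measurable
    also have "\<dots> \<le> liminf (\<lambda>n. ennreal (C * N (\<lambda>x. F n x - g0 x)))"
      using C(2)[OF dB] by (intro Liminf_mono always_eventually) auto
    also have "\<dots> = ennreal (C * 0)"
      by (intro lim_imp_Liminf tendsto_ennrealI tendsto_intros conv) auto
    finally have "(\<integral>\<^sup>+x\<in>cball 0 R. ennreal (norm (g x - g0 x)) \<partial>lebesgue) = 0"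
      by simp
    then have "AE x in lebesgue. ennreal (norm (g x - g0 x)) * indicator (cball 0 R) x = 0"
      by (subst (asm) nn_integral_0_iff_AE) measurable
    then show ?thesis
      by (rule eventually_mono) (auto simp: indicator_def split: if_splits)
  qed
  then have "AE x in lebesgue. \<forall>n::nat. x \<in> cball 0 (real n) \<longrightarrow> g x = g0 x"
    by (subst AE_all_countable) blast
  then have eq: "AE x in lebesgue. g0 x = g x"
  proof (rule eventually_mono)
    fix x assume "\<forall>n::nat. x \<in> cball 0 (real n) \<longrightarrow> g x = g0 x"
    moreover obtain n :: nat where "norm x \<le> real n" using real_arch_simple by blast
    ultimately show "g0 x = g x" by (metis mem_cball_0)
  qed
  have "g \<in> B" using AE_closed[OF g0 g eq] by blast
  moreover have "N (\<lambda>x. F n x - g x) = N (\<lambda>x. F n x - g0 x)" for n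
    using AE_closed[OF dB, of "\<lambda>x. F n x - g x" n] eq by (auto elim: eventually_mono)
  ultimately show ?thesis using conv by simp
qed

lemma quasi_Banach: "\<exists>K. quasi_Banach_function_space B N 1 K"
proof -
  obtain K where K: "1 \<le> K"
    and solid: "\<And>f g. g \<in> B \<Longrightarrow> f \<in> borel_measurable lebesgue \<Longrightarrow>
      (AE x in lebesgue. norm (f x) \<le> norm (g x)) \<Longrightarrow> f \<in> B \<and> N f \<le> K * N g"
    using solid_constant by blast
  have local': "\<exists>C\<ge>0. \<forall>f\<in>B. (\<integral>\<^sup>+x\<in>cball 0 R. ennreal (norm (f x) powr 1) \<partial>lborel) \<le> ennreal (C * N f powr 1)" for R
    using L1_local_embedding[of R] norm_nonneg by (simp add: nn_integral_completion)
  have gaussian': "(\<lambda>x. of_real (exp (- a * (norm x)\<^sup>2))) \<in> B" if "0 < a" for a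
    using gaussian_Sigma1[OF that] Sigma1_subset by blast
  have add': "(\<lambda>x. f x + g x) \<in> B \<and> N (\<lambda>x. f x + g x) \<le> K * (N f + N g)" if "f \<in> B" "g \<in> B" for f g
  proof -
    have "N f + N g \<le> K * (N f + N g)"
      using K norm_nonneg that mult_right_mono[of 1 K "N f + N g"] by simp
    then show ?thesis using add_mem norm_triangle that by (meson order_trans)
  qed
  have scale': "(\<lambda>x. a * f x) \<in> B \<and> N (\<lambda>x. a * f x) \<le> norm a * N f" if "f \<in> B" for f a
    using that scale_mem norm_scale by simp
  have "quasi_Banach_function_space B N 1 K"
    by (rule quasi_Banach_function_space.intro)
      (simp, simp, fact K, fact borel, fact norm_nonneg, fact solid, fact add', fact scale',
       fact local', fact gaussian', fact pointwise_limit)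
  then show ?thesis by blast
qed

lemma translation_bounded:
  assumes "bounded (range v)"
  shows "\<exists>C. \<forall>x. \<forall>f\<in>B. (\<lambda>y. f (y - x)) \<in> B \<and> N (\<lambda>y. f (y - x)) \<le> C * N f"
proof -
  obtain C where C: "\<And>x f. f \<in> B \<Longrightarrow> (\<lambda>y. f (y - x)) \<in> B \<and> N (\<lambda>y. f (y - x)) \<le> C * v x * N f"
    using invariance by blast
  obtain M where M: "\<And>x. \<bar>v x\<bar> \<le> M"
    using assms by (auto simp: bounded_iff)
  have "C * v x * N f \<le> \<bar>C\<bar> * M * N f" if "f \<in> B" for x f
  proof (rule mult_right_mono)
    have "C * v x \<le> \<bar>C * v x\<bar>" by simp
    also have "\<dots> \<le> \<bar>C\<bar> * M" unfolding abs_mult using M by (intro mult_left_mono) auto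
    finally show "C * v x \<le> \<bar>C\<bar> * M" .
  qed (use norm_nonneg that in auto)
  then show ?thesis
    using C by (meson order_trans)
qed

end

section \<open>Quasi-norms of Lebesgue type in one variable\<close>

lemma ennreal_powr_ennreal: "0 \<le> x \<Longrightarrow> ennreal_powr (ennreal x) p = ennreal (x powr p)"
  by (simp add: ennreal_powr_def)

lemma ennreal_powr_top: "ennreal_powr top p = top"
  by (simp add: ennreal_powr_def)

lemma ennreal_powr_0: "0 < p \<Longrightarrow> ennreal_powr 0 p = 0"
  by (simp add: ennreal_powr_def)

lemma ennreal_powr_mono:
  assumes "x \<le> y" "0 < p"
  shows "ennreal_powr x p \<le> ennreal_powr y p"
  using assms
  by (cases x; cases y) (auto simp: ennreal_powr_ennreal ennreal_powr_top top_unique intro!: ennreal_leI powr_mono2)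

lemma ennreal_powr_strict_mono:
  assumes "x < y" "0 < p"
  shows "ennreal_powr x p < ennreal_powr y p"
  using assms
  by (cases x; cases y) (auto simp: ennreal_powr_ennreal ennreal_powr_top ennreal_less_iff powr_less_mono2)

lemma ennreal_powr_inverse:
  assumes "0 < p"
  shows "ennreal_powr (ennreal_powr x p) (1 / p) = x" "ennreal_powr (ennreal_powr x (1 / p)) p = x"
  using assms by (cases x; simp add: ennreal_powr_ennreal ennreal_powr_top powr_powr)+

lemma ennreal_powr_mult:
  assumes "0 \<le> c" "0 < p"
  shows "ennreal_powr (ennreal c * x) p = ennreal (c powr p) * ennreal_powr x p"
proof (cases x)
  case (real y)
  then show ?thesis
    using assms by (simp add: ennreal_powr_ennreal powr_mult flip: ennreal_mult)
next
  case top
  then show ?thesis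
    using assms by (cases "c = 0") (simp_all add: ennreal_powr_top ennreal_powr_0 ennreal_mult_top)
qed

lemma ennreal_powr_measurable [measurable]: "(\<lambda>x. ennreal_powr x p) \<in> borel_measurable borel"
  unfolding ennreal_powr_def by measurable

text \<open>The power functions are order isomorphisms of \<open>[0, \<infinity>]\<close>: \<open>y < x\<^sup>p\<close> means that the root of \<open>y\<close> is below \<open>x\<close>.\<close>

lemma ennreal_powr_liminf:
  assumes "0 < p"
  shows "ennreal_powr (liminf x) p \<le> liminf (\<lambda>n. ennreal_powr (x n) p)"
  unfolding le_Liminf_iff
proof (intro allI impI)
  fix y assume "y < ennreal_powr (liminf x) p"
  then have "ennreal_powr y (1 / p) < liminf x"
    using ennreal_powr_strict_mono[of y "ennreal_powr (liminf x) p" "1 / p"] assms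
    by (simp add: ennreal_powr_inverse)
  then have "\<forall>\<^sub>F n in sequentially. ennreal_powr y (1 / p) < x n"
    using le_Liminf_iff[of "liminf x" sequentially x] by blast
  then show "\<forall>\<^sub>F n in sequentially. y < ennreal_powr (x n) p"
    by (rule eventually_mono)
      (use ennreal_powr_strict_mono[of "ennreal_powr y (1 / p)" _ p] assms in \<open>simp add: ennreal_powr_inverse\<close>)
qed

lemma lebesgue_measurable_AE_cong:
  fixes f g :: "'a::euclidean_space \<Rightarrow> 'b::topological_space"
  assumes f: "f \<in> borel_measurable lebesgue" and eq: "AE x in lebesgue. f x = g x"
  shows "g \<in> borel_measurable lebesgue"
proof (rule measurableI)
  fix A :: "'b set" assume A: "A \<in> sets borel"
  have "f -` A \<inter> space lebesgue \<in> sets lebesgue"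
    using f A by (rule measurable_sets)
  moreover have "AE x in lebesgue. x \<in> f -` A \<inter> space lebesgue \<longleftrightarrow> x \<in> g -` A \<inter> space lebesgue"
    using eq by eventually_elim simp
  ultimately show "g -` A \<inter> space lebesgue \<in> sets lebesgue"
    by (intro completion.in_sets_AE[of "f -` A \<inter> space lebesgue" "g -` A \<inter> space lebesgue"]) auto
qed simp

text \<open>The functions are arbitrary here. For \<open>p = \<infinity>\<close> this matters, as the essential supremum of a
non-measurable function is \<open>\<infinity>\<close> by convention; completeness of Lebesgue measure makes
measurability invariant under changes on null sets.\<close>

lemma Lp_norm_AE_cong:
  assumes "AE t in lborel. u t = w t"
  shows "Lp_norm p u = Lp_norm p w"
proof -
  have ae: "AE t in lebesgue. u t = w t"
    using assms by (simp add: AE_completion_iff)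
  have "esssup lebesgue u = esssup lebesgue w"
  proof (cases "u \<in> borel_measurable lebesgue")
    case True
    then show ?thesis
      using lebesgue_measurable_AE_cong[OF True ae] ae by (intro esssup_AE_cong)
  next
    case False
    have "AE t in lebesgue. w t = u t" using ae by eventually_elim simp
    then have "w \<notin> borel_measurable lebesgue"
      using False lebesgue_measurable_AE_cong by blast
    then show ?thesis using False by (simp add: esssup_non_measurable)
  qed
  moreover have "(\<integral>\<^sup>+t. ennreal_powr (u t) q \<partial>lebesgue) = (\<integral>\<^sup>+t. ennreal_powr (w t) q \<partial>lebesgue)" for q
    using ae by (intro nn_integral_cong_AE) (auto elim: eventually_mono)
  ultimately show ?thesis by (simp add: Lp_norm_def)
qed

lemma Lp_norm_mono:
  assumes u: "u \<in> borel_measurable lborel" and le: "AE t in lborel. u t \<le> w t" and p: "0 < p"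
  shows "Lp_norm p u \<le> Lp_norm p w"
proof (cases "p = \<infinity>")
  case True
  then show ?thesis
    using u le by (simp add: Lp_norm_def esssup_AE_mono measurable_completion AE_completion)
next
  case False
  then have pp: "0 < enn2real p"
    using p by (simp add: enn2real_positive_iff less_top)
  have "(\<integral>\<^sup>+t. ennreal_powr (u t) (enn2real p) \<partial>lborel) \<le> (\<integral>\<^sup>+t. ennreal_powr (w t) (enn2real p) \<partial>lborel)"
    using le pp by (intro nn_integral_mono_AE) (auto elim!: eventually_mono intro: ennreal_powr_mono)
  then show ?thesis
    using False pp by (simp add: Lp_norm_def nn_integral_completion ennreal_powr_mono)
qed

lemma Lp_norm_scale:
  assumes u: "u \<in> borel_measurable lborel" and c: "0 \<le> c" and p: "0 < p"
  shows "Lp_norm p (\<lambda>t. ennreal c * u t) = ennreal c * Lp_norm p u"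
proof (cases "p = \<infinity>")
  case True
  show ?thesis
  proof (cases "c = 0")
    case True
    then show ?thesis using \<open>p = \<infinity>\<close> by (simp add: Lp_norm_def esssup_const)
  next
    case False
    then have c: "c > 0" using c by simp
    have ul: "u \<in> borel_measurable lebesgue" using u by (simp add: measurable_completion)
    have "esssup lebesgue (\<lambda>t. ennreal c * u t) \<le> ennreal c * esssup lebesgue u"
      using esssup_AE[of u lebesgue] ul
      by (intro esssup_I) (auto elim!: eventually_mono intro!: mult_left_mono)
    moreover have "esssup lebesgue u \<le> ennreal (1 / c) * esssup lebesgue (\<lambda>t. ennreal c * u t)"
    proof (rule esssup_I[OF ul])
      show "AE t in lebesgue. u t \<le> ennreal (1 / c) * esssup lebesgue (\<lambda>t. ennreal c * u t)"
        using esssup_AE[of "\<lambda>t. ennreal c * u t" lebesgue]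
      proof (rule eventually_mono)
        fix t assume "ennreal c * u t \<le> esssup lebesgue (\<lambda>t. ennreal c * u t)"
        then have "ennreal (1 / c) * (ennreal c * u t) \<le> ennreal (1 / c) * esssup lebesgue (\<lambda>t. ennreal c * u t)"
          by (intro mult_left_mono) auto
        then show "u t \<le> ennreal (1 / c) * esssup lebesgue (\<lambda>t. ennreal c * u t)"
          using c by (simp add: mult.assoc[symmetric] flip: ennreal_mult)
      qed
    qed
    then have "ennreal c * esssup lebesgue u \<le> ennreal c * (ennreal (1 / c) * esssup lebesgue (\<lambda>t. ennreal c * u t))"
      by (intro mult_left_mono) auto
    then have "ennreal c * esssup lebesgue u \<le> esssup lebesgue (\<lambda>t. ennreal c * u t)"
      using c by (simp add: mult.assoc[symmetric] flip: ennreal_mult)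
    ultimately show ?thesis
      using \<open>p = \<infinity>\<close> by (simp add: Lp_norm_def)
  qed
next
  case False
  then have pp: "0 < enn2real p"
    using p by (simp add: enn2real_positive_iff less_top)
  have "(\<integral>\<^sup>+t. ennreal_powr (ennreal c * u t) (enn2real p) \<partial>lborel) =
      ennreal (c powr enn2real p) * (\<integral>\<^sup>+t. ennreal_powr (u t) (enn2real p) \<partial>lborel)"
    using u by (subst nn_integral_cmult[symmetric]) (auto simp: ennreal_powr_mult[OF c pp])
  moreover have "(c powr enn2real p) powr (1 / enn2real p) = c"
    using c pp by (simp add: powr_powr)
  ultimately show ?thesis
    using False pp by (simp add: Lp_norm_def nn_integral_completion ennreal_powr_mult)
qed

lemma ennreal_powr_add_le:
  assumes p: "0 < p"
  shows "ennreal_powr (x + y) p \<le> ennreal (2 powr p) * (ennreal_powr x p + ennreal_powr y p)"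
proof -
  have "ennreal_powr (x + y) p \<le> ennreal_powr (ennreal 2 * max x y) p"
  proof (rule ennreal_powr_mono[OF _ p])
    have "x + y \<le> max x y + max x y" by (intro add_mono) auto
    then show "x + y \<le> ennreal 2 * max x y" by (simp add: mult_2)
  qed
  also have "\<dots> = ennreal (2 powr p) * ennreal_powr (max x y) p"
    using p by (intro ennreal_powr_mult) auto
  also have "\<dots> \<le> ennreal (2 powr p) * (ennreal_powr x p + ennreal_powr y p)"
    by (intro mult_left_mono) (auto simp: max_def add_increasing add_increasing2)
  finally show ?thesis .
qed

text \<open>A crude constant that serves all \<open>p > 0\<close> at once, from \<open>(x + y)\<^sup>p \<le> 2\<^sup>p (x\<^sup>p + y\<^sup>p)\<close> with the exponents
\<open>p\<close> and \<open>1/p\<close>.\<close>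

lemma Lp_norm_add_le:
  assumes p: "0 < p"
  obtains K where "1 \<le> K" "\<And>u w. u \<in> borel_measurable lborel \<Longrightarrow> w \<in> borel_measurable lborel \<Longrightarrow>
    Lp_norm p (\<lambda>t. u t + w t) \<le> ennreal K * (Lp_norm p u + Lp_norm p w)"
proof (cases "p = \<infinity>")
  case True
  have "Lp_norm p (\<lambda>t. u t + w t) \<le> ennreal 1 * (Lp_norm p u + Lp_norm p w)"
    if "u \<in> borel_measurable lborel" "w \<in> borel_measurable lborel" for u w
  proof -
    have ul: "u \<in> borel_measurable lebesgue" "w \<in> borel_measurable lebesgue"
      using that by (simp_all add: measurable_completion)
    have "AE t in lebesgue. u t + w t \<le> esssup lebesgue u + esssup lebesgue w"
      using esssup_AE[of u lebesgue] esssup_AE[of w lebesgue] by eventually_elim (rule add_mono)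
    then have "esssup lebesgue (\<lambda>t. u t + w t) \<le> esssup lebesgue u + esssup lebesgue w"
      using ul by (intro esssup_I) auto
    then show ?thesis using True by (simp add: Lp_norm_def)
  qed
  then show ?thesis using that[of 1] by blast
next
  case False
  define q where "q = enn2real p"
  have q: "0 < q" using p False by (simp add: q_def enn2real_positive_iff less_top)
  have "Lp_norm p (\<lambda>t. u t + w t) \<le> ennreal (2 * 2 * 2 powr (1 / q)) * (Lp_norm p u + Lp_norm p w)"
    if [measurable]: "u \<in> borel_measurable lborel" "w \<in> borel_measurable lborel" for u w
  proof -
    define U W where "U = (\<integral>\<^sup>+t. ennreal_powr (u t) q \<partial>lborel)" and "W = (\<integral>\<^sup>+t. ennreal_powr (w t) q \<partial>lborel)"
    have "(\<integral>\<^sup>+t. ennreal_powr (u t + w t) q \<partial>lborel) \<le>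
        (\<integral>\<^sup>+t. ennreal (2 powr q) * (ennreal_powr (u t) q + ennreal_powr (w t) q) \<partial>lborel)"
      by (intro nn_integral_mono ennreal_powr_add_le q)
    also have "\<dots> = ennreal (2 powr q) * (U + W)"
      by (simp add: nn_integral_cmult nn_integral_add U_def W_def)
    finally have "Lp_norm p (\<lambda>t. u t + w t) \<le> ennreal_powr (ennreal (2 powr q) * (U + W)) (1 / q)"
      using False q by (simp add: Lp_norm_def nn_integral_completion ennreal_powr_mono flip: q_def)
    also have "\<dots> = ennreal 2 * ennreal_powr (U + W) (1 / q)"
      using q by (simp add: ennreal_powr_mult powr_powr)
    also have "\<dots> \<le> ennreal 2 * (ennreal (2 powr (1 / q)) * (ennreal_powr U (1 / q) + ennreal_powr W (1 / q)))"
      using q by (intro mult_left_mono ennreal_powr_add_le) auto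
    also have "\<dots> = ennreal (2 * 2 powr (1 / q)) * (Lp_norm p u + Lp_norm p w)"
      using False by (simp add: Lp_norm_def nn_integral_completion U_def W_def q_def ennreal_mult mult.assoc)
    also have "\<dots> \<le> ennreal (2 * 2 * 2 powr (1 / q)) * (Lp_norm p u + Lp_norm p w)"
      by (intro mult_right_mono ennreal_leI) auto
    finally show ?thesis .
  qed
  moreover have "1 \<le> 2 * 2 * 2 powr (1 / q)"
    using q ge_one_powr_ge_zero[of 2 "1 / q"] by simp
  ultimately show ?thesis using that by blast
qed

lemma Lp_norm_liminf:
  assumes u: "\<And>m. u m \<in> borel_measurable lborel" and p: "0 < p"
  shows "Lp_norm p (\<lambda>t. liminf (\<lambda>m. u m t)) \<le> liminf (\<lambda>m. Lp_norm p (u m))"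
proof (cases "p = \<infinity>")
  case True
  have ul: "u m \<in> borel_measurable lebesgue" for m
    using u by (simp add: measurable_completion)
  have "AE t in lebesgue. \<forall>m. u m t \<le> esssup lebesgue (u m)"
    by (simp add: AE_all_countable esssup_AE)
  then have "AE t in lebesgue. liminf (\<lambda>m. u m t) \<le> liminf (\<lambda>m. esssup lebesgue (u m))"
    by (rule eventually_mono) (auto intro: Liminf_mono)
  then show ?thesis
    using ul True by (auto simp: Lp_norm_def intro!: esssup_I)
next
  case False
  define q where "q = enn2real p"
  have q: "0 < q" using p False by (simp add: q_def enn2real_positive_iff less_top)
  have "(\<integral>\<^sup>+t. ennreal_powr (liminf (\<lambda>m. u m t)) q \<partial>lborel) \<le> (\<integral>\<^sup>+t. liminf (\<lambda>m. ennreal_powr (u m t) q) \<partial>lborel)"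
    by (intro nn_integral_mono ennreal_powr_liminf q)
  also have "\<dots> \<le> liminf (\<lambda>m. \<integral>\<^sup>+t. ennreal_powr (u m t) q \<partial>lborel)"
    using u by (intro nn_integral_liminf) auto
  finally have "ennreal_powr (\<integral>\<^sup>+t. ennreal_powr (liminf (\<lambda>m. u m t)) q \<partial>lborel) (1 / q) \<le>
      ennreal_powr (liminf (\<lambda>m. \<integral>\<^sup>+t. ennreal_powr (u m t) q \<partial>lborel)) (1 / q)"
    using q by (intro ennreal_powr_mono) auto
  also have "\<dots> \<le> liminf (\<lambda>m. ennreal_powr (\<integral>\<^sup>+t. ennreal_powr (u m t) q \<partial>lborel) (1 / q))"
    using q by (intro ennreal_powr_liminf) auto
  finally show ?thesis
    using False by (simp add: Lp_norm_def nn_integral_completion flip: q_def)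
qed

lemma Lp_norm_shift:
  assumes u: "u \<in> borel_measurable lborel"
  shows "Lp_norm p (\<lambda>t. u (t + a)) = Lp_norm p u"
proof -
  have [measurable]: "u \<in> borel_measurable borel" using u by simp
  have shift: "(\<integral>\<^sup>+t. f (t + a) \<partial>lborel) = (\<integral>\<^sup>+t. f t \<partial>lborel)"
    if "f \<in> borel_measurable lborel" for f :: "real \<Rightarrow> ennreal" and a
  proof -
    have "(\<integral>\<^sup>+t. f t \<partial>lborel) = (\<integral>\<^sup>+t. f t \<partial>distr lborel borel ((+) a))"
      by (simp add: lborel_distr_plus)
    then show ?thesis
      using that by (subst (asm) nn_integral_distr) (auto simp: add.commute)
  qed
  have ess: "esssup lebesgue (\<lambda>t. f (t + a)) \<le> esssup lebesgue f"
    if f: "f \<in> borel_measurable lborel" for f :: "real \<Rightarrow> ennreal" and a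
  proof (rule esssup_I)
    show "(\<lambda>t. f (t + a)) \<in> borel_measurable lebesgue"
    proof -
      have [measurable]: "f \<in> borel_measurable borel" using f by simp
      have "(\<lambda>t. f (t + a)) \<in> borel_measurable borel" by measurable
      then show ?thesis by (simp add: measurable_completion)
    qed
    have "AE t in lborel. f t \<le> esssup lebesgue f"
      using esssup_AE[of f lebesgue] by (simp add: AE_completion_iff)
    from subst[where P = "\<lambda>M. AE t in M. f t \<le> esssup lebesgue f", OF lborel_distr_plus[symmetric, of a] this]
    have "AE t in distr lborel borel ((+) a). f t \<le> esssup lebesgue f" .
    then have "AE t in lborel. f (a + t) \<le> esssup lebesgue f"
      by (rule AE_distrD[rotated]) simp
    then show "AE t in lebesgue. f (t + a) \<le> esssup lebesgue f"
      by (simp add: AE_completion_iff add.commute)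
  qed
  have "esssup lebesgue (\<lambda>t. u (t + a)) = esssup lebesgue u"
  proof (rule antisym[OF ess[OF u]])
    have "(\<lambda>t. u (t + a)) \<in> borel_measurable lborel" by measurable
    from ess[OF this, of "- a"] show "esssup lebesgue u \<le> esssup lebesgue (\<lambda>t. u (t + a))" by simp
  qed
  moreover have "(\<integral>\<^sup>+t. ennreal_powr (u (t + a)) q \<partial>lborel) = (\<integral>\<^sup>+t. ennreal_powr (u t) q \<partial>lborel)" for q
    by (intro shift) measurable
  ultimately show ?thesis by (simp add: Lp_norm_def nn_integral_completion)
qed

text \<open>For \<open>L = \<parallel>u\<parallel>\<^sub>p\<close> strictly between \<open>0\<close> and \<open>\<infinity>\<close>, distinguishing \<open>u \<le> L\<close> and \<open>u > L\<close> gives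
\<open>u\<^sup>r \<le> L\<^sup>r (1 + (u / L)\<^sup>p)\<close>, and \<open>(u / L)\<^sup>p\<close> has integral \<open>1\<close>.\<close>

lemma Lp_norm_local:
  assumes p: "0 < p" and r: "0 < r" "ennreal r \<le> p" and R: "0 \<le> R"
    and u: "u \<in> borel_measurable lborel"
  shows "(\<integral>\<^sup>+t\<in>{-R..R}. ennreal_powr (u t) r \<partial>lborel) \<le> ennreal (2 * R + 1) * ennreal_powr (Lp_norm p u) r"
proof (cases "p = \<infinity>")
  case True
  define L where "L = Lp_norm p u"
  have "AE t in lborel. u t \<le> L"
    using esssup_AE[of u lebesgue] True by (simp add: L_def Lp_norm_def AE_completion_iff)
  then have "(\<integral>\<^sup>+t\<in>{-R..R}. ennreal_powr (u t) r \<partial>lborel) \<le> (\<integral>\<^sup>+t\<in>{-R..R}. ennreal_powr L r \<partial>lborel)"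
    using r by (intro nn_integral_mono_AE) (auto elim!: eventually_mono intro!: mult_right_mono ennreal_powr_mono)
  also have "\<dots> = ennreal_powr L r * ennreal (2 * R)"
    using R by (simp add: nn_integral_cmult_indicator)
  also have "\<dots> \<le> ennreal_powr L r * ennreal (2 * R + 1)"
    by (intro mult_left_mono ennreal_leI) auto
  finally show ?thesis by (simp add: L_def mult.commute)
next
  case False
  define q where "q = enn2real p"
  have q: "0 < q" using p False by (simp add: q_def enn2real_positive_iff less_top)
  have "p = ennreal q" using False by (simp add: q_def less_top)
  then have rq: "r \<le> q" using r q by (simp add: ennreal_le_iff)
  define J where "J = (\<integral>\<^sup>+t. ennreal_powr (u t) q \<partial>lborel)"
  define L where "L = Lp_norm p u"
  have L: "L = ennreal_powr J (1 / q)"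
    using False by (simp add: L_def Lp_norm_def J_def q_def nn_integral_completion)
  have JL: "J = ennreal_powr L q"
    using q by (simp add: L ennreal_powr_inverse)
  have um: "(\<lambda>t. ennreal_powr (u t) q) \<in> borel_measurable lborel" using u by measurable
  consider "L = 0" | "L = top" | l where "L = ennreal l" "0 < l"
    by (cases L) (auto simp: less_le)
  then show ?thesis
  proof cases
    case 1
    then have "J = 0" using JL q by (simp add: ennreal_powr_0)
    then have "AE t in lborel. ennreal_powr (u t) q = 0"
      using um by (simp add: J_def nn_integral_0_iff_AE)
    then have "AE t in lborel. ennreal_powr (u t) r * indicator {-R..R} t = 0"
    proof (rule eventually_mono)
      fix t assume "ennreal_powr (u t) q = 0"
      then have "u t = 0" using q by (metis ennreal_powr_inverse(1) ennreal_powr_0 divide_pos_pos zero_less_one)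
      then show "ennreal_powr (u t) r * indicator {-R..R} t = 0" using r by (simp add: ennreal_powr_0)
    qed
    then have "(\<integral>\<^sup>+t\<in>{-R..R}. ennreal_powr (u t) r \<partial>lborel) = (\<integral>\<^sup>+t. 0 \<partial>(lborel :: real measure))"
      by (intro nn_integral_cong_AE) auto
    then show ?thesis by simp
  next
    case 2
    then show ?thesis
      using R by (simp add: L_def[symmetric] ennreal_powr_top ennreal_mult_top)
  next
    case 3
    have pt: "ennreal_powr x r \<le> ennreal (l powr r) * (1 + ennreal (l powr (- q)) * ennreal_powr x q)" for x
    proof (cases x)
      case (real y)
      have "y powr r \<le> l powr r * (1 + l powr (- q) * y powr q)"
      proof (cases "y \<le> l")
        case True
        then have "y powr r \<le> l powr r * 1"
          using real r by (simp add: powr_mono2)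
        also have "\<dots> \<le> l powr r * (1 + l powr (- q) * y powr q)"
          by (intro mult_left_mono) auto
        finally show ?thesis .
      next
        case False
        have "y powr r = l powr r * (y / l) powr r"
          using 3 real by (simp add: powr_divide)
        also have "\<dots> \<le> l powr r * (y / l) powr q"
          using False 3 rq by (intro mult_left_mono powr_mono) auto
        also have "(y / l) powr q = l powr (- q) * y powr q"
          using 3 real by (simp add: powr_divide powr_minus field_simps)
        also have "l powr r * (l powr (- q) * y powr q) \<le> l powr r * (1 + l powr (- q) * y powr q)"
          by (intro mult_left_mono) auto
        finally show ?thesis .
      qed
      then have "ennreal (y powr r) \<le> ennreal (l powr r * (1 + l powr (- q) * y powr q))"
        by (rule ennreal_leI)
      then show ?thesis
        using real by (simp add: ennreal_powr_ennreal ennreal_mult ennreal_plus)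
    next
      case top
      then show ?thesis using 3 by (simp add: ennreal_powr_top ennreal_mult_top)
    qed
    have "(\<integral>\<^sup>+t\<in>{-R..R}. ennreal_powr (u t) r \<partial>lborel) \<le>
        (\<integral>\<^sup>+t. ennreal (l powr r) * (indicator {-R..R} t + ennreal (l powr (- q)) * ennreal_powr (u t) q) \<partial>lborel)"
    proof (intro nn_integral_mono)
      fix t
      show "ennreal_powr (u t) r * indicator {-R..R} t \<le>
          ennreal (l powr r) * (indicator {-R..R} t + ennreal (l powr (- q)) * ennreal_powr (u t) q)"
        using pt[of "u t"] by (simp add: indicator_def)
    qed
    also have "\<dots> = ennreal (l powr r) * (ennreal (2 * R) + ennreal (l powr (- q)) * J)"
      using um R by (simp add: nn_integral_cmult nn_integral_add J_def)
    also have "ennreal (l powr (- q)) * J = 1"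
      using 3 by (simp add: JL ennreal_powr_ennreal flip: ennreal_mult powr_add)
    also have "ennreal (l powr r) * (ennreal (2 * R) + 1) = ennreal (2 * R + 1) * ennreal_powr L r"
      using 3 R by (simp add: ennreal_powr_ennreal ennreal_plus mult.commute)
    finally show ?thesis by (simp add: L_def)
  qed
qed

section \<open>Iterated quasi-norms\<close>

abbreviation coord_measure :: "nat \<Rightarrow> nat \<Rightarrow> (nat \<Rightarrow> real) measure" where
  "coord_measure k n \<equiv> PiM {k..<n} (\<lambda>_. lborel)"

interpretation coord: product_sigma_finite "\<lambda>_::nat. lborel :: real measure"
  by standard

text \<open>A function of the variables with numbers \<open>k, \<dots>, n - 1\<close> takes the list of their values. Numbering the
variables from \<open>k\<close> makes the head of the list the variable \<open>k\<close>, so that integrating it out leads from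
\<open>k\<close> to \<open>Suc k\<close>.\<close>

definition list_measurable :: "nat \<Rightarrow> nat \<Rightarrow> (real list \<Rightarrow> ennreal) \<Rightarrow> bool" where
  "list_measurable k n g \<longleftrightarrow> (\<lambda>\<xi>. g (map \<xi> [k..<n])) \<in> borel_measurable (coord_measure k n)"

definition AE_list :: "nat \<Rightarrow> nat \<Rightarrow> (real list \<Rightarrow> bool) \<Rightarrow> bool" where
  "AE_list k n P \<longleftrightarrow> (AE \<xi> in coord_measure k n. P (map \<xi> [k..<n]))"

lemma insert_interval: "k < n \<Longrightarrow> insert k {Suc k..<n} = {k..<n}"
  by auto

lemma map_upt_Cons: "k < n \<Longrightarrow> map (\<xi>(k := t)) [k..<n] = t # map \<xi> [Suc k..<n]"
  by (simp add: upt_conv_Cons)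

lemma coord_update_measurable:
  assumes "k < n"
  shows "(\<lambda>(\<xi>, t). \<xi>(k := t)) \<in> measurable (coord_measure (Suc k) n \<Otimes>\<^sub>M lborel) (coord_measure k n)"
  using measurable_add_dim[of k "{Suc k..<n}" "\<lambda>_. lborel"] insert_interval[OF assms] by simp

lemma list_measurable_pair:
  assumes "k < n" "list_measurable k n g"
  shows "(\<lambda>(\<xi>, t). g (t # map \<xi> [Suc k..<n])) \<in> borel_measurable (coord_measure (Suc k) n \<Otimes>\<^sub>M lborel)"
proof -
  have "(\<lambda>p. g (map ((\<lambda>(\<xi>, t). \<xi>(k := t)) p) [k..<n])) \<in> borel_measurable (coord_measure (Suc k) n \<Otimes>\<^sub>M lborel)"
    by (rule measurable_compose[OF coord_update_measurable[OF assms(1)] assms(2)[unfolded list_measurable_def]])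
  then show ?thesis
    using assms(1) by (simp add: case_prod_beta' map_upt_Cons del: map_eq_conv)
qed

lemma list_measurable_slice:
  assumes "k < n" "list_measurable k n g" "\<xi> \<in> space (coord_measure (Suc k) n)"
  shows "(\<lambda>t. g (t # map \<xi> [Suc k..<n])) \<in> borel_measurable lborel"
  using measurable_compose[OF measurable_Pair1'[OF assms(3)] list_measurable_pair[OF assms(1,2)]]
  by simp

text \<open>Fubini's theorem for null sets.\<close>

lemma AE_list_slice:
  assumes k: "k < n" and P: "AE_list k n P"
  shows "AE_list (Suc k) n (\<lambda>xs. AE t in lborel. P (t # xs))"
proof -
  obtain S where S: "{\<xi> \<in> space (coord_measure k n). \<not> P (map \<xi> [k..<n])} \<subseteq> S"
    "emeasure (coord_measure k n) S = 0" and Sm: "S \<in> sets (coord_measure k n)"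
    using AE_E[OF P[unfolded AE_list_def]] by blast
  have Sm': "(\<lambda>\<xi>. indicator S \<xi> :: ennreal) \<in> borel_measurable (PiM (insert k {Suc k..<n}) (\<lambda>_. lborel))"
    using Sm insert_interval[OF k] by simp
  have "0 = (\<integral>\<^sup>+\<xi>. indicator S \<xi> \<partial>PiM (insert k {Suc k..<n}) (\<lambda>_. lborel))"
    using S Sm insert_interval[OF k] by simp
  also have "\<dots> = (\<integral>\<^sup>+\<xi>. (\<integral>\<^sup>+t. indicator S (\<xi>(k := t)) \<partial>lborel) \<partial>coord_measure (Suc k) n)"
    using Sm' by (intro coord.product_nn_integral_insert) auto
  finally have int0: "(\<integral>\<^sup>+\<xi>. (\<integral>\<^sup>+t. indicator S (\<xi>(k := t)) \<partial>lborel) \<partial>coord_measure (Suc k) n) = 0"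
    by simp
  have joint: "(\<lambda>(\<xi>, t). indicator S (\<xi>(k := t)) :: ennreal) \<in> borel_measurable (coord_measure (Suc k) n \<Otimes>\<^sub>M lborel)"
    using measurable_compose[OF coord_update_measurable[OF k] borel_measurable_indicator[OF Sm]]
    by (simp add: case_prod_beta')
  have "(\<lambda>\<xi>. \<integral>\<^sup>+t. indicator S (\<xi>(k := t)) \<partial>lborel) \<in> borel_measurable (coord_measure (Suc k) n)"
    using lborel.borel_measurable_nn_integral_fst[OF joint] by simp
  with int0 have ae: "AE \<xi> in coord_measure (Suc k) n. (\<integral>\<^sup>+t. indicator S (\<xi>(k := t)) \<partial>lborel) = 0"
    by (simp add: nn_integral_0_iff_AE)
  show ?thesis
    unfolding AE_list_def
  proof (rule AE_mp[OF ae], rule AE_I2, rule impI)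
    fix \<xi> assume \<xi>: "\<xi> \<in> space (coord_measure (Suc k) n)"
      and 0: "(\<integral>\<^sup>+t. indicator S (\<xi>(k := t)) \<partial>lborel) = 0"
    have "(\<lambda>t. indicator S (\<xi>(k := t)) :: ennreal) \<in> borel_measurable lborel"
      using measurable_compose[OF measurable_Pair1'[OF \<xi>] joint] by simp
    with 0 have "AE t in lborel. indicator S (\<xi>(k := t)) = (0::ennreal)"
      by (simp add: nn_integral_0_iff_AE)
    then show "AE t in lborel. P (t # map \<xi> [Suc k..<n])"
    proof (rule eventually_mono)
      fix t :: real assume "indicator S (\<xi>(k := t)) = (0::ennreal)"
      then have "\<xi>(k := t) \<notin> S" by (simp add: indicator_def split: if_splits)
      moreover have "\<xi>(k := t) \<in> space (coord_measure k n)"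
        using \<xi> k by (auto simp: space_PiM PiE_def extensional_def)
      ultimately have "P (map (\<xi>(k := t)) [k..<n])" using S by blast
      then show "P (t # map \<xi> [Suc k..<n])" by (simp only: map_upt_Cons[OF k])
    qed
  qed
qed

lemma AE_list_empty: "AE_list n n P \<longleftrightarrow> P []"
proof -
  have "coord_measure n n = count_space {\<lambda>_. undefined}"
    by (simp add: PiM_empty)
  then show ?thesis
    unfolding AE_list_def by (simp only: AE_count_space) simp
qed

text \<open>The essential supremum is at most \<open>y\<close> if and only if the integral of the indicator function of the set
where \<open>y\<close> is exceeded vanishes, and integrals depend measurably on parameters.\<close>

lemma esssup_parameter_measurable:
  assumes f: "(\<lambda>(\<xi>, t). f \<xi> t) \<in> borel_measurable (M \<Otimes>\<^sub>M (lborel :: real measure))"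
  shows "(\<lambda>\<xi>. esssup lebesgue (f \<xi>) :: ennreal) \<in> borel_measurable M"
proof (rule borel_measurableI_le)
  fix y :: ennreal
  have slice: "f \<xi> \<in> borel_measurable lborel" if "\<xi> \<in> space M" for \<xi>
    using measurable_compose[OF measurable_Pair1'[OF that] f] by simp
  have ind: "(\<lambda>(\<xi>, t). if f \<xi> t \<le> y then 0 else 1 :: ennreal) \<in> borel_measurable (M \<Otimes>\<^sub>M lborel)"
    using f by (simp add: case_prod_beta') measurable
  have eq: "esssup lebesgue (f \<xi>) \<le> y \<longleftrightarrow> (\<integral>\<^sup>+t. (if f \<xi> t \<le> y then 0 else 1) \<partial>lborel) = 0"
    if \<xi>: "\<xi> \<in> space M" for \<xi>
  proof -
    have "(\<integral>\<^sup>+t. (if f \<xi> t \<le> y then 0 else 1) \<partial>lborel) = 0 \<longleftrightarrow> (AE t in lborel. f \<xi> t \<le> y)"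
      using measurable_compose[OF measurable_Pair1'[OF \<xi>] ind]
      by (subst nn_integral_0_iff_AE) (auto simp: if_distrib cong: if_cong split: if_splits elim!: eventually_mono)
    also have "\<dots> \<longleftrightarrow> esssup lebesgue (f \<xi>) \<le> y"
    proof
      assume "AE t in lborel. f \<xi> t \<le> y"
      then show "esssup lebesgue (f \<xi>) \<le> y"
        using slice[OF \<xi>] by (intro esssup_I) (auto simp: measurable_completion AE_completion)
    next
      assume "esssup lebesgue (f \<xi>) \<le> y"
      moreover have "AE t in lborel. f \<xi> t \<le> esssup lebesgue (f \<xi>)"
        using esssup_AE[of "f \<xi>" lebesgue] by (simp add: AE_completion_iff)
      ultimately show "AE t in lborel. f \<xi> t \<le> y"
        by (auto elim!: eventually_mono)
    qed
    finally show ?thesis by simp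
  qed
  have "{\<xi> \<in> space M. esssup lebesgue (f \<xi>) \<le> y} =
      {\<xi> \<in> space M. (\<integral>\<^sup>+t. (if f \<xi> t \<le> y then 0 else 1) \<partial>lborel) = (0::ennreal)}"
    using eq by blast
  also have "\<dots> \<in> sets M"
    using lborel.borel_measurable_nn_integral_fst[OF ind] by simp
  finally show "{\<xi> \<in> space M. esssup lebesgue (f \<xi>) \<le> y} \<in> sets M" .
qed

lemma list_measurable_Lp_norm:
  assumes k: "k < n" and g: "list_measurable k n g"
  shows "list_measurable (Suc k) n (\<lambda>xs. Lp_norm p (\<lambda>t. g (t # xs)))"
proof -
  have joint: "(\<lambda>(\<xi>, t). g (t # map \<xi> [Suc k..<n])) \<in> borel_measurable (coord_measure (Suc k) n \<Otimes>\<^sub>M lborel)"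
    by (rule list_measurable_pair[OF k g])
  show ?thesis
  proof (cases "p = \<infinity>")
    case True
    then show ?thesis
      using esssup_parameter_measurable[OF joint] by (simp add: list_measurable_def Lp_norm_def)
  next
    case False
    have "(\<lambda>(\<xi>, t). ennreal_powr (g (t # map \<xi> [Suc k..<n])) (enn2real p)) \<in> borel_measurable (coord_measure (Suc k) n \<Otimes>\<^sub>M lborel)"
      using measurable_compose[OF joint ennreal_powr_measurable] by (simp add: case_prod_beta')
    from lborel.borel_measurable_nn_integral_fst[OF this]
    have "(\<lambda>\<xi>. \<integral>\<^sup>+t. ennreal_powr (g (t # map \<xi> [Suc k..<n])) (enn2real p) \<partial>lborel) \<in> borel_measurable (coord_measure (Suc k) n)"
      by simp
    from measurable_compose[OF this ennreal_powr_measurable] show ?thesis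
      using False by (simp add: list_measurable_def Lp_norm_def nn_integral_completion)
  qed
qed

lemma AE_listI: "(\<And>\<xi>. \<xi> \<in> space (coord_measure k n) \<Longrightarrow> P (map \<xi> [k..<n])) \<Longrightarrow> AE_list k n P"
  unfolding AE_list_def by (rule AE_I2)

lemma AE_list_mono: "AE_list k n P \<Longrightarrow> (\<And>xs. P xs \<Longrightarrow> Q xs) \<Longrightarrow> AE_list k n Q"
  unfolding AE_list_def by (auto elim: eventually_mono)

lemma iterated_Lp_norm_AE_cong:
  assumes "length ps = n - k" "k \<le> n" "AE_list k n (\<lambda>xs. g xs = h xs)"
  shows "iterated_Lp_norm ps g = iterated_Lp_norm ps h"
  using assms
proof (induction ps arbitrary: k g h)
  case Nil
  then show ?case by (simp add: AE_list_empty)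
next
  case (Cons p ps)
  then have k: "k < n" by simp
  have "AE_list (Suc k) n (\<lambda>xs. AE t in lborel. g (t # xs) = h (t # xs))"
    by (rule AE_list_slice[OF k Cons.prems(3)])
  then have "AE_list (Suc k) n (\<lambda>xs. Lp_norm p (\<lambda>t. g (t # xs)) = Lp_norm p (\<lambda>t. h (t # xs)))"
    by (rule AE_list_mono) (rule Lp_norm_AE_cong)
  moreover have "length ps = n - Suc k"
    using Cons.prems(1) by simp
  ultimately show ?case
    using k Cons.IH[of "Suc k"] by simp
qed

lemma iterated_Lp_norm_mono:
  assumes "length ps = n - k" "k \<le> n" "\<forall>p\<in>set ps. 0 < p" "list_measurable k n g"
    "AE_list k n (\<lambda>xs. g xs \<le> h xs)"
  shows "iterated_Lp_norm ps g \<le> iterated_Lp_norm ps h"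
  using assms
proof (induction ps arbitrary: k g h)
  case Nil
  then show ?case by (simp add: AE_list_empty)
next
  case (Cons p ps)
  then have k: "k < n" and p: "0 < p" by auto
  have "AE_list (Suc k) n (\<lambda>xs. AE t in lborel. g (t # xs) \<le> h (t # xs))"
    by (rule AE_list_slice[OF k Cons.prems(5)])
  then have "AE_list (Suc k) n (\<lambda>xs. Lp_norm p (\<lambda>t. g (t # xs)) \<le> Lp_norm p (\<lambda>t. h (t # xs)))"
    unfolding AE_list_def
    by (rule AE_mp) (auto intro!: AE_I2 Lp_norm_mono list_measurable_slice k Cons.prems(4) p)
  moreover have "length ps = n - Suc k"
    using Cons.prems(1) by simp
  ultimately show ?case
    using k Cons.IH[of "Suc k"] Cons.prems(3) list_measurable_Lp_norm[OF k Cons.prems(4), of p] by simp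
qed

lemma iterated_Lp_norm_scale:
  assumes "length ps = n - k" "k \<le> n" "\<forall>p\<in>set ps. 0 < p" "list_measurable k n g" "0 \<le> c"
  shows "iterated_Lp_norm ps (\<lambda>xs. ennreal c * g xs) = ennreal c * iterated_Lp_norm ps g"
  using assms
proof (induction ps arbitrary: k g)
  case (Cons p ps)
  then have k: "k < n" and p: "0 < p" by auto
  have "AE_list (Suc k) n (\<lambda>xs. Lp_norm p (\<lambda>t. ennreal c * g (t # xs)) = ennreal c * Lp_norm p (\<lambda>t. g (t # xs)))"
    by (intro AE_listI Lp_norm_scale list_measurable_slice k Cons.prems p)
  then have "iterated_Lp_norm ps (\<lambda>xs. Lp_norm p (\<lambda>t. ennreal c * g (t # xs))) =
      iterated_Lp_norm ps (\<lambda>xs. ennreal c * Lp_norm p (\<lambda>t. g (t # xs)))"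
    using Cons.prems k by (intro iterated_Lp_norm_AE_cong[where k = "Suc k" and n = n]) auto
  also have "\<dots> = ennreal c * iterated_Lp_norm ps (\<lambda>xs. Lp_norm p (\<lambda>t. g (t # xs)))"
    using Cons.prems k by (intro Cons.IH[of "Suc k"] list_measurable_Lp_norm) auto
  finally show ?case by simp
qed simp

lemma list_measurable_add:
  "list_measurable k n g \<Longrightarrow> list_measurable k n h \<Longrightarrow> list_measurable k n (\<lambda>xs. g xs + h xs)"
  unfolding list_measurable_def by (rule borel_measurable_add)

lemma iterated_Lp_norm_add:
  assumes "length ps = n - k" "k \<le> n" "\<forall>p\<in>set ps. 0 < p"
  shows "\<exists>K\<ge>1. \<forall>g h. list_measurable k n g \<longrightarrow> list_measurable k n h \<longrightarrow>
    iterated_Lp_norm ps (\<lambda>xs. g xs + h xs) \<le> ennreal K * (iterated_Lp_norm ps g + iterated_Lp_norm ps h)"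
  using assms
proof (induction ps arbitrary: k)
  case Nil
  then show ?case by (auto intro!: exI[of _ 1])
next
  case (Cons p ps)
  then have k: "k < n" and p: "0 < p" by auto
  have len: "length ps = n - Suc k"
    using Cons.prems(1) by simp
  obtain K where K: "1 \<le> K" "\<And>g h. list_measurable (Suc k) n g \<Longrightarrow> list_measurable (Suc k) n h \<Longrightarrow>
    iterated_Lp_norm ps (\<lambda>xs. g xs + h xs) \<le> ennreal K * (iterated_Lp_norm ps g + iterated_Lp_norm ps h)"
    using Cons.IH[of "Suc k"] Cons.prems(3) len k by auto
  obtain L where L: "1 \<le> L" "\<And>u w. u \<in> borel_measurable lborel \<Longrightarrow> w \<in> borel_measurable lborel \<Longrightarrow>
    Lp_norm p (\<lambda>t. u t + w t) \<le> ennreal L * (Lp_norm p u + Lp_norm p w)"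
    using Lp_norm_add_le[OF p] by blast
  have "iterated_Lp_norm (p # ps) (\<lambda>xs. g xs + h xs) \<le> ennreal (L * K) * (iterated_Lp_norm (p # ps) g + iterated_Lp_norm (p # ps) h)"
    if gm: "list_measurable k n g" and hm: "list_measurable k n h" for g h
  proof -
    define G where "G xs = Lp_norm p (\<lambda>t. g (t # xs))" for xs
    define H where "H xs = Lp_norm p (\<lambda>t. h (t # xs))" for xs
    have Gm: "list_measurable (Suc k) n G" "list_measurable (Suc k) n H"
      unfolding G_def H_def by (intro list_measurable_Lp_norm k gm hm)+
    have "iterated_Lp_norm (p # ps) (\<lambda>xs. g xs + h xs) \<le> iterated_Lp_norm ps (\<lambda>xs. ennreal L * (G xs + H xs))"
      using Cons.prems k unfolding G_def H_def iterated_Lp_norm.simps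
      by (intro iterated_Lp_norm_mono[where k = "Suc k" and n = n] list_measurable_Lp_norm list_measurable_add gm hm
          AE_listI L(2) list_measurable_slice) auto
    also have "\<dots> = ennreal L * iterated_Lp_norm ps (\<lambda>xs. G xs + H xs)"
      using Cons.prems k L(1) by (intro iterated_Lp_norm_scale[where k = "Suc k" and n = n] list_measurable_add Gm) auto
    also have "\<dots> \<le> ennreal L * (ennreal K * (iterated_Lp_norm ps G + iterated_Lp_norm ps H))"
      by (intro mult_left_mono K(2) Gm) auto
    also have "\<dots> = ennreal (L * K) * (iterated_Lp_norm (p # ps) g + iterated_Lp_norm (p # ps) h)"
      using L(1) K(1) by (simp add: G_def[abs_def] H_def[abs_def] ennreal_mult mult.assoc)
    finally show ?thesis .
  qed
  moreover have "1 \<le> L * K" using L(1) K(1) mult_mono[of 1 L 1 K] by simp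
  ultimately show ?case by blast
qed

lemma list_measurable_liminf:
  "(\<And>m. list_measurable k n (g m)) \<Longrightarrow> list_measurable k n (\<lambda>xs. liminf (\<lambda>m. g m xs))"
  unfolding list_measurable_def by (rule borel_measurable_liminf)

lemma iterated_Lp_norm_liminf:
  assumes "length ps = n - k" "k \<le> n" "\<forall>p\<in>set ps. 0 < p" "\<And>m. list_measurable k n (g m)"
  shows "iterated_Lp_norm ps (\<lambda>xs. liminf (\<lambda>m. g m xs)) \<le> liminf (\<lambda>m. iterated_Lp_norm ps (g m))"
  using assms
proof (induction ps arbitrary: k g)
  case (Cons p ps)
  then have k: "k < n" and p: "0 < p" by auto
  have "iterated_Lp_norm ps (\<lambda>xs. Lp_norm p (\<lambda>t. liminf (\<lambda>m. g m (t # xs)))) \<le>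
      iterated_Lp_norm ps (\<lambda>xs. liminf (\<lambda>m. Lp_norm p (\<lambda>t. g m (t # xs))))"
    using Cons.prems k
    by (intro iterated_Lp_norm_mono[where k = "Suc k" and n = n] list_measurable_Lp_norm[where g = "\<lambda>xs. liminf (\<lambda>m. g m xs)"]
        list_measurable_liminf AE_listI Lp_norm_liminf list_measurable_slice p) auto
  also have "\<dots> \<le> liminf (\<lambda>m. iterated_Lp_norm ps (\<lambda>xs. Lp_norm p (\<lambda>t. g m (t # xs))))"
    using Cons.prems k by (intro Cons.IH[of "Suc k"] list_measurable_Lp_norm) auto
  finally show ?case by simp
qed simp

lemma iterated_Lp_norm_shift:
  assumes "length ps = n - k" "k \<le> n" "length ss = n - k" "list_measurable k n g"
  shows "iterated_Lp_norm ps (\<lambda>xs. g (map2 (+) xs ss)) = iterated_Lp_norm ps g"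
  using assms
proof (induction ps arbitrary: k g ss)
  case (Cons p ps)
  then have k: "k < n" by simp
  obtain s ss' where ss: "ss = s # ss'" "length ss' = n - Suc k"
    using Cons.prems k by (cases ss) auto
  have "AE_list (Suc k) n (\<lambda>xs. Lp_norm p (\<lambda>t. g ((t + s) # map2 (+) xs ss')) = Lp_norm p (\<lambda>t. g (t # map2 (+) xs ss')))"
  proof (rule AE_listI)
    fix \<xi> assume \<xi>: "\<xi> \<in> space (coord_measure (Suc k) n)"
    define \<xi>' where "\<xi>' = restrict (\<lambda>i. \<xi> i + ss' ! (i - Suc k)) {Suc k..<n}"
    have "map2 (+) (map \<xi> [Suc k..<n]) ss' = map \<xi>' [Suc k..<n]"
      using ss(2) by (intro nth_equalityI) (auto simp: \<xi>'_def)
    moreover have "\<xi>' \<in> space (coord_measure (Suc k) n)"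
      by (simp add: space_PiM \<xi>'_def)
    from Lp_norm_shift[OF list_measurable_slice[OF k Cons.prems(4) this], of p s]
    have "Lp_norm p (\<lambda>t. g ((t + s) # map \<xi>' [Suc k..<n])) = Lp_norm p (\<lambda>t. g (t # map \<xi>' [Suc k..<n]))" .
    ultimately show "Lp_norm p (\<lambda>t. g ((t + s) # map2 (+) (map \<xi> [Suc k..<n]) ss')) =
        Lp_norm p (\<lambda>t. g (t # map2 (+) (map \<xi> [Suc k..<n]) ss'))"
      by simp
  qed
  then have "iterated_Lp_norm ps (\<lambda>xs. Lp_norm p (\<lambda>t. g ((t + s) # map2 (+) xs ss'))) =
      iterated_Lp_norm ps (\<lambda>xs. Lp_norm p (\<lambda>t. g (t # map2 (+) xs ss')))"
    using Cons.prems k by (intro iterated_Lp_norm_AE_cong[where k = "Suc k" and n = n]) auto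
  also have "\<dots> = iterated_Lp_norm ps (\<lambda>xs. Lp_norm p (\<lambda>t. g (t # xs)))"
    using Cons.prems k ss(2) by (intro Cons.IH[of "Suc k" ss' "\<lambda>xs. Lp_norm p (\<lambda>t. g (t # xs))"] list_measurable_Lp_norm) auto
  finally show ?case by (simp add: ss)
qed simp

text \<open>Peeling off one variable at a time, with the one-variable estimate on the edges of a cube.\<close>

lemma iterated_Lp_norm_local:
  assumes "length ps = n - k" "k \<le> n" "\<forall>p\<in>set ps. 0 < p \<and> ennreal r \<le> p" "0 < r" "0 \<le> R" "list_measurable k n g"
  shows "(\<integral>\<^sup>+\<xi>. (\<Prod>i\<in>{k..<n}. indicator {-R..R} (\<xi> i)) * ennreal_powr (g (map \<xi> [k..<n])) r \<partial>coord_measure k n)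
    \<le> ennreal ((2 * R + 1) ^ length ps) * ennreal_powr (iterated_Lp_norm ps g) r"
  using assms
proof (induction ps arbitrary: k g)
  case Nil
  then show ?case by (simp add: PiM_empty nn_integral_count_space_finite)
next
  case (Cons p ps)
  then have k: "k < n" and p: "0 < p" "ennreal r \<le> p" by auto
  define G where "G xs = Lp_norm p (\<lambda>t. g (t # xs))" for xs
  define I where "I \<xi> = (\<Prod>i\<in>{Suc k..<n}. indicator {-R..R} (\<xi> i) :: ennreal)" for \<xi> :: "nat \<Rightarrow> real"
  have Gm: "list_measurable (Suc k) n G"
    unfolding G_def by (intro list_measurable_Lp_norm k Cons.prems)
  have [measurable]: "(\<lambda>\<xi>. G (map \<xi> [Suc k..<n])) \<in> borel_measurable (coord_measure (Suc k) n)"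
    using Gm by (simp add: list_measurable_def)
  have [measurable]: "I \<in> borel_measurable (coord_measure (Suc k) n)"
    unfolding I_def by measurable
  have gm: "(\<lambda>\<xi>. (\<Prod>i\<in>{k..<n}. indicator {-R..R} (\<xi> i)) * ennreal_powr (g (map \<xi> [k..<n])) r)
      \<in> borel_measurable (coord_measure k n)"
  proof -
    have [measurable]: "(\<lambda>\<xi>. g (map \<xi> [k..<n])) \<in> borel_measurable (coord_measure k n)"
      using Cons.prems by (simp add: list_measurable_def)
    show ?thesis by measurable
  qed
  have "(\<integral>\<^sup>+\<xi>. (\<Prod>i\<in>{k..<n}. indicator {-R..R} (\<xi> i)) * ennreal_powr (g (map \<xi> [k..<n])) r \<partial>coord_measure k n) =
    (\<integral>\<^sup>+\<xi>. (\<integral>\<^sup>+t. (\<Prod>i\<in>{k..<n}. indicator {-R..R} ((\<xi>(k := t)) i)) * ennreal_powr (g (map (\<xi>(k := t)) [k..<n])) r \<partial>lborel)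
      \<partial>coord_measure (Suc k) n)"
    using coord.product_nn_integral_insert[of "{Suc k..<n}" k, unfolded insert_interval[OF k], OF _ _ gm] by simp
  also have "\<dots> = (\<integral>\<^sup>+\<xi>. I \<xi> * (\<integral>\<^sup>+t\<in>{-R..R}. ennreal_powr (g (t # map \<xi> [Suc k..<n])) r \<partial>lborel) \<partial>coord_measure (Suc k) n)"
  proof (rule nn_integral_cong)
    fix \<xi> assume \<xi>: "\<xi> \<in> space (coord_measure (Suc k) n)"
    have prod: "(\<Prod>i\<in>{k..<n}. indicator {-R..R} ((\<xi>(k := t)) i)) = indicator {-R..R} t * I \<xi>" for t
    proof -
      have "(\<Prod>i\<in>{Suc k..<n}. indicator {-R..R} ((\<xi>(k := t)) i) :: ennreal) = I \<xi>"
        unfolding I_def by (intro prod.cong) auto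
      then show ?thesis
        unfolding insert_interval[OF k, symmetric] by simp
    qed
    have sm: "(\<lambda>t. ennreal_powr (g (t # map \<xi> [Suc k..<n])) r * indicator {-R..R} t) \<in> borel_measurable lborel"
      using measurable_compose[OF list_measurable_slice[OF k Cons.prems(6) \<xi>] ennreal_powr_measurable, of r] by measurable
    show "(\<integral>\<^sup>+t. (\<Prod>i\<in>{k..<n}. indicator {-R..R} ((\<xi>(k := t)) i)) * ennreal_powr (g (map (\<xi>(k := t)) [k..<n])) r \<partial>lborel) =
        I \<xi> * (\<integral>\<^sup>+t\<in>{-R..R}. ennreal_powr (g (t # map \<xi> [Suc k..<n])) r \<partial>lborel)"
      unfolding prod map_upt_Cons[OF k] nn_integral_cmult[OF sm, symmetric] by (simp add: mult_ac)
  qed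
  also have "\<dots> \<le> (\<integral>\<^sup>+\<xi>. ennreal (2 * R + 1) * (I \<xi> * ennreal_powr (G (map \<xi> [Suc k..<n])) r) \<partial>coord_measure (Suc k) n)"
  proof (rule nn_integral_mono)
    fix \<xi> assume \<xi>: "\<xi> \<in> space (coord_measure (Suc k) n)"
    have "(\<integral>\<^sup>+t\<in>{-R..R}. ennreal_powr (g (t # map \<xi> [Suc k..<n])) r \<partial>lborel) \<le>
        ennreal (2 * R + 1) * ennreal_powr (G (map \<xi> [Suc k..<n])) r"
      unfolding G_def using Cons.prems p by (intro Lp_norm_local list_measurable_slice[OF k _ \<xi>]) auto
    from mult_left_mono[OF this, of "I \<xi>"]
    show "I \<xi> * (\<integral>\<^sup>+t\<in>{-R..R}. ennreal_powr (g (t # map \<xi> [Suc k..<n])) r \<partial>lborel) \<le>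
        ennreal (2 * R + 1) * (I \<xi> * ennreal_powr (G (map \<xi> [Suc k..<n])) r)"
      by (simp add: mult_ac)
  qed
  also have "\<dots> = ennreal (2 * R + 1) * (\<integral>\<^sup>+\<xi>. I \<xi> * ennreal_powr (G (map \<xi> [Suc k..<n])) r \<partial>coord_measure (Suc k) n)"
    by (rule nn_integral_cmult) measurable
  also have "\<dots> \<le> ennreal (2 * R + 1) * (ennreal ((2 * R + 1) ^ length ps) * ennreal_powr (iterated_Lp_norm ps G) r)"
    unfolding I_def using Cons.prems k by (intro mult_left_mono Cons.IH[of "Suc k" G] Gm) auto
  also have "\<dots> = ennreal ((2 * R + 1) ^ length (p # ps)) * ennreal_powr (iterated_Lp_norm (p # ps) g) r"
    using Cons.prems(5) by (simp add: G_def[abs_def] ennreal_mult mult.assoc)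
  finally show ?case .
qed

section \<open>Coordinates with respect to a basis\<close>

lemma coordinate_measurable:
  "i < m \<Longrightarrow> (\<lambda>\<xi>. \<xi> i) \<in> borel_measurable (coord_measure 0 m)"
  using measurable_component_singleton[of i "{0..<m}" "\<lambda>_. lborel :: real measure"] by simp

definition lincomb :: "'a::euclidean_space list \<Rightarrow> real list \<Rightarrow> 'a" where
  "lincomb es xs = (\<Sum>(t, e)\<leftarrow>zip xs es. t *\<^sub>R e)"

lemma lincomb_nth:
  assumes "length xs = length es"
  shows "lincomb es xs = (\<Sum>i<length es. xs ! i *\<^sub>R es ! i)"
proof -
  have "lincomb es xs = (\<Sum>i\<in>{0..<length es}. map (\<lambda>(t, e). t *\<^sub>R e) (zip xs es) ! i)"
    unfolding lincomb_def sum_list_sum_nth using assms by simp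
  also have "\<dots> = (\<Sum>i<length es. xs ! i *\<^sub>R es ! i)"
    using assms by (intro sum.cong) auto
  finally show ?thesis .
qed

lemma lincomb_shift:
  assumes "length xs = length es" "length ss = length es"
  shows "lincomb es (map2 (+) xs ss) = lincomb es xs + lincomb es ss"
proof -
  have len: "length (map2 (+) xs ss) = length es"
    using assms by simp
  have "lincomb es (map2 (+) xs ss) = (\<Sum>i<length es. xs ! i *\<^sub>R es ! i + ss ! i *\<^sub>R es ! i)"
    unfolding lincomb_nth[OF len]
    by (rule sum.cong[OF refl]) (use assms in \<open>simp add: scaleR_add_left\<close>)
  then show ?thesis
    unfolding lincomb_nth[OF assms(1)] lincomb_nth[OF assms(2)] sum.distrib .
qed

text \<open>Within the locale, \<open>point \<xi>\<close> is the vector with coordinates \<open>\<xi>\<close>, and \<open>mnorm\<close> is the mixed quasi-norm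
on functions with values in \<open>[0, \<infinity>]\<close>. Its properties are stated for Lebesgue measurable functions;
they are derived from the iterated norms by passing to Borel representatives.\<close>

locale mixed_Lebesgue_data =
  fixes es :: "'a::euclidean_space list" and ps :: "ennreal list"
  assumes es: "distinct es" "independent (set es)" "span (set es) = UNIV"
    and ps: "length ps = length es" "\<forall>p\<in>set ps. 0 < p"
begin

abbreviation n where "n \<equiv> length es"

abbreviation point :: "(nat \<Rightarrow> real) \<Rightarrow> 'a" where "point \<xi> \<equiv> lincomb es (map \<xi> [0..<n])"

abbreviation mnorm :: "('a \<Rightarrow> ennreal) \<Rightarrow> ennreal" where
  "mnorm q \<equiv> iterated_Lp_norm ps (\<lambda>xs. q (lincomb es xs))"

lemma point_eq: "point \<xi> = (\<Sum>i<n. \<xi> i *\<^sub>R es ! i)"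
proof -
  have len: "length (map \<xi> [0..<n]) = n" by simp
  show ?thesis
    unfolding lincomb_nth[OF len] by (rule sum.cong[OF refl]) simp
qed

lemma point_measurable [measurable]: "point \<in> borel_measurable (coord_measure 0 n)"
  unfolding point_eq
proof (intro borel_measurable_sum borel_measurable_scaleR)
  show "(\<lambda>\<xi>. \<xi> i) \<in> borel_measurable (coord_measure 0 n)" if "i \<in> {..<n}" for i
    using coordinate_measurable that by simp
  show "(\<lambda>\<xi>. es ! i) \<in> borel_measurable (coord_measure 0 n)" for i
    by (rule borel_measurable_const)
qed

lemma lincomb_onto: obtains ss where "length ss = n" "lincomb es ss = x"
proof -
  have "x \<in> range (\<lambda>u. \<Sum>e\<in>set es. u e *\<^sub>R e)"
    unfolding span_finite[OF List.finite_set, symmetric] es(3) by simp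
  then obtain u where u: "x = (\<Sum>e\<in>set es. u e *\<^sub>R e)"
    by (rule imageE)
  have "(\<Sum>e\<in>set es. u e *\<^sub>R e) = (\<Sum>i<n. u (es ! i) *\<^sub>R es ! i)"
    using sum.reindex_bij_betw[OF bij_betw_nth[OF es(1) refl refl], of "\<lambda>e. u e *\<^sub>R e"] by simp
  then show ?thesis
    using u that[of "map u es"] lincomb_nth[of "map u es" es] by simp
qed

text \<open>The coordinates are linear functionals, and linear functionals on a Euclidean space are bounded.\<close>

lemma coordinate_bound:
  obtains \<kappa> where "0 < \<kappa>" "\<And>\<xi> i. i < n \<Longrightarrow> \<bar>\<xi> i\<bar> \<le> \<kappa> * norm (point \<xi>)"
proof -
  have "\<exists>\<kappa>>0. \<forall>\<xi>. \<bar>\<xi> i\<bar> \<le> \<kappa> * norm (point \<xi>)" if i: "i < n" for i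
  proof -
    obtain f :: "'a \<Rightarrow> real" where f: "linear f" "\<forall>e\<in>set es. f e = (if e = es ! i then 1 else 0)"
      using linear_independent_extend[OF es(2), of "\<lambda>e. if e = es ! i then 1 else 0"] by (elim exE conjE)
    obtain \<kappa> where \<kappa>: "0 < \<kappa>" "\<And>x. norm (f x) \<le> norm x * \<kappa>"
      using bounded_linear.pos_bounded[OF linear_conv_bounded_linear[THEN iffD1, OF f(1)]] by blast
    have "f (point \<xi>) = \<xi> i" for \<xi>
    proof -
      have "f (point \<xi>) = (\<Sum>j<n. \<xi> j * f (es ! j))"
        unfolding point_eq using f(1) by (simp add: linear_sum linear_scale)
      also have "\<dots> = (\<Sum>j<n. if j = i then \<xi> j else 0)"
        using f(2) es(1) i by (intro sum.cong) (auto simp: nth_eq_iff_index_eq)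
      finally show ?thesis using i by simp
    qed
    then have "\<bar>\<xi> i\<bar> \<le> \<kappa> * norm (point \<xi>)" for \<xi>
      using \<kappa>(2)[of "point \<xi>"] by (simp add: mult.commute)
    then show ?thesis using \<kappa>(1) by blast
  qed
  then obtain k where k: "\<And>i. i < n \<Longrightarrow> 0 < k i" "\<And>i \<xi>. i < n \<Longrightarrow> \<bar>\<xi> i\<bar> \<le> k i * norm (point \<xi>)"
    by metis
  define \<kappa> where "\<kappa> = 1 + (\<Sum>i<n. k i)"
  have le: "k i \<le> \<kappa>" if "i < n" for i
    unfolding \<kappa>_def using k(1) that member_le_sum[of i "{..<n}" k] by (fastforce simp: less_imp_le)
  show ?thesis
  proof
    show "0 < \<kappa>"
      unfolding \<kappa>_def using k(1) by (intro add_pos_nonneg sum_nonneg) (auto simp: less_imp_le)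
    show "\<bar>\<xi> i\<bar> \<le> \<kappa> * norm (point \<xi>)" if "i < n" for \<xi> i
      using k(2)[OF that] mult_right_mono[OF le[OF that] norm_ge_zero] order_trans by blast
  qed
qed

lemma coord_measure_shift:
  "distr (coord_measure 0 n) (coord_measure 0 n) (\<lambda>\<xi>. \<lambda>i\<in>{0..<n}. s i + \<xi> i) = coord_measure 0 n"
    (is "?D = _")
proof (rule coord.PiM_eqI)
  have meas: "(\<lambda>\<xi>. \<lambda>i\<in>{0..<n}. s i + \<xi> i) \<in> measurable (coord_measure 0 n) (coord_measure 0 n)"
  proof (rule measurable_restrict)
    fix i assume "i \<in> {0..<n}"
    then have [measurable]: "(\<lambda>\<xi>. \<xi> i) \<in> borel_measurable (coord_measure 0 n)"
      using coordinate_measurable by simp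
    have "(\<lambda>\<xi>. s i + \<xi> i) \<in> borel_measurable (coord_measure 0 n)" by measurable
    then show "(\<lambda>\<xi>. s i + \<xi> i) \<in> measurable (coord_measure 0 n) lborel" by simp
  qed
  fix A :: "nat \<Rightarrow> real set" assume A: "\<And>i. i \<in> {0..<n} \<Longrightarrow> A i \<in> sets lborel"
  have pre: "(\<lambda>\<xi>. \<lambda>i\<in>{0..<n}. s i + \<xi> i) -` (Pi\<^sub>E {0..<n} A) \<inter> space (coord_measure 0 n) =
      Pi\<^sub>E {0..<n} (\<lambda>i. (+) (s i) -` A i)"
    by (auto simp: space_PiM PiE_def Pi_def extensional_def)
  have Am: "(+) (s i) -` A i \<in> sets lborel" if "i \<in> {0..<n}" for i
    using A[OF that] measurable_sets_borel[of "(+) (s i)" borel "A i"] by simp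
  have "emeasure ?D (Pi\<^sub>E {0..<n} A) = emeasure (coord_measure 0 n) (Pi\<^sub>E {0..<n} (\<lambda>i. (+) (s i) -` A i))"
    using A by (subst emeasure_distr[OF meas]) (auto simp: pre intro!: sets_PiM_I_finite)
  also have "\<dots> = (\<Prod>i\<in>{0..<n}. emeasure lborel ((+) (s i) -` A i))"
    using Am by (intro coord.emeasure_PiM) auto
  also have "\<dots> = (\<Prod>i\<in>{0..<n}. emeasure lborel (A i))"
  proof (rule prod.cong[OF refl])
    fix i assume "i \<in> {0..<n}"
    then have "emeasure (distr lborel borel ((+) (s i))) (A i) = emeasure lborel ((+) (s i) -` A i)"
      using A by (subst emeasure_distr) auto
    then show "emeasure lborel ((+) (s i) -` A i) = emeasure lborel (A i)"
      by (simp add: lborel_distr_plus)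
  qed
  finally show "emeasure ?D (Pi\<^sub>E {0..<n} A) = (\<Prod>i\<in>{0..<n}. emeasure lborel (A i))" .
qed auto

text \<open>The image of the product measure in coordinates is translation invariant and finite on balls, hence a
multiple of Lebesgue measure; it is not zero.\<close>

lemma coordinate_change:
  obtains c where "0 < c"
    "\<And>g. g \<in> borel_measurable borel \<Longrightarrow> (\<integral>\<^sup>+\<xi>. g (point \<xi>) \<partial>coord_measure 0 n) = ennreal c * (\<integral>\<^sup>+x. g x \<partial>lborel)"
proof -
  define \<mu> where "\<mu> = distr (coord_measure 0 n) borel point"
  obtain \<kappa> where \<kappa>: "0 < \<kappa>" "\<And>\<xi> i. i < n \<Longrightarrow> \<bar>\<xi> i\<bar> \<le> \<kappa> * norm (point \<xi>)"
    using coordinate_bound by blast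
  have fin: "emeasure \<mu> (ball 0 R) < \<infinity>" for R
  proof -
    have "point -` ball 0 R \<inter> space (coord_measure 0 n) \<subseteq> Pi\<^sub>E {0..<n} (\<lambda>_. {- (\<kappa> * R)..\<kappa> * R})"
    proof
      fix \<xi> assume \<xi>: "\<xi> \<in> point -` ball 0 R \<inter> space (coord_measure 0 n)"
      then have "norm (point \<xi>) \<le> R" by simp
      then have "\<bar>\<xi> i\<bar> \<le> \<kappa> * R" if "i < n" for i
        using \<kappa>(2)[OF that, of \<xi>] mult_left_mono[of "norm (point \<xi>)" R \<kappa>] \<kappa>(1) by linarith
      then show "\<xi> \<in> Pi\<^sub>E {0..<n} (\<lambda>_. {- (\<kappa> * R)..\<kappa> * R})"
        using \<xi> by (auto simp: space_PiM PiE_def Pi_def abs_le_iff) (smt (verit))+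
    qed
    then have "emeasure \<mu> (ball 0 R) \<le> emeasure (coord_measure 0 n) (Pi\<^sub>E {0..<n} (\<lambda>_. {- (\<kappa> * R)..\<kappa> * R}))"
      unfolding \<mu>_def by (subst emeasure_distr) (auto intro!: emeasure_mono sets_PiM_I_finite)
    also have "\<dots> = (\<Prod>i\<in>{0..<n}. emeasure lborel {- (\<kappa> * R)..\<kappa> * R})"
      by (intro coord.emeasure_PiM) auto
    also have "\<dots> < \<infinity>"
      by (auto simp: ennreal_prod_eq_top less_top[symmetric] emeasure_lborel_Icc_eq power_eq_top_ennreal)
    finally show ?thesis .
  qed
  have inv: "distr \<mu> borel (\<lambda>x. a + x) = \<mu>" for a
  proof -
    obtain ss where ss: "length ss = n" "lincomb es ss = a"
      using lincomb_onto by blast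
    define S where "S = (\<lambda>\<xi>. \<lambda>i\<in>{0..<n}. ss ! i + \<xi> i)"
    have Sm [measurable]: "S \<in> measurable (coord_measure 0 n) (coord_measure 0 n)"
      unfolding S_def
    proof (rule measurable_restrict)
      fix i assume "i \<in> {0..<n}"
      then have [measurable]: "(\<lambda>\<xi>. \<xi> i) \<in> borel_measurable (coord_measure 0 n)"
        using coordinate_measurable by simp
      have "(\<lambda>\<xi>. ss ! i + \<xi> i) \<in> borel_measurable (coord_measure 0 n)" by measurable
      then show "(\<lambda>\<xi>. ss ! i + \<xi> i) \<in> measurable (coord_measure 0 n) lborel" by simp
    qed
    have TS: "point (S \<xi>) = a + point \<xi>" for \<xi>
    proof -
      have "point (S \<xi>) = (\<Sum>i<n. (ss ! i + \<xi> i) *\<^sub>R es ! i)"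
        unfolding point_eq S_def by (intro sum.cong) auto
      then show ?thesis
        using ss by (simp add: point_eq scaleR_add_left sum.distrib lincomb_nth[symmetric])
    qed
    have "distr \<mu> borel (\<lambda>x. a + x) = distr (coord_measure 0 n) borel (\<lambda>\<xi>. a + point \<xi>)"
      unfolding \<mu>_def by (subst distr_distr) (auto simp: comp_def)
    also have "\<dots> = distr (distr (coord_measure 0 n) (coord_measure 0 n) S) borel point"
      by (subst distr_distr) (auto simp: comp_def TS)
    also have "distr (coord_measure 0 n) (coord_measure 0 n) S = coord_measure 0 n"
      unfolding S_def by (rule coord_measure_shift)
    finally show ?thesis by (simp add: \<mu>_def)
  qed
  obtain c where c: "c < \<infinity>" "\<And>g. g \<in> borel_measurable borel \<Longrightarrow> (\<integral>\<^sup>+x. g x \<partial>\<mu>) = c * (\<integral>\<^sup>+x. g x \<partial>lborel)"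
    using translation_invariant_nn_integral[of \<mu>] fin inv unfolding \<mu>_def by (metis sets_distr)
  have int: "(\<integral>\<^sup>+\<xi>. g (point \<xi>) \<partial>coord_measure 0 n) = c * (\<integral>\<^sup>+x. g x \<partial>lborel)" if "g \<in> borel_measurable borel" for g
    using c(2)[OF that] that unfolding \<mu>_def by (simp add: nn_integral_distr)
  have "c \<noteq> 0"
  proof
    assume "c = 0"
    then have "emeasure (coord_measure 0 n) (space (coord_measure 0 n)) = 0"
      using int[of "\<lambda>_. 1"] by simp
    moreover have "emeasure (coord_measure 0 n) (Pi\<^sub>E {0..<n} (\<lambda>_. {0..1})) = (\<Prod>i\<in>{0..<n}. emeasure lborel {0..1::real})"
      by (intro coord.emeasure_PiM) auto
    moreover have "emeasure (coord_measure 0 n) (Pi\<^sub>E {0..<n} (\<lambda>_. {0..1})) \<le> emeasure (coord_measure 0 n) (space (coord_measure 0 n))"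
      by (rule emeasure_space)
    ultimately show False by simp
  qed
  then obtain c' where "c = ennreal c'" "0 < c'"
    using c(1) by (cases c) (auto simp: less_le)
  then show ?thesis using that[of c'] int by simp
qed

lemma AE_list_lincomb:
  assumes "AE x in lborel. P x"
  shows "AE_list 0 n (\<lambda>xs. P (lincomb es xs))"
proof -
  obtain c where c: "0 < c"
    "\<And>g. g \<in> borel_measurable borel \<Longrightarrow> (\<integral>\<^sup>+\<xi>. g (point \<xi>) \<partial>coord_measure 0 n) = ennreal c * (\<integral>\<^sup>+x. g x \<partial>lborel)"
    using coordinate_change by blast
  obtain S where S: "{x \<in> space lborel. \<not> P x} \<subseteq> S" "emeasure lborel S = 0" "S \<in> sets lborel"
    using AE_E[OF assms] by blast
  have "(\<lambda>x. indicator S x :: ennreal) \<in> borel_measurable borel" using S by simp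
  from c(2)[OF this] have "(\<integral>\<^sup>+\<xi>. indicator S (point \<xi>) \<partial>coord_measure 0 n) = 0"
    using S by simp
  moreover have "(\<lambda>\<xi>. indicator S (point \<xi>) :: ennreal) \<in> borel_measurable (coord_measure 0 n)"
    using measurable_compose[OF point_measurable, of "indicator S"] S by simp
  ultimately have "AE \<xi> in coord_measure 0 n. indicator S (point \<xi>) = (0::ennreal)"
    by (simp add: nn_integral_0_iff_AE)
  then show ?thesis
    unfolding AE_list_def
    by (rule eventually_mono) (use S in \<open>auto simp: indicator_def split: if_splits\<close>)
qed

lemma list_measurable_lincomb:
  "q \<in> borel_measurable borel \<Longrightarrow> list_measurable 0 n (\<lambda>xs. q (lincomb es xs))"
  unfolding list_measurable_def by (rule measurable_compose[OF point_measurable])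

lemma mnorm_cong: "AE x in lborel. q x = h x \<Longrightarrow> mnorm q = mnorm h"
  using ps by (intro iterated_Lp_norm_AE_cong[where k = 0 and n = n] AE_list_lincomb) auto

lemma borel_representative:
  assumes "q \<in> borel_measurable lebesgue"
  obtains q' where "q' \<in> borel_measurable borel" "AE x in lborel. q x = q' x" "mnorm q = mnorm (q' :: 'a \<Rightarrow> ennreal)"
proof -
  obtain q' where q': "q' \<in> borel_measurable lborel" "AE x in lborel. q x = q' x"
    using completion_ex_borel_measurable[OF assms] by blast
  then show ?thesis using that[of q'] mnorm_cong[OF q'(2)] by simp
qed

lemma mnorm_mono:
  assumes q: "q \<in> borel_measurable lebesgue" and le: "AE x in lborel. q x \<le> h x"
  shows "mnorm q \<le> mnorm h"
proof -
  obtain q' where q': "q' \<in> borel_measurable borel" "AE x in lborel. q x = q' x" "mnorm q = mnorm q'"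
    using borel_representative[OF q] by blast
  have "AE x in lborel. q' x \<le> h x"
    using le q'(2) by eventually_elim simp
  then have "mnorm q' \<le> mnorm h"
    using ps q'(1)
    by (intro iterated_Lp_norm_mono[where k = 0 and n = n] AE_list_lincomb list_measurable_lincomb) auto
  then show ?thesis using q'(3) by simp
qed

lemma mnorm_add:
  obtains K where "1 \<le> K" "\<And>q h. q \<in> borel_measurable lebesgue \<Longrightarrow> h \<in> borel_measurable lebesgue \<Longrightarrow>
    mnorm (\<lambda>x. q x + h x) \<le> ennreal K * (mnorm q + mnorm h)"
proof -
  obtain K where K: "1 \<le> K" "\<And>g h. list_measurable 0 n g \<Longrightarrow> list_measurable 0 n h \<Longrightarrow>
    iterated_Lp_norm ps (\<lambda>xs. g xs + h xs) \<le> ennreal K * (iterated_Lp_norm ps g + iterated_Lp_norm ps h)"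
    using iterated_Lp_norm_add[of ps n 0] ps by auto
  have "mnorm (\<lambda>x. q x + h x) \<le> ennreal K * (mnorm q + mnorm h)"
    if q: "q \<in> borel_measurable lebesgue" and h: "h \<in> borel_measurable lebesgue" for q h
  proof -
    obtain q' where q': "q' \<in> borel_measurable borel" "AE x in lborel. q x = q' x" "mnorm q = mnorm q'"
      using borel_representative[OF q] by blast
    obtain h' where h': "h' \<in> borel_measurable borel" "AE x in lborel. h x = h' x" "mnorm h = mnorm h'"
      using borel_representative[OF h] by blast
    have "AE x in lborel. q x + h x = q' x + h' x"
      using q'(2) h'(2) by eventually_elim simp
    then have "mnorm (\<lambda>x. q x + h x) = mnorm (\<lambda>x. q' x + h' x)" by (rule mnorm_cong)
    also have "\<dots> \<le> ennreal K * (mnorm q' + mnorm h')"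
      using q'(1) h'(1) by (intro K(2) list_measurable_lincomb)
    finally show ?thesis using q'(3) h'(3) by simp
  qed
  then show ?thesis using that K(1) by blast
qed

lemma mnorm_scale:
  assumes q: "q \<in> borel_measurable lebesgue" and c: "0 \<le> c"
  shows "mnorm (\<lambda>x. ennreal c * q x) = ennreal c * mnorm q"
proof -
  obtain q' where q': "q' \<in> borel_measurable borel" "AE x in lborel. q x = q' x" "mnorm q = mnorm q'"
    using borel_representative[OF q] by blast
  have "AE x in lborel. ennreal c * q x = ennreal c * q' x"
    using q'(2) by eventually_elim simp
  then have "mnorm (\<lambda>x. ennreal c * q x) = mnorm (\<lambda>x. ennreal c * q' x)" by (rule mnorm_cong)
  also have "\<dots> = ennreal c * mnorm q'"
    using ps q'(1) c by (intro iterated_Lp_norm_scale[where k = 0 and n = n] list_measurable_lincomb) auto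
  finally show ?thesis using q'(3) by simp
qed

text \<open>Fatou's lemma, which takes the place of completeness.\<close>

lemma mnorm_liminf:
  assumes q: "\<And>m. q m \<in> borel_measurable lebesgue"
  shows "mnorm (\<lambda>x. liminf (\<lambda>m. q m x)) \<le> liminf (\<lambda>m. mnorm (q m))"
proof -
  have "\<exists>q'. q' \<in> borel_measurable borel \<and> (AE x in lborel. q m x = q' x) \<and> mnorm (q m) = mnorm q'" for m
    using borel_representative[OF q] by metis
  then obtain q' where q': "\<And>m. q' m \<in> borel_measurable borel" "\<And>m. AE x in lborel. q m x = q' m x"
    "\<And>m. mnorm (q m) = mnorm (q' m)"
    by metis
  have "AE x in lborel. \<forall>m. q m x = q' m x"
    using q'(2) by (simp add: AE_all_countable)
  then have "AE x in lborel. liminf (\<lambda>m. q m x) = liminf (\<lambda>m. q' m x)"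
    by eventually_elim simp
  then have "mnorm (\<lambda>x. liminf (\<lambda>m. q m x)) = mnorm (\<lambda>x. liminf (\<lambda>m. q' m x))" by (rule mnorm_cong)
  also have "\<dots> \<le> liminf (\<lambda>m. mnorm (q' m))"
    using ps q'(1)
    by (intro iterated_Lp_norm_liminf[where k = 0 and n = n and g = "\<lambda>m xs. q' m (lincomb es xs)"] list_measurable_lincomb) auto
  finally show ?thesis using q'(3) by simp
qed

lemma mnorm_shift:
  assumes q: "q \<in> borel_measurable lebesgue"
  shows "mnorm (\<lambda>x. q (x - a)) = mnorm q"
proof -
  obtain q' where q': "q' \<in> borel_measurable borel" "AE x in lborel. q x = q' x" "mnorm q = mnorm q'"
    using borel_representative[OF q] by blast
  obtain ss where ss: "length ss = n" "lincomb es ss = - a"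
    using lincomb_onto by blast
  from subst[where P = "\<lambda>M. AE x in M. q x = q' x", OF lborel_distr_plus[symmetric, of "- a"] q'(2)]
  have "AE x in distr lborel borel ((+) (- a)). q x = q' x" .
  then have "AE x in lborel. q (- a + x) = q' (- a + x)"
    by (rule AE_distrD[rotated]) simp
  then have "mnorm (\<lambda>x. q (- a + x)) = mnorm (\<lambda>x. q' (- a + x))" by (rule mnorm_cong)
  also have "\<dots> = iterated_Lp_norm ps (\<lambda>xs. q' (lincomb es (map2 (+) xs ss)))"
    using ps ss
    by (intro iterated_Lp_norm_AE_cong[where k = 0 and n = n] AE_listI) (auto simp: lincomb_shift add.commute)
  also have "\<dots> = mnorm q'"
    using ps ss q'(1)
    by (intro iterated_Lp_norm_shift[where k = 0 and n = n and g = "\<lambda>xs. q' (lincomb es xs)"] list_measurable_lincomb) auto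
  finally show ?thesis using q'(3) by simp
qed

lemma mnorm_local:
  assumes r: "0 < r" "\<forall>p\<in>set ps. ennreal r \<le> p"
  obtains C where "0 \<le> C" "\<And>q. q \<in> borel_measurable lebesgue \<Longrightarrow>
    (\<integral>\<^sup>+x\<in>cball 0 R. ennreal_powr (q x) r \<partial>lborel) \<le> ennreal C * ennreal_powr (mnorm q) r"
proof -
  obtain \<kappa> where \<kappa>: "0 < \<kappa>" "\<And>\<xi> i. i < n \<Longrightarrow> \<bar>\<xi> i\<bar> \<le> \<kappa> * norm (point \<xi>)"
    using coordinate_bound by blast
  obtain c where c: "0 < c"
    "\<And>g. g \<in> borel_measurable borel \<Longrightarrow> (\<integral>\<^sup>+\<xi>. g (point \<xi>) \<partial>coord_measure 0 n) = ennreal c * (\<integral>\<^sup>+x. g x \<partial>lborel)"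
    using coordinate_change by blast
  define S where "S = \<kappa> * \<bar>R\<bar>"
  have S: "0 \<le> S" using \<kappa> by (simp add: S_def)
  define D where "D = (2 * S + 1) ^ length ps"
  have D: "0 \<le> D" using S by (simp add: D_def)
  have "(\<integral>\<^sup>+x\<in>cball 0 R. ennreal_powr (q x) r \<partial>lborel) \<le> ennreal (D / c) * ennreal_powr (mnorm q) r"
    if q: "q \<in> borel_measurable lebesgue" for q
  proof -
    obtain q' where q' [measurable]: "q' \<in> borel_measurable borel" and eq: "AE x in lborel. q x = q' x" "mnorm q = mnorm q'"
      using borel_representative[OF q] by blast
    have [measurable]: "cball (0::'a) R \<in> sets borel" by simp
    have "(\<integral>\<^sup>+x\<in>cball 0 R. ennreal_powr (q x) r \<partial>lborel) = (\<integral>\<^sup>+x\<in>cball 0 R. ennreal_powr (q' x) r \<partial>lborel)"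
      using eq(1) by (intro nn_integral_cong_AE) (auto elim: eventually_mono)
    also have "\<dots> = ennreal (1 / c) * (ennreal c * (\<integral>\<^sup>+x\<in>cball 0 R. ennreal_powr (q' x) r \<partial>lborel))"
      using c(1) by (simp add: mult.assoc[symmetric] flip: ennreal_mult)
    also have "ennreal c * (\<integral>\<^sup>+x\<in>cball 0 R. ennreal_powr (q' x) r \<partial>lborel) =
        (\<integral>\<^sup>+\<xi>. ennreal_powr (q' (point \<xi>)) r * indicator (cball 0 R) (point \<xi>) \<partial>coord_measure 0 n)"
    proof (rule c(2)[symmetric])
      show "(\<lambda>x. ennreal_powr (q' x) r * indicator (cball 0 R) x) \<in> borel_measurable borel" by measurable
    qed
    also have "\<dots> \<le> (\<integral>\<^sup>+\<xi>. (\<Prod>i\<in>{0..<n}. indicator {-S..S} (\<xi> i)) * ennreal_powr (q' (point \<xi>)) r \<partial>coord_measure 0 n)"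
    proof (rule nn_integral_mono)
      fix \<xi> :: "nat \<Rightarrow> real"
      have "(\<Prod>i\<in>{0..<n}. indicator {-S..S} (\<xi> i)) = (1::ennreal)" if "norm (point \<xi>) \<le> R"
      proof (rule prod.neutral, rule ballI)
        fix i assume "i \<in> {0..<n}"
        then have "\<bar>\<xi> i\<bar> \<le> \<kappa> * norm (point \<xi>)" using \<kappa>(2) by simp
        also have "\<dots> \<le> S" unfolding S_def using that \<kappa>(1) by (intro mult_left_mono) auto
        finally show "indicator {-S..S} (\<xi> i) = (1::ennreal)" by (simp add: indicator_def abs_le_iff)
      qed
      then show "ennreal_powr (q' (point \<xi>)) r * indicator (cball 0 R) (point \<xi>) \<le>
          (\<Prod>i\<in>{0..<n}. indicator {-S..S} (\<xi> i)) * ennreal_powr (q' (point \<xi>)) r"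
        by (auto simp: indicator_def)
    qed
    also have "\<dots> \<le> ennreal D * ennreal_powr (mnorm q') r"
      unfolding D_def using ps r S q'
      by (intro iterated_Lp_norm_local[where k = 0 and n = n and g = "\<lambda>xs. q' (lincomb es xs)"] list_measurable_lincomb) auto
    finally have "(\<integral>\<^sup>+x\<in>cball 0 R. ennreal_powr (q x) r \<partial>lborel) \<le> ennreal (1 / c) * (ennreal D * ennreal_powr (mnorm q') r)"
      by (simp add: mult_left_mono)
    also have "\<dots> = ennreal (D / c) * ennreal_powr (mnorm q) r"
      using c(1) D eq(2) by (simp add: mult.assoc[symmetric] flip: ennreal_mult)
    finally show ?thesis .
  qed
  moreover have "0 \<le> D / c" using D c(1) by simp
  ultimately show ?thesis using that by blast
qed

end

lemma Lp_norm_gaussian_finite: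
  assumes b: "0 < b" and p: "0 < p"
  shows "Lp_norm p (\<lambda>t. ennreal (exp (- b * t\<^sup>2))) < \<infinity>"
proof (cases "p = \<infinity>")
  case True
  have "esssup lebesgue (\<lambda>t::real. ennreal (exp (- b * t\<^sup>2))) \<le> ennreal 1"
    using b by (intro esssup_I AE_I2 measurable_completion) auto
  then show ?thesis using True by (auto simp: Lp_norm_def intro: le_less_trans)
next
  case False
  define q where "q = enn2real p"
  have q: "0 < q" using p False by (simp add: q_def enn2real_positive_iff less_top)
  define \<sigma> where "\<sigma> = sqrt (1 / (2 * b * q))"
  have \<sigma>: "0 < \<sigma>" "2 * \<sigma>\<^sup>2 = 1 / (b * q)" using b q by (auto simp: \<sigma>_def)
  have eq: "exp (- b * t\<^sup>2) powr q = sqrt (2 * pi * \<sigma>\<^sup>2) * normal_density 0 \<sigma> t" for t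
  proof -
    have "exp (- b * t\<^sup>2) powr q = exp (- (b * q) * t\<^sup>2)"
      by (simp add: powr_def mult_ac)
    also have "- (b * q) * t\<^sup>2 = - (t - 0)\<^sup>2 / (2 * \<sigma>\<^sup>2)"
      unfolding \<sigma>(2) by simp
    also have "exp \<dots> = sqrt (2 * pi * \<sigma>\<^sup>2) * normal_density 0 \<sigma> t"
      using \<sigma>(1) by (simp add: normal_density_def)
    finally show ?thesis .
  qed
  have "integrable lborel (\<lambda>t. exp (- b * t\<^sup>2) powr q)"
    unfolding eq using \<sigma>(1) by (intro integrable_mult_right integrable_normal_density)
  then have "(\<integral>\<^sup>+t. ennreal (exp (- b * t\<^sup>2) powr q) \<partial>lborel) < \<infinity>"
    by (simp add: integrable_iff_bounded)
  then obtain J where "(\<integral>\<^sup>+t. ennreal (exp (- b * t\<^sup>2) powr q) \<partial>lborel) = ennreal J" "0 \<le> J"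
    by (cases "\<integral>\<^sup>+t. ennreal (exp (- b * t\<^sup>2) powr q) \<partial>lborel") auto
  then show ?thesis
    using False by (simp add: Lp_norm_def nn_integral_completion ennreal_powr_ennreal flip: q_def)
qed

text \<open>The norm of a product of functions of one variable each factorizes.\<close>

lemma iterated_Lp_norm_gaussian_finite:
  assumes "0 < b" "\<forall>p\<in>set ps. 0 < p"
  shows "iterated_Lp_norm ps (\<lambda>xs. ennreal (prod_list (map (\<lambda>t. exp (- b * t\<^sup>2)) xs))) < \<infinity>"
  using assms(2)
proof (induction ps)
  case (Cons p ps)
  define G where "G = Lp_norm p (\<lambda>t. ennreal (exp (- b * t\<^sup>2)))"
  have p: "0 < p" using Cons.prems by simp
  have "G < \<infinity>" unfolding G_def by (rule Lp_norm_gaussian_finite[OF assms(1) p])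
  then obtain g where g: "G = ennreal g" "0 \<le> g" by (cases G) auto
  have "(\<lambda>xs. Lp_norm p (\<lambda>t. ennreal (prod_list (map (\<lambda>t. exp (- b * t\<^sup>2)) (t # xs))))) =
      (\<lambda>xs. ennreal g * ennreal (prod_list (map (\<lambda>t. exp (- b * t\<^sup>2)) xs)))"
  proof
    fix xs :: "real list"
    have nn: "0 \<le> prod_list (map (\<lambda>t. exp (- b * t\<^sup>2)) xs)"
      by (induction xs) auto
    have "Lp_norm p (\<lambda>t. ennreal (prod_list (map (\<lambda>t. exp (- b * t\<^sup>2)) xs)) * ennreal (exp (- b * t\<^sup>2))) =
        ennreal (prod_list (map (\<lambda>t. exp (- b * t\<^sup>2)) xs)) * G"
      unfolding G_def by (intro Lp_norm_scale nn p) measurable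
    then show "Lp_norm p (\<lambda>t. ennreal (prod_list (map (\<lambda>t. exp (- b * t\<^sup>2)) (t # xs)))) =
        ennreal g * ennreal (prod_list (map (\<lambda>t. exp (- b * t\<^sup>2)) xs))"
      using nn g by (simp add: ennreal_mult mult.commute)
  qed
  moreover have "iterated_Lp_norm ps (\<lambda>xs. ennreal g * ennreal (prod_list (map (\<lambda>t. exp (- b * t\<^sup>2)) xs))) =
      ennreal g * iterated_Lp_norm ps (\<lambda>xs. ennreal (prod_list (map (\<lambda>t. exp (- b * t\<^sup>2)) xs)))"
  proof (rule iterated_Lp_norm_scale[where k = 0 and n = "length ps"])
    show "list_measurable 0 (length ps) (\<lambda>xs. ennreal (prod_list (map (\<lambda>t. exp (- b * t\<^sup>2)) xs)))"
    proof -
      have "(\<lambda>\<xi>. ennreal (\<Prod>i\<in>{0..<length ps}. exp (- b * (\<xi> i)\<^sup>2))) \<in> borel_measurable (coord_measure 0 (length ps))"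
      proof (intro measurable_compose[OF _ measurable_ennreal] borel_measurable_prod)
        fix i assume "i \<in> {0..<length ps}"
        then have [measurable]: "(\<lambda>\<xi>. \<xi> i) \<in> borel_measurable (coord_measure 0 (length ps))"
          using coordinate_measurable by simp
        show "(\<lambda>\<xi>. exp (- b * (\<xi> i)\<^sup>2)) \<in> borel_measurable (coord_measure 0 (length ps))"
          by measurable
      qed
      moreover have "(\<Prod>i\<in>{0..<length ps}. exp (- b * (\<xi> i)\<^sup>2)) =
          prod_list (map (\<lambda>t. exp (- b * t\<^sup>2)) (map \<xi> [0..<length ps]))" for \<xi> :: "nat \<Rightarrow> real"
        using prod.distinct_set_conv_list[of "[0..<length ps]" "\<lambda>i. exp (- b * (\<xi> i)\<^sup>2)"]
        by (simp add: comp_def)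
      ultimately show ?thesis
        unfolding list_measurable_def by (simp only:)
    qed
  qed (use Cons.prems g in auto)
  ultimately show ?case
    using Cons by (auto simp: ennreal_mult_less_top)
qed simp

section \<open>Mixed Lebesgue spaces\<close>

lemma lebesgue_measurable_shift:
  fixes f :: "'a::euclidean_space \<Rightarrow> 'b::topological_space"
  assumes "f \<in> borel_measurable lebesgue"
  shows "(\<lambda>y. f (y - x)) \<in> borel_measurable lebesgue"
proof -
  have "(\<lambda>y. - x + y) \<in> lebesgue \<rightarrow>\<^sub>M lebesgue"
    using lebesgue_affine_measurable[of "\<lambda>_. 1" "- x"] by (simp add: euclidean_representation)
  from measurable_compose[OF this assms] show ?thesis by simp
qed

context mixed_Lebesgue_data
begin

text \<open>In coordinates, \<open>|x|\<^sup>2\<close> is at least a multiple of the sum of the squares of the coordinates, so the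
Gaussian is dominated by a product of one-dimensional Gaussians.\<close>

lemma mnorm_gaussian_finite:
  assumes s: "0 < s"
  shows "mnorm (\<lambda>x. ennreal (exp (- s * (norm x)\<^sup>2))) < \<infinity>"
proof -
  obtain \<kappa> where \<kappa>: "0 < \<kappa>" "\<And>\<xi> i. i < n \<Longrightarrow> \<bar>\<xi> i\<bar> \<le> \<kappa> * norm (point \<xi>)"
    using coordinate_bound by blast
  define b where "b = s / (real n * \<kappa>\<^sup>2 + 1)"
  have pos: "real n * \<kappa>\<^sup>2 + 1 > 0" by (intro add_nonneg_pos) auto
  have b: "0 < b" using s pos by (simp add: b_def)
  have "mnorm (\<lambda>x. ennreal (exp (- s * (norm x)\<^sup>2))) \<le>
      iterated_Lp_norm ps (\<lambda>xs. ennreal (prod_list (map (\<lambda>t. exp (- b * t\<^sup>2)) xs)))"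
  proof (intro iterated_Lp_norm_mono[where k = 0 and n = n] AE_listI list_measurable_lincomb)
    fix \<xi> :: "nat \<Rightarrow> real"
    have "(\<Sum>i<n. (\<xi> i)\<^sup>2) \<le> (\<Sum>i<n. \<kappa>\<^sup>2 * (norm (point \<xi>))\<^sup>2)"
    proof (rule sum_mono)
      fix i assume "i \<in> {..<n}"
      then have "\<bar>\<xi> i\<bar> \<le> \<kappa> * norm (point \<xi>)" using \<kappa>(2) by simp
      from power_mono[OF this abs_ge_zero, of 2]
      show "(\<xi> i)\<^sup>2 \<le> \<kappa>\<^sup>2 * (norm (point \<xi>))\<^sup>2" by (simp add: power_mult_distrib)
    qed
    also have "\<dots> \<le> (real n * \<kappa>\<^sup>2 + 1) * (norm (point \<xi>))\<^sup>2"
      by (simp add: algebra_simps)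
    finally have "b * (\<Sum>i<n. (\<xi> i)\<^sup>2) \<le> b * ((real n * \<kappa>\<^sup>2 + 1) * (norm (point \<xi>))\<^sup>2)"
      using b by (intro mult_left_mono) auto
    also have "\<dots> = s * (norm (point \<xi>))\<^sup>2"
      using pos by (simp add: b_def)
    finally have "exp (- s * (norm (point \<xi>))\<^sup>2) \<le> exp (\<Sum>i<n. - b * (\<xi> i)\<^sup>2)"
      by (simp add: sum_distrib_left sum_negf)
    also have "exp (\<Sum>i<n. - b * (\<xi> i)\<^sup>2) = (\<Prod>i<n. exp (- b * (\<xi> i)\<^sup>2))"
      by (rule exp_sum) simp
    also have "\<dots> = prod_list (map (\<lambda>t. exp (- b * t\<^sup>2)) (map \<xi> [0..<n]))"
      using prod.distinct_set_conv_list[of "[0..<n]" "\<lambda>i. exp (- b * (\<xi> i)\<^sup>2)"]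
      by (simp add: comp_def atLeast0LessThan)
    finally show "ennreal (exp (- s * (norm (point \<xi>))\<^sup>2)) \<le> ennreal (prod_list (map (\<lambda>t. exp (- b * t\<^sup>2)) (map \<xi> [0..<n])))"
      by (rule ennreal_leI)
  qed (use ps in auto)
  also have "\<dots> < \<infinity>"
    by (rule iterated_Lp_norm_gaussian_finite[OF b ps(2)])
  finally show ?thesis .
qed

text \<open>The local integrability exponent; the insertion of \<open>1\<close> keeps it finite when all exponents are \<open>\<infinity>\<close>.\<close>

abbreviation rmin :: real where "rmin \<equiv> enn2real (Min (insert 1 (set ps)))"

abbreviation fnorm :: "('a \<Rightarrow> complex) \<Rightarrow> ennreal" where "fnorm f \<equiv> mnorm (\<lambda>x. ennreal (norm (f x)))"

lemma mixed_norm_eq: "mixed_norm es ps f = fnorm f"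
  by (simp add: mixed_norm_def lincomb_def)

lemma rmin: "0 < rmin" "rmin \<le> 1" "\<forall>p\<in>set ps. ennreal rmin \<le> p"
proof -
  define m where "m = Min (insert 1 (set ps))"
  have m: "0 < m" "m \<le> 1" "\<forall>p\<in>set ps. m \<le> p"
    unfolding m_def using ps by (auto simp: Min_gr_iff)
  then have "m < \<infinity>" by (auto intro: le_less_trans)
  then obtain r where r: "m = ennreal r" "0 \<le> r" by (cases m) auto
  then show "0 < rmin" "rmin \<le> 1" "\<forall>p\<in>set ps. ennreal rmin \<le> p"
    using m unfolding m_def[symmetric] by auto
qed

lemma norm_measurable:
  "f \<in> borel_measurable lebesgue \<Longrightarrow> (\<lambda>x. ennreal (norm (f x))) \<in> borel_measurable lebesgue"
  for f :: "'a \<Rightarrow> complex"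
  by measurable

lemma fnorm_local:
  obtains C where "0 \<le> C" "\<And>f. f \<in> borel_measurable lebesgue \<Longrightarrow> fnorm f < \<infinity> \<Longrightarrow>
    (\<integral>\<^sup>+x\<in>cball 0 R. ennreal (norm (f x) powr rmin) \<partial>lborel) \<le> ennreal (C * enn2real (fnorm f) powr rmin)"
proof -
  obtain C where C: "0 \<le> C" "\<And>q. q \<in> borel_measurable lebesgue \<Longrightarrow>
    (\<integral>\<^sup>+x\<in>cball 0 R. ennreal_powr (q x) rmin \<partial>lborel) \<le> ennreal C * ennreal_powr (mnorm q) rmin"
    using mnorm_local[OF rmin(1,3)] by blast
  have "(\<integral>\<^sup>+x\<in>cball 0 R. ennreal (norm (f x) powr rmin) \<partial>lborel) \<le> ennreal (C * enn2real (fnorm f) powr rmin)"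
    if f: "f \<in> borel_measurable lebesgue" and fin: "fnorm f < \<infinity>" for f
  proof -
    obtain t where t: "fnorm f = ennreal t" "0 \<le> t" using fin by (cases "fnorm f") auto
    show ?thesis
      using C(2)[OF norm_measurable[OF f]] C(1) t by (simp add: ennreal_powr_ennreal ennreal_mult)
  qed
  then show ?thesis using that C(1) by blast
qed

lemma mem_mixed_LebesgueD:
  "f \<in> mixed_Lebesgue es ps \<Longrightarrow> f \<in> borel_measurable lebesgue \<and> fnorm f < \<infinity>"
  unfolding mixed_Lebesgue_def Lloc_def mixed_norm_eq mem_Collect_eq
  by (elim conjE) (rule conjI)

text \<open>Local integrability follows from finiteness of the quasi-norm, by the estimate on cubes.\<close>

lemma mem_mixed_Lebesgue: "f \<in> mixed_Lebesgue es ps \<longleftrightarrow> f \<in> borel_measurable lebesgue \<and> fnorm f < \<infinity>"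
proof (rule iffI, rule mem_mixed_LebesgueD)
  assume f: "f \<in> borel_measurable lebesgue \<and> fnorm f < \<infinity>"
  have "(\<integral>\<^sup>+x\<in>A. ennreal (norm (f x) powr rmin) \<partial>lebesgue) < \<infinity>" if A: "compact A" for A
  proof -
    obtain R where "\<forall>x\<in>A. norm x \<le> R"
      using compact_imp_bounded[OF A] unfolding bounded_iff by blast
    then have R: "A \<subseteq> cball 0 R" by auto
    obtain C where C: "(\<integral>\<^sup>+x\<in>cball 0 R. ennreal (norm (f x) powr rmin) \<partial>lborel) \<le> ennreal (C * enn2real (fnorm f) powr rmin)"
    proof (rule fnorm_local[of R])
      fix C :: real
      assume "\<And>g. g \<in> borel_measurable lebesgue \<Longrightarrow> fnorm g < \<infinity> \<Longrightarrow>
        (\<integral>\<^sup>+x\<in>cball 0 R. ennreal (norm (g x) powr rmin) \<partial>lborel) \<le> ennreal (C * enn2real (fnorm g) powr rmin)"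
      from this[of f] show ?thesis using f by (intro that) blast
    qed
    have "(\<integral>\<^sup>+x\<in>A. ennreal (norm (f x) powr rmin) \<partial>lborel) \<le> (\<integral>\<^sup>+x\<in>cball 0 R. ennreal (norm (f x) powr rmin) \<partial>lborel)"
      using R by (intro nn_integral_mono) (auto simp: indicator_def)
    also note C
    also have "ennreal (C * enn2real (fnorm f) powr rmin) < \<infinity>" by simp
    finally show ?thesis
      by (simp only: nn_integral_completion)
  qed
  then have "\<forall>A. compact A \<longrightarrow> (\<integral>\<^sup>+x\<in>A. ennreal (norm (f x) powr rmin) \<partial>lebesgue) < \<infinity>"
    by (intro allI impI)
  then show "f \<in> mixed_Lebesgue es ps"
    unfolding mixed_Lebesgue_def Lloc_def mixed_norm_eq mem_Collect_eq
    using f by simp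
qed

lemma fnorm_enn2real: "fnorm f < \<infinity> \<Longrightarrow> fnorm f = ennreal (enn2real (fnorm f))"
  by (rule ennreal_enn2real[symmetric, unfolded infinity_ennreal_def[symmetric]])

lemma quasi_Banach:
  "\<exists>K. quasi_Banach_function_space (mixed_Lebesgue es ps) (\<lambda>f. enn2real (mixed_norm es ps f)) rmin K"
proof -
  let ?B = "mixed_Lebesgue es ps" and ?N = "\<lambda>f. enn2real (mixed_norm es ps f)"
  obtain K where K: "1 \<le> K" "\<And>q h. q \<in> borel_measurable lebesgue \<Longrightarrow> h \<in> borel_measurable lebesgue \<Longrightarrow>
    mnorm (\<lambda>x. q x + h x) \<le> ennreal K * (mnorm q + mnorm h)"
    using mnorm_add by blast
  note mem = mem_mixed_Lebesgue and NE = mixed_norm_eq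
  have solid: "f \<in> ?B \<and> ?N f \<le> K * ?N g"
    if g: "g \<in> ?B" and f: "f \<in> borel_measurable lebesgue" and le: "AE x in lebesgue. norm (f x) \<le> norm (g x)" for f g
  proof -
    have gm: "g \<in> borel_measurable lebesgue" "fnorm g < \<infinity>" using g by (auto simp: mem)
    have "AE x in lborel. ennreal (norm (f x)) \<le> ennreal (norm (g x))"
      using le unfolding AE_completion_iff by (rule eventually_mono) (rule ennreal_leI)
    then have le': "fnorm f \<le> fnorm g"
      by (rule mnorm_mono[OF norm_measurable[OF f]])
    then have "fnorm f < \<infinity>" using gm(2) by (rule le_less_trans)
    moreover have "enn2real (fnorm f) \<le> enn2real (fnorm g)"
      using le' gm(2) by (intro enn2real_mono) auto
    moreover have "enn2real (fnorm g) \<le> K * enn2real (fnorm g)"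
      using K(1) mult_right_mono[of 1 K "enn2real (fnorm g)"] by simp
    ultimately show ?thesis using f by (simp add: mem NE)
  qed
  have add: "(\<lambda>x. f x + g x) \<in> ?B \<and> ?N (\<lambda>x. f x + g x) \<le> K * (?N f + ?N g)"
    if f: "f \<in> ?B" and g: "g \<in> ?B" for f g
  proof -
    have fm: "f \<in> borel_measurable lebesgue" "fnorm f < \<infinity>" and gm: "g \<in> borel_measurable lebesgue" "fnorm g < \<infinity>"
      using f g by (auto simp: mem)
    have fg: "(\<lambda>x. f x + g x) \<in> borel_measurable lebesgue"
      using fm gm by measurable
    have "fnorm (\<lambda>x. f x + g x) \<le> mnorm (\<lambda>x. ennreal (norm (f x)) + ennreal (norm (g x)))"
      by (intro mnorm_mono norm_measurable fg AE_I2)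
        (simp add: ennreal_plus[symmetric] norm_triangle_ineq ennreal_leI del: ennreal_plus)
    also have "\<dots> \<le> ennreal K * (fnorm f + fnorm g)"
      by (intro K(2) norm_measurable fm gm)
    also have "\<dots> = ennreal (K * (enn2real (fnorm f) + enn2real (fnorm g)))"
    proof -
      have "ennreal K * (ennreal s + ennreal t) = ennreal (K * (s + t))" if "0 \<le> s" "0 \<le> t" for s t
        using that K(1) by (simp add: ennreal_mult)
      then show ?thesis
        by (subst fnorm_enn2real[OF fm(2)], subst fnorm_enn2real[OF gm(2)]) simp
    qed
    finally have le: "fnorm (\<lambda>x. f x + g x) \<le> ennreal (K * (enn2real (fnorm f) + enn2real (fnorm g)))" .
    then have "fnorm (\<lambda>x. f x + g x) < \<infinity>" by (rule le_less_trans) simp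
    moreover have "enn2real (fnorm (\<lambda>x. f x + g x)) \<le> K * (enn2real (fnorm f) + enn2real (fnorm g))"
      using enn2real_mono[OF le] K(1) by simp
    ultimately show ?thesis using fg by (simp add: mem NE)
  qed
  have scale: "(\<lambda>x. a * f x) \<in> ?B \<and> ?N (\<lambda>x. a * f x) \<le> norm a * ?N f" if f: "f \<in> ?B" for f a
  proof -
    have fm: "f \<in> borel_measurable lebesgue" "fnorm f < \<infinity>" using f by (auto simp: mem)
    have af: "(\<lambda>x. a * f x) \<in> borel_measurable lebesgue" using fm by measurable
    have "fnorm (\<lambda>x. a * f x) = mnorm (\<lambda>x. ennreal (norm a) * ennreal (norm (f x)))"
      by (simp add: norm_mult ennreal_mult)
    also have "\<dots> = ennreal (norm a) * fnorm f"
      by (intro mnorm_scale norm_measurable fm) simp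
    finally have eq: "fnorm (\<lambda>x. a * f x) = ennreal (norm a) * fnorm f" .
    then have "fnorm (\<lambda>x. a * f x) < \<infinity>"
      using fm(2) by (simp add: ennreal_mult_less_top)
    then show ?thesis using af eq by (simp add: mem NE enn2real_mult)
  qed
  have diff: "(\<lambda>x. f x - g x) \<in> ?B" if "f \<in> ?B" "g \<in> ?B" for f g
    using add[OF that(1) scale[OF that(2), of "- 1", THEN conjunct1]] by simp
  have local': "\<exists>C\<ge>0. \<forall>f\<in>?B. (\<integral>\<^sup>+x\<in>cball 0 R. ennreal (norm (f x) powr rmin) \<partial>lborel) \<le> ennreal (C * ?N f powr rmin)" for R
  proof (rule fnorm_local[of R])
    fix C :: real assume C: "0 \<le> C" "\<And>g. g \<in> borel_measurable lebesgue \<Longrightarrow> fnorm g < \<infinity> \<Longrightarrow>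
      (\<integral>\<^sup>+x\<in>cball 0 R. ennreal (norm (g x) powr rmin) \<partial>lborel) \<le> ennreal (C * enn2real (fnorm g) powr rmin)"
    show ?thesis
      unfolding NE using C by (intro exI[of _ C] conjI ballI) (simp_all add: mem)
  qed
  have gaussian: "(\<lambda>x. of_real (exp (- s * (norm x)\<^sup>2))) \<in> ?B" if "0 < s" for s
    using mnorm_gaussian_finite[OF that] by (auto simp: mem intro!: measurable_completion)
  have limit: "g \<in> ?B \<and> (\<lambda>n. ?N (\<lambda>x. F n x - g x)) \<longlonglongrightarrow> 0"
    if F: "\<And>n::nat. F n \<in> ?B"
      and cauchy: "\<And>e. 0 < e \<Longrightarrow> \<exists>M. \<forall>m\<ge>M. \<forall>n\<ge>M. ?N (\<lambda>x. F m x - F n x) < e"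
      and g: "g \<in> borel_measurable lebesgue" and lim: "AE x in lebesgue. (\<lambda>n. F n x) \<longlonglongrightarrow> g x" for F g
  proof -
    have Fm: "F i \<in> borel_measurable lebesgue" for i using F by (auto simp: mem)
    have dm: "(\<lambda>x. F i x - F m x) \<in> borel_measurable lebesgue" for i m
      using Fm by measurable
    have gm: "(\<lambda>x. F i x - g x) \<in> borel_measurable lebesgue" for i
      using Fm g by measurable
    (* By Fatou, the quasi-norm of F i - g is at most the lower limit of those of F i - F m. *)
    have key: "\<exists>M. \<forall>i\<ge>M. fnorm (\<lambda>x. F i x - g x) \<le> ennreal e" if e: "0 < e" for e
    proof -
      obtain M where M: "\<And>i m. i \<ge> M \<Longrightarrow> m \<ge> M \<Longrightarrow> ?N (\<lambda>x. F i x - F m x) < e"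
        using cauchy[OF e] by blast
      have "fnorm (\<lambda>x. F i x - g x) \<le> ennreal e" if i: "i \<ge> M" for i
      proof -
        have "AE x in lborel. ennreal (norm (F i x - g x)) = liminf (\<lambda>m. ennreal (norm (F i x - F m x)))"
          using lim unfolding AE_completion_iff
        proof (rule eventually_mono)
          fix x assume "(\<lambda>n. F n x) \<longlonglongrightarrow> g x"
          then have "(\<lambda>m. ennreal (norm (F i x - F m x))) \<longlonglongrightarrow> ennreal (norm (F i x - g x))"
            by (intro tendsto_ennrealI tendsto_intros)
          from lim_imp_Liminf[OF trivial_limit_sequentially this] show "ennreal (norm (F i x - g x)) = liminf (\<lambda>m. ennreal (norm (F i x - F m x)))"
            by (rule sym)
        qed
        then have "fnorm (\<lambda>x. F i x - g x) = mnorm (\<lambda>x. liminf (\<lambda>m. ennreal (norm (F i x - F m x))))"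
          by (rule mnorm_cong)
        also have "\<dots> \<le> liminf (\<lambda>m. fnorm (\<lambda>x. F i x - F m x))"
          by (intro mnorm_liminf norm_measurable dm)
        also have "\<dots> \<le> liminf (\<lambda>m. ennreal e)"
        proof (rule Liminf_mono)
          show "\<forall>\<^sub>F m in sequentially. fnorm (\<lambda>x. F i x - F m x) \<le> ennreal e"
            using eventually_ge_at_top[of M]
          proof eventually_elim
            case (elim m)
            have "fnorm (\<lambda>x. F i x - F m x) < \<infinity>"
              using diff[OF F[of i] F[of m]] unfolding mem by (rule conjunct2)
            then have eq: "fnorm (\<lambda>x. F i x - F m x) = ennreal (enn2real (fnorm (\<lambda>x. F i x - F m x)))"
              by (rule fnorm_enn2real)
            show ?case
              by (subst eq, rule ennreal_leI, rule less_imp_le, rule M[OF i elim, unfolded NE])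
          qed
        qed
        also have "\<dots> = ennreal e" by (simp add: Liminf_const)
        finally show ?thesis .
      qed
      then show ?thesis by blast
    qed
    have "g \<in> ?B"
    proof -
      obtain i where "fnorm (\<lambda>x. F i x - g x) \<le> ennreal 1"
        using key[of 1] by auto
      then have "fnorm (\<lambda>x. F i x - g x) < \<infinity>" by (rule le_less_trans) simp
      then have "(\<lambda>x. F i x - g x) \<in> ?B" using gm by (simp add: mem)
      from diff[OF F[of i] this] show ?thesis by simp
    qed
    moreover have "(\<lambda>n. ?N (\<lambda>x. F n x - g x)) \<longlonglongrightarrow> 0"
    proof (rule LIMSEQ_I)
      fix e :: real assume e: "0 < e"
      obtain M where M: "\<And>i. i \<ge> M \<Longrightarrow> fnorm (\<lambda>x. F i x - g x) \<le> ennreal (e / 2)"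
        using key[of "e / 2"] e by auto
      have "norm (?N (\<lambda>x. F i x - g x) - 0) < e" if "i \<ge> M" for i
      proof -
        have "enn2real (fnorm (\<lambda>x. F i x - g x)) \<le> e / 2"
          using enn2real_mono[OF M[OF that]] e by simp
        then show ?thesis using e by (simp add: NE)
      qed
      then show "\<exists>M. \<forall>i\<ge>M. norm (?N (\<lambda>x. F i x - g x) - 0) < e" by blast
    qed
    ultimately show ?thesis by blast
  qed
  have meas: "f \<in> borel_measurable lebesgue" if "f \<in> ?B" for f using that by (simp add: mem)
  have nonneg: "0 \<le> ?N f" for f by simp
  have "quasi_Banach_function_space ?B ?N rmin K"
    by (rule quasi_Banach_function_space.intro)
      (fact rmin(1), fact rmin(2), fact K(1), fact meas, rule nonneg, fact solid, fact add, fact scale,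
       fact local', fact gaussian, fact limit)
  then show ?thesis by blast
qed

lemma translation_bounded:
  "\<exists>C. \<forall>x. \<forall>f\<in>mixed_Lebesgue es ps. (\<lambda>y. f (y - x)) \<in> mixed_Lebesgue es ps \<and>
    enn2real (mixed_norm es ps (\<lambda>y. f (y - x))) \<le> C * enn2real (mixed_norm es ps f)"
proof (intro exI[of _ 1] allI ballI)
  fix x f assume "f \<in> mixed_Lebesgue es ps"
  then have "f \<in> borel_measurable lebesgue \<and> fnorm f < \<infinity>"
    unfolding mem_mixed_Lebesgue .
  then have f: "f \<in> borel_measurable lebesgue" "fnorm f < \<infinity>"
    by (rule conjunct1, rule conjunct2)
  have eq: "fnorm (\<lambda>y. f (y - x)) = fnorm f"
    by (rule mnorm_shift[OF norm_measurable[OF f(1)]])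
  have "(\<lambda>y. f (y - x)) \<in> borel_measurable lebesgue"
    using f(1) by (rule lebesgue_measurable_shift)
  then show "(\<lambda>y. f (y - x)) \<in> mixed_Lebesgue es ps \<and>
    enn2real (mixed_norm es ps (\<lambda>y. f (y - x))) \<le> 1 * enn2real (mixed_norm es ps f)"
    unfolding mem_mixed_Lebesgue mixed_norm_eq eq mult_1 using f(2) order_refl by blast
qed

end

section \<open>Compactness criteria for embeddings of modulation spaces\<close>

theorem theorem3p9:
  fixes \<omega>\<^sub>1 \<omega>\<^sub>2 v :: "(real ^ 'd::finite) \<times> (real ^ 'd) \<Rightarrow> real"
    and B :: "((real ^ 'd) \<times> (real ^ 'd) \<Rightarrow> complex) set"
    and N :: "((real ^ 'd) \<times> (real ^ 'd) \<Rightarrow> complex) \<Rightarrow> real"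
  assumes "\<omega>\<^sub>1 \<in> PQ_weights" and "\<omega>\<^sub>2 \<in> PQ_weights"
    and "v \<in> moderate_weights" and "submultiplicative v"
    and "invariant_BF_space v B N \<or> mixed_Lebesgue_space B N"
  shows "((\<lambda>X. \<omega>\<^sub>2 X / \<omega>\<^sub>1 X) \<in> Linfty0 \<longrightarrow>
      compact_map (modulation_space \<omega>\<^sub>1 B) (modulation_norm \<omega>\<^sub>1 N)
        (modulation_space \<omega>\<^sub>2 B) (modulation_norm \<omega>\<^sub>2 N) (\<lambda>f. f)) \<and>
    (\<omega>\<^sub>1 \<in> moderate_weights \<and> \<omega>\<^sub>2 \<in> moderate_weights \<and> bounded (range v) \<longrightarrow>
      (compact_map (modulation_space \<omega>\<^sub>1 B) (modulation_norm \<omega>\<^sub>1 N)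
        (modulation_space \<omega>\<^sub>2 B) (modulation_norm \<omega>\<^sub>2 N) (\<lambda>f. f) \<longleftrightarrow>
       (\<lambda>X. \<omega>\<^sub>2 X / \<omega>\<^sub>1 X) \<in> Linfty0))"
proof -
  have w: "weight \<omega>\<^sub>1" "weight \<omega>\<^sub>2"
    using assms by (auto simp: PQ_weights_def)
  have "\<exists>r K. quasi_Banach_function_space B N r K \<and>
      (bounded (range v) \<longrightarrow> (\<exists>C. \<forall>x. \<forall>f\<in>B. (\<lambda>y. f (y - x)) \<in> B \<and> N (\<lambda>y. f (y - x)) \<le> C * N f))"
    using assms(5)
  proof
    assume "invariant_BF_space v B N"
    then interpret invariant_BF_space v B N .
    show ?thesis using quasi_Banach translation_bounded by blast
  next
    assume "mixed_Lebesgue_space B N"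
    then obtain es ps where data: "distinct es" "independent (set es)" "span (set es) = UNIV"
      "length ps = length es" "\<forall>p\<in>set ps. 0 < p"
      and BN: "B = mixed_Lebesgue es ps" "N = (\<lambda>f. enn2real (mixed_norm es ps f))"
      unfolding mixed_Lebesgue_space_def by blast
    interpret mixed_Lebesgue_data es ps by standard (use data in auto)
    show ?thesis unfolding BN using quasi_Banach translation_bounded by blast
  qed
  then obtain r K where q: "quasi_Banach_function_space B N r K"
    and t: "bounded (range v) \<Longrightarrow> \<exists>C. \<forall>x. \<forall>f\<in>B. (\<lambda>y. f (y - x)) \<in> B \<and> N (\<lambda>y. f (y - x)) \<le> C * N f"
    by blast
  have 1: "compact_map (modulation_space \<omega>\<^sub>1 B) (modulation_norm \<omega>\<^sub>1 N)
        (modulation_space \<omega>\<^sub>2 B) (modulation_norm \<omega>\<^sub>2 N) (\<lambda>f. f)"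
    if "(\<lambda>X. \<omega>\<^sub>2 X / \<omega>\<^sub>1 X) \<in> Linfty0"
    using modulation_embedding_compact[OF q w that] .
  have 2: "(\<lambda>X. \<omega>\<^sub>2 X / \<omega>\<^sub>1 X) \<in> Linfty0"
    if "\<omega>\<^sub>1 \<in> moderate_weights" "\<omega>\<^sub>2 \<in> moderate_weights" "bounded (range v)"
      "compact_map (modulation_space \<omega>\<^sub>1 B) (modulation_norm \<omega>\<^sub>1 N)
        (modulation_space \<omega>\<^sub>2 B) (modulation_norm \<omega>\<^sub>2 N) (\<lambda>f. f)"
    using compact_modulation_embedding_ratio[OF q t[OF that(3)] that(1,2,4)] .
  show ?thesis using 1 2 by blast
qed

end
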